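(* Let $(M,g)$, $M=\mathbb{R}\times S$, be an SOM-spacetime with Fermat metric $F$ and pre-distance $d_F$. Then $(M,g)$ is causal if and only if $d_F(x,x)=0$ for all $x\in S$ and there is no non-trivial (i.e. non-constant) closed curve $c$ in $S$ with $\ell_F(c)=0$.
   Context: An SOM-spacetime is a product $M=\mathbb{R}\times S$ ($S$ a connected smooth manifold) with the Lorentzian metric $g=-\beta\,dt\otimes dt+dt\otimes\omega+\omega\otimes dt+g_0$, where $\beta:S\to(0,\infty)$ is a smooth function, $\omega$ a one-form on $S$, $g_0$ a symmetric $(0,2)$-tensor on $S$, and $g_0(v,v)+\frac1\beta\omega(v)^2>0$ for every nonzero $v\in TS$; it is time-oriented by the timelike Killing field $\partial_t$. Its Fermat metric is $F(v)=\frac1\beta\omega(v)+\sqrt{\frac1{\beta^2}\omega(v)^2+\frac1\beta g_0(v,v)}$. The pre-distance $d_F(x_0,x_1)\in\mathbb{R}\cup\{-\infty\}$ is the infimum of $\ell_F(c)=\int F(\dot c)\,ds$ over piecewise smooth curves $c$ from $x_0$ to $x_1$ (constant curves allowed). $(M,g)$ is causal if it contains no closed causal curve. *)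

theory Defs
  imports "HOL-Analysis.Analysis"
begin

section \<open>Smooth functions\<close>

text \<open>
  Used only for \<open>S\<close> open in a Euclidean space, or \<open>S\<close> relatively open in a nondegenerate
  real interval; in both cases derivatives within \<open>S\<close> are unique.  At an endpoint of an
  interval they are one-sided.
\<close>

fun higher_differentiable_on ::
  "'a::real_normed_vector set \<Rightarrow> ('a \<Rightarrow> 'b::real_normed_vector) \<Rightarrow> nat \<Rightarrow> bool" where
  "higher_differentiable_on S f 0 \<longleftrightarrow> continuous_on S f"
| "higher_differentiable_on S f (Suc n) \<longleftrightarrow>
     (\<forall>x\<in>S. f differentiable (at x within S)) \<and>
     (\<forall>v. higher_differentiable_on S (\<lambda>x. frechet_derivative f (at x within S) v) n)"

definition smooth_on ::
  "'a::real_normed_vector set \<Rightarrow> ('a \<Rightarrow> 'b::real_normed_vector) \<Rightarrow> bool" where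
  "smooth_on S f \<longleftrightarrow> (\<forall>n. higher_differentiable_on S f n)"


section \<open>Smooth manifolds\<close>

text \<open>
  A manifold is the whole of a (Hausdorff, second countable) type \<open>'a\<close> together with a smooth,
  not necessarily maximal, atlas \<open>A\<close>.  A chart is a pair \<open>(U, \<phi>)\<close>; the values of \<open>\<phi>\<close> outside
  \<open>U\<close> are irrelevant.
\<close>

type_synonym ('a, 'e) chart = "'a set \<times> ('a \<Rightarrow> 'e)"

abbreviation chart_dom :: "('a, 'e) chart \<Rightarrow> 'a set" where
  "chart_dom c \<equiv> fst c"

abbreviation chart_map :: "('a, 'e) chart \<Rightarrow> 'a \<Rightarrow> 'e" where
  "chart_map c \<equiv> snd c"

abbreviation chart_inv :: "('a, 'e) chart \<Rightarrow> 'e \<Rightarrow> 'a" where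
  "chart_inv c \<equiv> inv_into (chart_dom c) (chart_map c)"

abbreviation chart_image :: "('a, 'e) chart \<Rightarrow> 'e set" where
  "chart_image c \<equiv> chart_map c ` chart_dom c"

definition smooth_atlas ::
  "('a::{t2_space, second_countable_topology}, 'e::euclidean_space) chart set \<Rightarrow> bool" where
  "smooth_atlas A \<longleftrightarrow>
     (\<Union>c\<in>A. chart_dom c) = UNIV \<and>
     (\<forall>c\<in>A. open (chart_dom c) \<and> open (chart_image c) \<and>
        homeomorphism (chart_dom c) (chart_image c) (chart_map c) (chart_inv c)) \<and>
     (\<forall>c\<in>A. \<forall>d\<in>A.
        smooth_on (chart_map c ` (chart_dom c \<inter> chart_dom d)) (chart_map d \<circ> chart_inv c))"

text \<open>
  A tangent vector at \<open>p\<close> assigns to every chart around \<open>p\<close> its coordinate vector in that chart,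
  subject to the transformation law under change of charts; it is extended by \<open>0\<close> to all other
  charts.
\<close>

type_synonym ('a, 'e) tangent = "('a, 'e) chart \<Rightarrow> 'e"

definition tangent_space ::
  "('a, 'e::euclidean_space) chart set \<Rightarrow> 'a \<Rightarrow> ('a, 'e) tangent set" where
  "tangent_space A p = {v.
     (\<forall>c\<in>A. \<forall>d\<in>A. p \<in> chart_dom c \<longrightarrow> p \<in> chart_dom d \<longrightarrow>
        v d = frechet_derivative (chart_map d \<circ> chart_inv c) (at (chart_map c p)) (v c)) \<and>
     (\<forall>c. \<not> (c \<in> A \<and> p \<in> chart_dom c) \<longrightarrow> v c = 0)}"

text \<open>The tangent vector at \<open>p\<close> whose coordinate vector in the chart \<open>c\<close> is \<open>e\<close>.\<close>

definition coord_vector ::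
  "('a, 'e::euclidean_space) chart set \<Rightarrow> ('a, 'e) chart \<Rightarrow> 'a \<Rightarrow> 'e \<Rightarrow> ('a, 'e) tangent" where
  "coord_vector A c p e = (\<lambda>d. if d \<in> A \<and> p \<in> chart_dom d
     then frechet_derivative (chart_map d \<circ> chart_inv c) (at (chart_map c p)) e else 0)"

definition tangent_map ::
  "('a, 'e::euclidean_space) chart set \<Rightarrow> ('b, 'f::euclidean_space) chart set \<Rightarrow>
   ('a \<Rightarrow> 'b) \<Rightarrow> 'a \<Rightarrow> ('a, 'e) tangent \<Rightarrow> ('b, 'f) tangent" where
  "tangent_map A B f p v =
     (let c = (SOME c. c \<in> A \<and> p \<in> chart_dom c)
      in (\<lambda>d. if d \<in> B \<and> f p \<in> chart_dom d
           then frechet_derivative (chart_map d \<circ> f \<circ> chart_inv c) (at (chart_map c p)) (v c)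
           else 0))"

definition smooth_function ::
  "('a, 'e::euclidean_space) chart set \<Rightarrow> ('a \<Rightarrow> real) \<Rightarrow> bool" where
  "smooth_function A f \<longleftrightarrow> (\<forall>c\<in>A. smooth_on (chart_image c) (f \<circ> chart_inv c))"

definition linear_on_tangent_space ::
  "('a, 'e::euclidean_space) chart set \<Rightarrow> 'a \<Rightarrow> (('a, 'e) tangent \<Rightarrow> real) \<Rightarrow> bool" where
  "linear_on_tangent_space A p L \<longleftrightarrow>
     (\<forall>v\<in>tangent_space A p. \<forall>w\<in>tangent_space A p. \<forall>a b.
        L (\<lambda>d. a *\<^sub>R v d + b *\<^sub>R w d) = a * L v + b * L w)"

definition one_form ::
  "('a, 'e::euclidean_space) chart set \<Rightarrow> ('a \<Rightarrow> ('a, 'e) tangent \<Rightarrow> real) \<Rightarrow> bool" where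
  "one_form A \<omega> \<longleftrightarrow>
     (\<forall>p. linear_on_tangent_space A p (\<omega> p)) \<and>
     (\<forall>c\<in>A. \<forall>e. smooth_on (chart_image c)
        (\<lambda>y. \<omega> (chart_inv c y) (coord_vector A c (chart_inv c y) e)))"

definition symmetric_02_tensor ::
  "('a, 'e::euclidean_space) chart set \<Rightarrow>
   ('a \<Rightarrow> ('a, 'e) tangent \<Rightarrow> ('a, 'e) tangent \<Rightarrow> real) \<Rightarrow> bool" where
  "symmetric_02_tensor A h \<longleftrightarrow>
     (\<forall>p. \<forall>v\<in>tangent_space A p. \<forall>w\<in>tangent_space A p. h p v w = h p w v) \<and>
     (\<forall>p. \<forall>v\<in>tangent_space A p. linear_on_tangent_space A p (h p v)) \<and>
     (\<forall>c\<in>A. \<forall>e e'. smooth_on (chart_image c)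
        (\<lambda>y. h (chart_inv c y) (coord_vector A c (chart_inv c y) e)
                               (coord_vector A c (chart_inv c y) e')))"


section \<open>Piecewise smooth curves\<close>

definition smooth_curve_on ::
  "('a::topological_space, 'e::euclidean_space) chart set \<Rightarrow> real set \<Rightarrow> (real \<Rightarrow> 'a) \<Rightarrow> bool" where
  "smooth_curve_on A I c \<longleftrightarrow> continuous_on I c \<and>
     (\<forall>d\<in>A. smooth_on {s \<in> I. c s \<in> chart_dom d} (chart_map d \<circ> c))"

definition velocity ::
  "('a, 'e::euclidean_space) chart set \<Rightarrow> real set \<Rightarrow> (real \<Rightarrow> 'a) \<Rightarrow> real \<Rightarrow> ('a, 'e) tangent" where
  "velocity A I c s = (\<lambda>d. if d \<in> A \<and> c s \<in> chart_dom d
     then vector_derivative (chart_map d \<circ> c) (at s within I) else 0)"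

text \<open>\<open>Q\<close> holds on each closed piece of some partition of \<open>[a, b]\<close>; this forces \<open>a < b\<close>.\<close>

definition piecewise :: "(real set \<Rightarrow> bool) \<Rightarrow> real \<Rightarrow> real \<Rightarrow> bool" where
  "piecewise Q a b \<longleftrightarrow> (\<exists>(n::nat) s. 0 < n \<and> s 0 = a \<and> s n = b \<and>
     (\<forall>i<n. s i < s (Suc i) \<and> Q {s i..s (Suc i)}))"

text \<open>Velocities of piecewise smooth curves may vanish; in particular constant curves qualify.\<close>

definition piecewise_smooth_curve ::
  "('a::topological_space, 'e::euclidean_space) chart set \<Rightarrow> real \<Rightarrow> real \<Rightarrow> (real \<Rightarrow> 'a) \<Rightarrow> bool"
  where
  "piecewise_smooth_curve A a b c \<longleftrightarrow> piecewise (\<lambda>I. smooth_curve_on A I c) a b"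


section \<open>Causality of time-oriented Lorentzian manifolds\<close>

text \<open>
  Below, \<open>M\<close> is an atlas of the spacetime, \<open>g\<close> its metric (of signature \<open>(-,+,\<dots>,+)\<close>) and \<open>T\<close> a
  timelike vector field fixing the time orientation.
\<close>

definition causal_vector ::
  "('a, 'e::euclidean_space) chart set \<Rightarrow> ('a \<Rightarrow> ('a, 'e) tangent \<Rightarrow> ('a, 'e) tangent \<Rightarrow> real) \<Rightarrow>
   'a \<Rightarrow> ('a, 'e) tangent \<Rightarrow> bool" where
  "causal_vector M g p v \<longleftrightarrow> v \<in> tangent_space M p \<and> v \<noteq> (\<lambda>_. 0) \<and> g p v v \<le> 0"

definition future_causal_vector ::
  "('a, 'e::euclidean_space) chart set \<Rightarrow> ('a \<Rightarrow> ('a, 'e) tangent \<Rightarrow> ('a, 'e) tangent \<Rightarrow> real) \<Rightarrow>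
   ('a \<Rightarrow> ('a, 'e) tangent) \<Rightarrow> 'a \<Rightarrow> ('a, 'e) tangent \<Rightarrow> bool" where
  "future_causal_vector M g T p v \<longleftrightarrow> causal_vector M g p v \<and> g p v (T p) < 0"

definition past_causal_vector ::
  "('a, 'e::euclidean_space) chart set \<Rightarrow> ('a \<Rightarrow> ('a, 'e) tangent \<Rightarrow> ('a, 'e) tangent \<Rightarrow> real) \<Rightarrow>
   ('a \<Rightarrow> ('a, 'e) tangent) \<Rightarrow> 'a \<Rightarrow> ('a, 'e) tangent \<Rightarrow> bool" where
  "past_causal_vector M g T p v \<longleftrightarrow> causal_vector M g p v \<and> g p v (T p) > 0"

text \<open>
  On each smooth piece, both ends included, the velocity is causal; it must not switch between
  the future and the past cone, not even at a break point.
\<close>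

definition causal_curve ::
  "('a::topological_space, 'e::euclidean_space) chart set \<Rightarrow>
   ('a \<Rightarrow> ('a, 'e) tangent \<Rightarrow> ('a, 'e) tangent \<Rightarrow> real) \<Rightarrow> ('a \<Rightarrow> ('a, 'e) tangent) \<Rightarrow>
   real \<Rightarrow> real \<Rightarrow> (real \<Rightarrow> 'a) \<Rightarrow> bool" where
  "causal_curve M g T a b \<gamma> \<longleftrightarrow>
     piecewise (\<lambda>I. smooth_curve_on M I \<gamma> \<and>
       (\<forall>s\<in>I. future_causal_vector M g T (\<gamma> s) (velocity M I \<gamma> s))) a b \<or>
     piecewise (\<lambda>I. smooth_curve_on M I \<gamma> \<and>
       (\<forall>s\<in>I. past_causal_vector M g T (\<gamma> s) (velocity M I \<gamma> s))) a b"

definition causal_spacetime ::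
  "('a::topological_space, 'e::euclidean_space) chart set \<Rightarrow>
   ('a \<Rightarrow> ('a, 'e) tangent \<Rightarrow> ('a, 'e) tangent \<Rightarrow> real) \<Rightarrow> ('a \<Rightarrow> ('a, 'e) tangent) \<Rightarrow> bool" where
  "causal_spacetime M g T \<longleftrightarrow> \<not> (\<exists>a b \<gamma>. causal_curve M g T a b \<gamma> \<and> \<gamma> a = \<gamma> b)"


section \<open>SOM-spacetimes\<close>

definition real_atlas :: "(real, real) chart set" where
  "real_atlas = {(UNIV, \<lambda>t. t)}"

text \<open>The product atlas of \<open>\<real> \<times> S\<close>.\<close>

definition som_atlas :: "('a, 'e) chart set \<Rightarrow> (real \<times> 'a, real \<times> 'e) chart set" where
  "som_atlas A = (\<lambda>c. (UNIV \<times> chart_dom c, \<lambda>(t, x). (t, chart_map c x))) ` A"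

definition dt ::
  "('a, 'e::euclidean_space) chart set \<Rightarrow> real \<times> 'a \<Rightarrow> (real \<times> 'a, real \<times> 'e) tangent \<Rightarrow> real" where
  "dt A p v = tangent_map (som_atlas A) real_atlas fst p v (UNIV, \<lambda>t. t)"

definition dproj ::
  "('a, 'e::euclidean_space) chart set \<Rightarrow> real \<times> 'a \<Rightarrow> (real \<times> 'a, real \<times> 'e) tangent \<Rightarrow>
   ('a, 'e) tangent" where
  "dproj A p v = tangent_map (som_atlas A) A snd p v"

text \<open>The vector field \<open>\<partial>\<^sub>t\<close>.\<close>

definition d_dt ::
  "('a, 'e::euclidean_space) chart set \<Rightarrow> real \<times> 'a \<Rightarrow> (real \<times> 'a, real \<times> 'e) tangent" where
  "d_dt A p = velocity (som_atlas A) UNIV (\<lambda>r. (r, snd p)) (fst p)"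

text \<open>\<open>-\<beta> dt \<otimes> dt + dt \<otimes> \<omega> + \<omega> \<otimes> dt + g\<^sub>0\<close>, with \<open>\<beta>\<close>, \<open>\<omega>\<close>, \<open>g\<^sub>0\<close> pulled back from \<open>S\<close>.\<close>

definition som_metric ::
  "('a, 'e::euclidean_space) chart set \<Rightarrow> ('a \<Rightarrow> real) \<Rightarrow> ('a \<Rightarrow> ('a, 'e) tangent \<Rightarrow> real) \<Rightarrow>
   ('a \<Rightarrow> ('a, 'e) tangent \<Rightarrow> ('a, 'e) tangent \<Rightarrow> real) \<Rightarrow>
   real \<times> 'a \<Rightarrow> (real \<times> 'a, real \<times> 'e) tangent \<Rightarrow> (real \<times> 'a, real \<times> 'e) tangent \<Rightarrow> real" where
  "som_metric A \<beta> \<omega> g0 p v w =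
     - \<beta> (snd p) * dt A p v * dt A p w
     + dt A p v * \<omega> (snd p) (dproj A p w)
     + \<omega> (snd p) (dproj A p v) * dt A p w
     + g0 (snd p) (dproj A p v) (dproj A p w)"

definition som_spacetime ::
  "('a::{t2_space, second_countable_topology}, 'e::euclidean_space) chart set \<Rightarrow> ('a \<Rightarrow> real) \<Rightarrow>
   ('a \<Rightarrow> ('a, 'e) tangent \<Rightarrow> real) \<Rightarrow>
   ('a \<Rightarrow> ('a, 'e) tangent \<Rightarrow> ('a, 'e) tangent \<Rightarrow> real) \<Rightarrow> bool" where
  "som_spacetime A \<beta> \<omega> g0 \<longleftrightarrow>
     smooth_atlas A \<and> connected (UNIV :: 'a set) \<and>
     smooth_function A \<beta> \<and> (\<forall>x. \<beta> x > 0) \<and>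
     one_form A \<omega> \<and> symmetric_02_tensor A g0 \<and>
     (\<forall>x. \<forall>v\<in>tangent_space A x. v \<noteq> (\<lambda>_. 0) \<longrightarrow> g0 x v v + 1 / \<beta> x * (\<omega> x v)\<^sup>2 > 0)"

definition fermat_metric ::
  "('a \<Rightarrow> real) \<Rightarrow> ('a \<Rightarrow> ('a, 'e) tangent \<Rightarrow> real) \<Rightarrow>
   ('a \<Rightarrow> ('a, 'e) tangent \<Rightarrow> ('a, 'e) tangent \<Rightarrow> real) \<Rightarrow> 'a \<Rightarrow> ('a, 'e) tangent \<Rightarrow> real" where
  "fermat_metric \<beta> \<omega> g0 x v =
     1 / \<beta> x * \<omega> x v + sqrt (1 / (\<beta> x)\<^sup>2 * (\<omega> x v)\<^sup>2 + 1 / \<beta> x * g0 x v v)"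

text \<open>
  For a piecewise smooth curve \<open>c\<close> the value of the integrand at the finitely many break points,
  where the velocity need not exist, does not matter.
\<close>

definition curve_length ::
  "('a, 'e::euclidean_space) chart set \<Rightarrow> ('a \<Rightarrow> ('a, 'e) tangent \<Rightarrow> real) \<Rightarrow>
   real \<Rightarrow> real \<Rightarrow> (real \<Rightarrow> 'a) \<Rightarrow> real" where
  "curve_length A F a b c = integral {a..b} (\<lambda>s. F (c s) (velocity A {a..b} c s))"

definition pre_distance ::
  "('a::topological_space, 'e::euclidean_space) chart set \<Rightarrow> ('a \<Rightarrow> ('a, 'e) tangent \<Rightarrow> real) \<Rightarrow>
   'a \<Rightarrow> 'a \<Rightarrow> ereal" where
  "pre_distance A F x0 x1 =
     Inf {ereal (curve_length A F a b c) | a b c.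
            piecewise_smooth_curve A a b c \<and> c a = x0 \<and> c b = x1}"

end

theory Submission
  imports Defs
begin

text \<open>
  The Fermat metric splits as \<open>F(w) = \<omega>(w)/\<beta> + \<surd>h(w)\<close> with a Riemannian metric \<open>h\<close>.  Completing the
  square in \<open>g\<close> shows that a vector with time component \<open>\<tau>\<close> and projection \<open>w\<close> to \<open>S\<close> is future causal iff
  \<open>\<tau> \<ge> F(w)\<close> and \<open>\<tau> > \<omega>(w)/\<beta>\<close> (\<open>causal_vector_iff\<close>).  So a future causal curve is a curve in \<open>S\<close> together with a
  time function \<open>t\<close> that satisfies \<open>t' \<ge> F(c')\<close> and increases where \<open>c\<close> is at rest, and \<open>S\<close> carries the relation
  \<open>reaches x \<tau> y\<close>: one can travel from \<open>x\<close> to \<open>y\<close> in time \<open>\<tau>\<close>.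

  A closed causal curve, run backwards if it is past directed, projects to a closed curve of length at most \<open>0\<close>.
  If all \<open>d\<^sub>F(x,x)\<close> vanish and no closed curve but the constant ones has length \<open>0\<close>, then the projection is
  constant; but then \<open>t\<close> increases strictly and the curve is not closed (\<open>not_closed_future_curve\<close>).

  Conversely a closed curve \<open>c\<close> that is not constant and has length \<open>l \<le> 0\<close> should be lifted to \<open>(\<integral>F(c'), c)\<close>.
  This is no causal curve in general: \<open>c'\<close> may vanish, and on a complicated set, where the lift has
  velocity \<open>0\<close> and \<open>F(c')\<close> need not be smooth.  If there is any time to spare, \<open>F(c')\<close> can be replaced by a
  polynomial above it (\<open>reaches_if_longer\<close>).  If there is none, it is shown for a piece of \<open>c\<close> in one chart that
  it is constant or its end is reached in exactly its length (\<open>constant_or_reaches\<close>).  Either a part of the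
  piece can be outrun, and there is time to spare.  Or the piece minimizes length among nearby curves.  Then
  the first variation yields, in integrated form, an Euler-Lagrange equation between any two parameters at
  which \<open>c\<close> moves, across all rests of \<open>c\<close> in between (\<open>euler_lagrange\<close>).  Written for position and momentum it says
  that \<open>c\<close> follows a smooth vector field at a rate given by its \<open>h\<close>-speed.  Hence the parametrization of \<open>c\<close> by
  \<open>h\<close>-length exists, solves an ordinary differential equation, and so is smooth with nowhere vanishing
  velocity; it lifts to a lightlike curve (\<open>reaches_if_not_outrun\<close>).  Concatenation of the pieces gives a
  travel from \<open>c a\<close> to itself in time \<open>l\<close>, which after waiting for the time \<open>- l\<close> closes up to a closed causal
  curve (\<open>not_reaches_if_causal\<close>).
\<close>

text \<open>Facts on the Henstock-Kurzweil integral whose names are shared with facts on the Lebesgue integral.\<close>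

lemmas hk_integral_add = Henstock_Kurzweil_Integration.integral_add
lemmas hk_integral_combine = Henstock_Kurzweil_Integration.integral_combine
lemmas hk_integral_cong = Henstock_Kurzweil_Integration.integral_cong
lemmas hk_integral_sum = Henstock_Kurzweil_Integration.integral_sum


section \<open>Calculus of smooth functions\<close>

abbreviation hd_on where "hd_on \<equiv> higher_differentiable_on"

text \<open>The hypothesis of the uniqueness theorem for derivatives within a set.  It holds for open sets, for
  nondegenerate intervals and for their relatively open subsets.\<close>

definition derivative_unique_on :: "'a::euclidean_space set \<Rightarrow> bool" where
  "derivative_unique_on S \<longleftrightarrow>
     (\<forall>x\<in>S. \<forall>i\<in>Basis. \<forall>e>0. \<exists>d. 0 < \<bar>d\<bar> \<and> \<bar>d\<bar> < e \<and> x + d *\<^sub>R i \<in> S)"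

lemma derivative_unique_onD:
  assumes "derivative_unique_on S" "x \<in> S"
    and "(f has_derivative f') (at x within S)" "(f has_derivative f'') (at x within S)"
  shows "f' = f''"
  using frechet_derivative_unique_within[OF assms(3,4)] assms(1,2)
  unfolding derivative_unique_on_def by blast

lemma frechet_derivative_within_eq:
  assumes "derivative_unique_on S" "x \<in> S" "(f has_derivative f') (at x within S)"
  shows "frechet_derivative f (at x within S) = f'"
  using derivative_unique_onD[OF assms(1,2) _ assms(3)] assms(3)
  by (metis differentiableI frechet_derivative_works)

lemma derivative_unique_on_open:
  assumes "open S" shows "derivative_unique_on S"
  unfolding derivative_unique_on_def
proof (intro ballI allI impI)
  fix x i :: 'a and e :: real assume "x \<in> S" and i: "i \<in> Basis" and e: "e > 0"
  then obtain r where r: "r > 0" "ball x r \<subseteq> S" using assms openE by blast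
  define d where "d = min r e / 2"
  have d: "d > 0" "d < r" "d < e" using r e by (auto simp: d_def)
  have "x + d *\<^sub>R i \<in> ball x r" using d i by (simp add: dist_norm)
  then show "\<exists>d. 0 < \<bar>d\<bar> \<and> \<bar>d\<bar> < e \<and> x + d *\<^sub>R i \<in> S"
    using d r by (intro exI[of _ d]) auto
qed

lemma derivative_unique_on_real_iff:
  fixes S :: "real set"
  shows "derivative_unique_on S \<longleftrightarrow> (\<forall>x\<in>S. at x within S \<noteq> bot)"
  unfolding derivative_unique_on_def trivial_limit_within islimpt_approachable
proof (intro ball_cong refl)
  fix x assume "x \<in> S"
  have "(\<exists>d. 0 < \<bar>d\<bar> \<and> \<bar>d\<bar> < e \<and> x + d \<in> S) \<longleftrightarrow> (\<exists>y\<in>S. y \<noteq> x \<and> dist y x < e)" for e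
  proof
    assume "\<exists>d. 0 < \<bar>d\<bar> \<and> \<bar>d\<bar> < e \<and> x + d \<in> S"
    then obtain d where "0 < \<bar>d\<bar>" "\<bar>d\<bar> < e" "x + d \<in> S" by blast
    then show "\<exists>y\<in>S. y \<noteq> x \<and> dist y x < e" by (intro bexI[of _ "x+d"]) (auto simp: dist_real_def)
  next
    assume "\<exists>y\<in>S. y \<noteq> x \<and> dist y x < e"
    then obtain y where "y \<in> S" "y \<noteq> x" "dist y x < e" by blast
    then show "\<exists>d. 0 < \<bar>d\<bar> \<and> \<bar>d\<bar> < e \<and> x + d \<in> S"
      by (intro exI[of _ "y-x"]) (auto simp: dist_real_def)
  qed
  then show "(\<forall>i\<in>Basis. \<forall>e>0. \<exists>d. 0 < \<bar>d\<bar> \<and> \<bar>d\<bar> < e \<and> x + d *\<^sub>R i \<in> S) \<longleftrightarrow>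
      \<not> \<not> (\<forall>e>0. \<exists>x'\<in>S. x' \<noteq> x \<and> dist x' x < e)"
    by simp
qed

lemma derivative_unique_on_Icc:
  fixes a b :: real assumes "a < b" shows "derivative_unique_on {a..b}"
  using assms unfolding derivative_unique_on_real_iff
  by (auto simp: trivial_limit_within islimpt_Icc)

lemma derivative_unique_on_relopen:
  fixes S :: "real set"
  assumes "derivative_unique_on S" "openin (top_of_set S) T"
  shows "derivative_unique_on T"
proof -
  obtain U where U: "open U" "T = S \<inter> U" using assms(2) by (auto simp: openin_open)
  have "at x within T = at x within S" if "x \<in> T" for x
    using that U by (intro at_within_nhd[of x U]) auto
  then show ?thesis using assms(1) U unfolding derivative_unique_on_real_iff by auto
qed

lemma hd_on_cong:
  assumes "\<And>x. x \<in> S \<Longrightarrow> f x = g x"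
  shows "hd_on S f n \<longleftrightarrow> hd_on S g n"
  using assms
proof (induction n arbitrary: f g)
  case 0
  then show ?case by (simp cong: continuous_on_cong)
next
  case (Suc n)
  have eq: "(f has_derivative D) (at x within S) \<longleftrightarrow> (g has_derivative D) (at x within S)"
    if "x \<in> S" for x D
    using has_derivative_transform[of x S f g D] has_derivative_transform[of x S g f D] that Suc.prems by metis
  have "frechet_derivative f (at x within S) = frechet_derivative g (at x within S)" if "x \<in> S" for x
    using eq[OF that] by (simp add: frechet_derivative_def)
  then have "hd_on S (\<lambda>x. frechet_derivative f (at x within S) v) n
      \<longleftrightarrow> hd_on S (\<lambda>x. frechet_derivative g (at x within S) v) n" for v
    by (intro Suc.IH) simp
  then show ?case using eq by (simp add: differentiable_def)
qed

lemma smooth_on_cong: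
  assumes "\<And>x. x \<in> S \<Longrightarrow> f x = g x"
  shows "smooth_on S f \<longleftrightarrow> smooth_on S g"
  by (simp add: smooth_on_def hd_on_cong[OF assms])

text \<open>Where derivatives within \<open>S\<close> are unique, any derivative may be exhibited in place of the one chosen by
  \<^const>\<open>frechet_derivative\<close>.\<close>

lemma hd_on_SucI:
  assumes "derivative_unique_on S"
    and "\<And>x. x \<in> S \<Longrightarrow> (f has_derivative f' x) (at x within S)"
    and "\<And>v. hd_on S (\<lambda>x. f' x v) n"
  shows "hd_on S f (Suc n)"
proof -
  have "hd_on S (\<lambda>x. frechet_derivative f (at x within S) v) n" for v
    using assms(3)[of v] frechet_derivative_within_eq[OF assms(1) _ assms(2)]
    by (subst hd_on_cong[where g = "\<lambda>x. f' x v"]) auto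
  then show ?thesis using assms(2) by (auto simp: differentiable_def)
qed

lemma hd_on_SucD:
  assumes "hd_on S f (Suc n)" "x \<in> S"
  shows "(f has_derivative frechet_derivative f (at x within S)) (at x within S)"
  using assms frechet_derivative_works by auto

lemma hd_on_Suc_imp: "hd_on S f (Suc n) \<Longrightarrow> hd_on S f n"
proof (induction n arbitrary: f)
  case 0
  then show ?case
    by (auto simp: continuous_on_eq_continuous_within intro: differentiable_imp_continuous_within)
next
  case (Suc n)
  from Suc.prems have "\<forall>x\<in>S. f differentiable at x within S"
    and "hd_on S (\<lambda>x. frechet_derivative f (at x within S) v) (Suc n)" for v
    by simp_all
  then show ?case using Suc.IH by simp
qed

lemma hd_on_le: "hd_on S f n \<Longrightarrow> m \<le> n \<Longrightarrow> hd_on S f m"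
  by (induction n) (use hd_on_Suc_imp le_Suc_eq in blast)+

lemma hd_on_continuous: "hd_on S f n \<Longrightarrow> continuous_on S f"
  using hd_on_le[of S f n 0] by simp

lemma hd_on_const:
  assumes "derivative_unique_on S" shows "hd_on S (\<lambda>_. k) n"
proof (induction n arbitrary: k)
  case (Suc n)
  show ?case
    by (rule hd_on_SucI[OF assms has_derivative_const]) (rule Suc)
qed simp

lemma hd_on_add:
  assumes "derivative_unique_on S"
  shows "hd_on S f n \<Longrightarrow> hd_on S g n \<Longrightarrow> hd_on S (\<lambda>x. f x + g x) n"
proof (induction n arbitrary: f g)
  case 0
  then show ?case by (simp add: continuous_on_add)
next
  case (Suc n)
  show ?case
    by (rule hd_on_SucI[OF assms has_derivative_add[OF hd_on_SucD[OF Suc.prems(1)] hd_on_SucD[OF Suc.prems(2)]]])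
      (use Suc in simp_all)
qed

lemma hd_on_bounded_linear:
  assumes "derivative_unique_on S" "bounded_linear L"
  shows "hd_on S f n \<Longrightarrow> hd_on S (\<lambda>x. L (f x)) n"
proof (induction n arbitrary: f)
  case 0
  then show ?case using assms by (simp add: bounded_linear.continuous_on)
next
  case (Suc n)
  show ?case
    by (rule hd_on_SucI[OF assms(1) bounded_linear.has_derivative[OF assms(2) hd_on_SucD[OF Suc.prems]]])
      (use Suc in simp_all)
qed

lemma hd_on_bounded_bilinear:
  assumes "derivative_unique_on S" "bounded_bilinear B"
  shows "hd_on S f n \<Longrightarrow> hd_on S g n \<Longrightarrow> hd_on S (\<lambda>x. B (f x) (g x)) n"
proof (induction n arbitrary: f g)
  case 0
  then show ?case using assms by (simp add: bounded_bilinear.continuous_on)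
next
  case (Suc n)
  show ?case
  proof (rule hd_on_SucI[OF assms(1)])
    show "((\<lambda>x. B (f x) (g x)) has_derivative
       (\<lambda>v. B (f x) (frechet_derivative g (at x within S) v)
          + B (frechet_derivative f (at x within S) v) (g x))) (at x within S)" if "x \<in> S" for x
      using Suc.prems that by (intro bounded_bilinear.FDERIV[OF assms(2)] hd_on_SucD)
    fix v
    have "hd_on S f n" "hd_on S g n" using Suc.prems hd_on_Suc_imp by blast+
    then show "hd_on S (\<lambda>x. B (f x) (frechet_derivative g (at x within S) v)
          + B (frechet_derivative f (at x within S) v) (g x)) n"
      using Suc by (intro hd_on_add[OF assms(1)]) auto
  qed
qed

lemmas hd_on_mult = hd_on_bounded_bilinear[OF _ bounded_bilinear_mult]
lemmas hd_on_scaleR = hd_on_bounded_bilinear[OF _ bounded_bilinear_scaleR]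
lemmas hd_on_inner_left = hd_on_bounded_linear[OF _ bounded_linear_inner_left]

lemma hd_on_sum:
  assumes "derivative_unique_on S" "finite B" "\<And>b. b \<in> B \<Longrightarrow> hd_on S (f b) n"
  shows "hd_on S (\<lambda>x. \<Sum>b\<in>B. f b x) n"
  using assms(2,3) by induction (auto intro: hd_on_const[OF assms(1)] hd_on_add[OF assms(1)])

lemma hd_on_uminus:
  assumes "derivative_unique_on S" "hd_on S f n" shows "hd_on S (\<lambda>x. - f x) n"
  using hd_on_bounded_linear[OF assms(1) bounded_linear_minus[OF bounded_linear_ident] assms(2)] .

lemma hd_on_diff:
  assumes "derivative_unique_on S" "hd_on S f n" "hd_on S g n" shows "hd_on S (\<lambda>x. f x - g x) n"
  using hd_on_add[OF assms(1,2) hd_on_uminus[OF assms(1,3)]] by simp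

lemma hd_on_Pair:
  assumes "derivative_unique_on S"
  shows "hd_on S f n \<Longrightarrow> hd_on S g n \<Longrightarrow> hd_on S (\<lambda>x. (f x, g x)) n"
proof (induction n arbitrary: f g)
  case 0
  then show ?case by (simp add: continuous_on_Pair)
next
  case (Suc n)
  show ?case
    by (rule hd_on_SucI[OF assms has_derivative_Pair[OF hd_on_SucD[OF Suc.prems(1)] hd_on_SucD[OF Suc.prems(2)]]])
      (use Suc in simp_all)
qed

lemma hd_on_inverse:
  fixes f :: "'a::euclidean_space \<Rightarrow> real"
  assumes "derivative_unique_on S" "\<And>x. x \<in> S \<Longrightarrow> f x \<noteq> 0"
  shows "hd_on S f n \<Longrightarrow> hd_on S (\<lambda>x. inverse (f x)) n"
proof (induction n)
  case 0
  then show ?case using assms by (simp add: continuous_on_inverse)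
next
  case (Suc n)
  show ?case
  proof (rule hd_on_SucI[OF assms(1)])
    show "((\<lambda>x. inverse (f x)) has_derivative
       (\<lambda>v. - (inverse (f x) * frechet_derivative f (at x within S) v * inverse (f x)))) (at x within S)" if "x \<in> S" for x
      by (rule Deriv.has_derivative_inverse[OF assms(2)[OF that] hd_on_SucD[OF Suc.prems that]])
    fix v
    have "hd_on S (\<lambda>x. inverse (f x)) n" using Suc hd_on_Suc_imp by blast
    then show "hd_on S (\<lambda>x. - (inverse (f x) * frechet_derivative f (at x within S) v * inverse (f x))) n"
      using Suc.prems by (intro hd_on_uminus hd_on_mult assms(1)) auto
  qed
qed

lemma hd_on_subset:
  assumes "derivative_unique_on T" "T \<subseteq> S"
  shows "hd_on S f n \<Longrightarrow> hd_on T f n"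
proof (induction n arbitrary: f)
  case 0
  then show ?case using assms by (auto intro: continuous_on_subset)
next
  case (Suc n)
  show ?case
    by (rule hd_on_SucI[OF assms(1) has_derivative_subset[OF hd_on_SucD[OF Suc.prems] assms(2)]])
      (use Suc assms(2) in auto)
qed

text \<open>The chain rule expresses the derivative of a composition through the partial derivatives
  of the outer function, which are again compositions: this is what makes the induction work.\<close>

lemma hd_on_compose:
  fixes g :: "'a::euclidean_space \<Rightarrow> 'b::euclidean_space"
    and f :: "'b \<Rightarrow> 'c::real_normed_vector"
  assumes S: "derivative_unique_on S" and T: "derivative_unique_on T" and gT: "g ` S \<subseteq> T"
  shows "hd_on T f n \<Longrightarrow> hd_on S g n \<Longrightarrow> hd_on S (\<lambda>x. f (g x)) n"
proof (induction n arbitrary: f)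
  case 0
  then show ?case using gT by (auto intro: continuous_on_compose2)
next
  case (Suc n)
  let ?Df = "\<lambda>y. frechet_derivative f (at y within T)"
  let ?Dg = "\<lambda>x. frechet_derivative g (at x within S)"
  show ?case
  proof (rule hd_on_SucI[OF S])
    fix x assume x: "x \<in> S"
    have df: "(f has_derivative ?Df (g x)) (at (g x) within T)"
      using Suc.prems(1) x gT by (intro hd_on_SucD) auto
    have "((\<lambda>x. f (g x)) has_derivative (\<lambda>v. ?Df (g x) (?Dg x v))) (at x within S)"
      using has_derivative_in_compose[OF hd_on_SucD[OF Suc.prems(2) x] has_derivative_subset[OF df gT]] .
    moreover have "?Df (g x) (?Dg x v) = (\<Sum>b\<in>Basis. (?Dg x v \<bullet> b) *\<^sub>R ?Df (g x) b)" for v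
    proof -
      have L: "linear (?Df (g x))" using df has_derivative_linear by blast
      have "?Df (g x) (?Dg x v) = ?Df (g x) (\<Sum>b\<in>Basis. (?Dg x v \<bullet> b) *\<^sub>R b)"
        by (simp add: euclidean_representation)
      also have "\<dots> = (\<Sum>b\<in>Basis. (?Dg x v \<bullet> b) *\<^sub>R ?Df (g x) b)"
        by (simp add: linear_sum[OF L] linear_scale[OF L])
      finally show ?thesis .
    qed
    ultimately show "((\<lambda>x. f (g x)) has_derivative
       (\<lambda>v. \<Sum>b\<in>Basis. (?Dg x v \<bullet> b) *\<^sub>R ?Df (g x) b)) (at x within S)" by simp
  next
    fix v
    show "hd_on S (\<lambda>x. \<Sum>b\<in>Basis. (?Dg x v \<bullet> b) *\<^sub>R ?Df (g x) b) n"
      using Suc.prems hd_on_Suc_imp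
      by (intro hd_on_sum hd_on_scaleR hd_on_inner_left S Suc.IH) auto
  qed
qed

lemma has_vector_derivative_frechet:
  assumes "f differentiable (at x within S)"
  shows "(f has_vector_derivative frechet_derivative f (at x within S) 1) (at x within S)"
proof -
  let ?D = "frechet_derivative f (at x within S)"
  have D: "(f has_derivative ?D) (at x within S)" using assms frechet_derivative_works by blast
  then have "?D h = h *\<^sub>R ?D 1" for h
    using linear_scale[OF has_derivative_linear[OF D], of h 1] by simp
  then have "?D = (\<lambda>h. h *\<^sub>R ?D 1)" by blast
  with D show ?thesis unfolding has_vector_derivative_def by metis
qed

lemma hd_on_real_SucI:
  fixes S :: "real set"
  assumes "derivative_unique_on S"
    and "\<And>x. x \<in> S \<Longrightarrow> (f has_vector_derivative f' x) (at x within S)"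
    and "hd_on S f' n"
  shows "hd_on S f (Suc n)"
  by (rule hd_on_SucI[OF assms(1), where f' = "\<lambda>x h. h *\<^sub>R f' x"])
    (use assms in \<open>auto simp: has_vector_derivative_def intro: hd_on_bounded_linear bounded_linear_scaleR_right\<close>)

lemma hd_on_real_SucE:
  fixes S :: "real set"
  assumes "hd_on S f (Suc n)"
  obtains f' where "\<And>x. x \<in> S \<Longrightarrow> (f has_vector_derivative f' x) (at x within S)" "hd_on S f' n"
proof
  show "(f has_vector_derivative frechet_derivative f (at x within S) 1) (at x within S)" if "x \<in> S" for x
    using assms that by (intro has_vector_derivative_frechet) simp
  show "hd_on S (\<lambda>x. frechet_derivative f (at x within S) 1) n"
    using assms by simp
qed

lemma hd_on_affine:
  fixes f :: "real \<Rightarrow> 'b::real_normed_vector"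
  assumes "derivative_unique_on {s. r + k * s \<in> S}"
  shows "hd_on S f n \<Longrightarrow> hd_on {s. r + k * s \<in> S} (\<lambda>s. f (r + k * s)) n"
proof (induction n arbitrary: f)
  case 0
  then show ?case by (auto intro!: continuous_on_compose2[of S f] continuous_intros)
next
  case (Suc n)
  from Suc.prems obtain f' where f': "\<And>x. x \<in> S \<Longrightarrow> (f has_vector_derivative f' x) (at x within S)" "hd_on S f' n"
    by (rule hd_on_real_SucE) blast
  show ?case
  proof (rule hd_on_real_SucI[OF assms])
    fix s assume s: "s \<in> {s. r + k * s \<in> S}"
    have 1: "((\<lambda>s. r + k * s) has_vector_derivative k) (at s within {s. r + k * s \<in> S})"
      by (auto intro!: derivative_eq_intros)
    have 2: "(f has_vector_derivative f' (r + k * s)) (at (r + k * s) within (\<lambda>s. r + k * s) ` {s. r + k * s \<in> S})"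
      by (rule has_vector_derivative_within_subset[OF f'(1)]) (use s in blast)+
    show "((\<lambda>s. f (r + k * s)) has_vector_derivative k *\<^sub>R f' (r + k * s)) (at s within {s. r + k * s \<in> S})"
      using vector_diff_chain_within[OF 1 2] unfolding o_def .
  next
    show "hd_on {s. r + k * s \<in> S} (\<lambda>s. k *\<^sub>R f' (r + k * s)) n"
      using Suc.IH[OF f'(2)] by (intro hd_on_bounded_linear[OF assms bounded_linear_scaleR_right])
  qed
qed

section \<open>Positive definite systems and reparametrization\<close>

text \<open>A matrix is a function of two basis vectors, so that its entries can be smooth functions of a point;
  \<open>bilin\<close> is the bilinear form with that matrix.\<close>

definition bilin :: "('e::euclidean_space \<Rightarrow> 'e \<Rightarrow> real) \<Rightarrow> 'e \<Rightarrow> 'e \<Rightarrow> real" where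
  "bilin a v w = (\<Sum>b\<in>Basis. \<Sum>c\<in>Basis. a b c * (v \<bullet> b) * (w \<bullet> c))"

lemma bilin_linear:
  "bilin a (v + v') w = bilin a v w + bilin a v' w"
  "bilin a v (w + w') = bilin a v w + bilin a v w'"
  "bilin a (k *\<^sub>R v) w = k * bilin a v w"
  "bilin a v (k *\<^sub>R w) = k * bilin a v w"
  "bilin a 0 w = 0" "bilin a v 0 = 0"
  "bilin a (- v) w = - bilin a v w" "bilin a v (- w) = - bilin a v w"
  by (simp_all add: bilin_def inner_add_left algebra_simps sum.distrib sum_distrib_left sum_negf)

lemma bilin_eq_sum_left: "bilin a v w = (\<Sum>b\<in>Basis. (\<Sum>c\<in>Basis. a b c * (w \<bullet> c)) * (v \<bullet> b))"
  by (simp add: bilin_def sum_distrib_left sum_distrib_right ac_simps)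

lemma bilin_basis: "b \<in> Basis \<Longrightarrow> bilin a b w = (\<Sum>c\<in>Basis. a b c * (w \<bullet> c))"
  by (simp add: bilin_eq_sum_left inner_Basis if_distrib cong: if_cong)

text \<open>The minimum of the form over the unit sphere works as \<open>m\<close>; compactness of \<open>K\<close> makes it uniform.\<close>

lemma pos_def_coercive:
  fixes a :: "'x::topological_space \<Rightarrow> 'e::euclidean_space \<Rightarrow> 'e \<Rightarrow> real"
  assumes K: "compact K"
    and cont: "\<And>b c. b \<in> Basis \<Longrightarrow> c \<in> Basis \<Longrightarrow> continuous_on K (\<lambda>x. a x b c)"
    and pos: "\<And>x v. x \<in> K \<Longrightarrow> v \<noteq> 0 \<Longrightarrow> bilin (a x) v v > 0"
  obtains m where "m > 0" "\<And>x v. x \<in> K \<Longrightarrow> m * (norm v)\<^sup>2 \<le> bilin (a x) v v"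
proof (cases "K = {}")
  case True
  then show ?thesis using that[of 1] by simp
next
  case False
  let ?q = "\<lambda>(x, v). bilin (a x) v v"
  have c: "continuous_on (K \<times> sphere 0 1) ?q"
    unfolding bilin_def split_beta
    by (intro continuous_intros continuous_on_compose2[OF cont]) auto
  obtain e :: 'e where "e \<in> Basis" using nonempty_Basis by blast
  then have "e \<in> sphere 0 1" by simp
  then have ne: "K \<times> sphere (0::'e) 1 \<noteq> {}" using False by blast
  obtain p where p: "p \<in> K \<times> sphere 0 1" "\<And>y. y \<in> K \<times> sphere 0 1 \<Longrightarrow> ?q p \<le> ?q y"
    using continuous_attains_inf[OF compact_Times[OF K compact_sphere] ne c] by blast
  show ?thesis
  proof (rule that)
    have "snd p \<noteq> 0" using p(1) by auto
    then show "?q p > 0" using p(1) pos[of "fst p" "snd p"] by (auto simp: split_beta)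
    fix x v assume x: "x \<in> K"
    show "?q p * (norm v)\<^sup>2 \<le> bilin (a x) v v"
    proof (cases "v = 0")
      case False
      then have "?q p \<le> bilin (a x) (v /\<^sub>R norm v) (v /\<^sub>R norm v)"
        using p(2)[of "(x, v /\<^sub>R norm v)"] x by simp
      also have "\<dots> = bilin (a x) v v / (norm v)\<^sup>2"
        by (simp add: bilin_linear power2_eq_square divide_inverse)
      finally show ?thesis using False by (simp add: field_simps)
    qed (simp add: bilin_linear)
  qed
qed

lemma pos_def_solvable:
  fixes a :: "'e::euclidean_space \<Rightarrow> 'e \<Rightarrow> real"
  assumes pos: "\<And>v. v \<noteq> 0 \<Longrightarrow> bilin a v v > 0"
  shows "\<exists>z. \<forall>b\<in>Basis. bilin a b z = r \<bullet> b"
proof -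
  define L where "L z = (\<Sum>b\<in>Basis. bilin a b z *\<^sub>R b)" for z
  have lin: "linear L"
    by (rule linearI) (simp_all add: L_def bilin_linear scaleR_left_distrib sum.distrib scaleR_sum_right)
  have Lb: "L z \<bullet> b = bilin a b z" if "b \<in> Basis" for z b
    using that by (simp add: L_def inner_sum_left inner_Basis if_distrib cong: if_cong)
  have "v = 0" if "L v = 0" for v
  proof (rule ccontr)
    assume "v \<noteq> 0"
    have "bilin a v v = (\<Sum>b\<in>Basis. bilin a b v * (v \<bullet> b))"
      by (simp add: bilin_eq_sum_left[of a v] bilin_basis)
    also have "\<dots> = 0" using Lb[of _ v] that by simp
    finally show False using pos[OF \<open>v \<noteq> 0\<close>] by simp
  qed
  then have "inj L" using linear_injective_0[OF lin] by blast
  then have "surj L" using linear_injective_imp_surjective[OF lin] by blast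
  then obtain z where "L z = r" by (metis surjD)
  then show ?thesis using Lb by metis
qed

text \<open>With \<open>v = z - z0\<close>, the value \<open>bilin a v v\<close> is the residual of \<open>z0\<close> in the perturbed system, paired
  with \<open>v\<close>.  The residual tends to \<open>0\<close>, and coercivity of the limit form passes this on to \<open>v\<close>.\<close>

lemma pos_def_solution_tendsto:
  fixes a :: "'x \<Rightarrow> 'e::euclidean_space \<Rightarrow> 'e \<Rightarrow> real"
  assumes a: "\<And>b c. b \<in> Basis \<Longrightarrow> c \<in> Basis \<Longrightarrow> ((\<lambda>x. a x b c) \<longlongrightarrow> a0 b c) F"
    and r: "(r \<longlongrightarrow> r0) F"
    and sol: "\<forall>\<^sub>F x in F. \<forall>b\<in>Basis. bilin (a x) b (z x) = r x \<bullet> b"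
    and sol0: "\<And>b. b \<in> Basis \<Longrightarrow> bilin a0 b z0 = r0 \<bullet> b"
    and pos: "\<And>v. v \<noteq> 0 \<Longrightarrow> bilin a0 v v > 0"
  shows "(z \<longlongrightarrow> z0) F"
proof -
  obtain m where m: "m > 0" "\<And>v. m * (norm v)\<^sup>2 \<le> bilin a0 v v"
    by (rule pos_def_coercive[of "{0::real}" "\<lambda>_. a0"]) (use pos in auto)
  define \<alpha> where "\<alpha> x = (\<Sum>b\<in>Basis. \<Sum>c\<in>Basis. \<bar>a x b c - a0 b c\<bar>)" for x
  define \<rho> where "\<rho> x = (\<Sum>b\<in>Basis. \<bar>r x \<bullet> b - bilin (a x) b z0\<bar>)" for x
  have \<alpha>0: "(\<alpha> \<longlongrightarrow> 0) F"
    unfolding \<alpha>_def by (auto intro!: tendsto_eq_intros a)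
  have "((\<lambda>x. \<Sum>b\<in>Basis. \<bar>r x \<bullet> b - (\<Sum>c\<in>Basis. a x b c * (z0 \<bullet> c))\<bar>) \<longlongrightarrow>
      (\<Sum>b\<in>Basis. \<bar>r0 \<bullet> b - (\<Sum>c\<in>Basis. a0 b c * (z0 \<bullet> c))\<bar>)) F"
    by (intro tendsto_intros a r)
  also have "(\<Sum>b\<in>Basis. \<bar>r0 \<bullet> b - (\<Sum>c\<in>Basis. a0 b c * (z0 \<bullet> c))\<bar>) = 0"
    using sol0 by (simp add: bilin_basis)
  finally have \<rho>0: "(\<rho> \<longlongrightarrow> 0) F" unfolding \<rho>_def by (simp add: bilin_basis)
  have ev: "\<forall>\<^sub>F x in F. \<alpha> x < m / 2"
    by (rule order_tendstoD(2)[OF \<alpha>0]) (use m(1) in simp)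
  have "\<forall>\<^sub>F x in F. norm (z x - z0) \<le> 2 / m * \<rho> x"
    using ev sol
  proof eventually_elim
    fix x assume ax: "\<alpha> x < m / 2" and s: "\<forall>b\<in>Basis. bilin (a x) b (z x) = r x \<bullet> b"
    define v where "v = z x - z0"
    have "bilin (a x) v v = (\<Sum>b\<in>Basis. (r x \<bullet> b - bilin (a x) b z0) * (v \<bullet> b))"
    proof -
      have "bilin (a x) b v = r x \<bullet> b - bilin (a x) b z0" if "b \<in> Basis" for b
        using that s bilin_linear(2)[of "a x" b "z x" "- z0"] by (simp add: v_def bilin_linear)
      then show ?thesis by (simp add: bilin_eq_sum_left[of "a x" v] bilin_basis)
    qed
    also have "\<dots> \<le> (\<Sum>b\<in>Basis. \<bar>r x \<bullet> b - bilin (a x) b z0\<bar> * norm v)"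
    proof (rule sum_mono)
      fix b :: 'e assume "b \<in> Basis"
      then have "\<bar>r x \<bullet> b - bilin (a x) b z0\<bar> * \<bar>v \<bullet> b\<bar> \<le> \<bar>r x \<bullet> b - bilin (a x) b z0\<bar> * norm v"
        by (intro mult_left_mono Basis_le_norm) auto
      then show "(r x \<bullet> b - bilin (a x) b z0) * (v \<bullet> b) \<le> \<bar>r x \<bullet> b - bilin (a x) b z0\<bar> * norm v"
        using abs_ge_self[of "(r x \<bullet> b - bilin (a x) b z0) * (v \<bullet> b)"] unfolding abs_mult by linarith
    qed
    also have "\<dots> = \<rho> x * norm v" by (simp add: \<rho>_def sum_distrib_right)
    finally have 1: "bilin (a x) v v \<le> \<rho> x * norm v" .
    have "bilin a0 v v - bilin (a x) v v = (\<Sum>b\<in>Basis. \<Sum>c\<in>Basis. (a0 b c - a x b c) * (v \<bullet> b) * (v \<bullet> c))"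
      by (simp add: bilin_def sum_subtractf algebra_simps)
    also have "\<dots> \<le> (\<Sum>b\<in>Basis. \<Sum>c\<in>Basis. \<bar>a x b c - a0 b c\<bar> * (norm v)\<^sup>2)"
    proof (intro sum_mono)
      fix b c :: 'e assume "b \<in> Basis" "c \<in> Basis"
      then have "\<bar>(v \<bullet> b) * (v \<bullet> c)\<bar> \<le> (norm v)\<^sup>2"
        using Basis_le_norm[of b v] Basis_le_norm[of c v]
        by (simp add: abs_mult power2_eq_square mult_mono)
      then have "\<bar>a x b c - a0 b c\<bar> * \<bar>(v \<bullet> b) * (v \<bullet> c)\<bar> \<le> \<bar>a x b c - a0 b c\<bar> * (norm v)\<^sup>2"
        by (intro mult_left_mono) auto
      moreover have "(a0 b c - a x b c) * ((v \<bullet> b) * (v \<bullet> c)) \<le> \<bar>a x b c - a0 b c\<bar> * \<bar>(v \<bullet> b) * (v \<bullet> c)\<bar>"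
        using abs_ge_self[of "(a0 b c - a x b c) * ((v \<bullet> b) * (v \<bullet> c))"]
        unfolding abs_mult[of "a0 b c - a x b c"] by (simp add: abs_minus_commute)
      ultimately show "(a0 b c - a x b c) * (v \<bullet> b) * (v \<bullet> c) \<le> \<bar>a x b c - a0 b c\<bar> * (norm v)\<^sup>2"
        by (simp add: mult.assoc)
    qed
    also have "\<dots> = \<alpha> x * (norm v)\<^sup>2" by (simp add: \<alpha>_def sum_distrib_right)
    also have "\<dots> \<le> m / 2 * (norm v)\<^sup>2" using ax by (intro mult_right_mono) auto
    finally have "m * (norm v)\<^sup>2 \<le> m / 2 * (norm v)\<^sup>2 + \<rho> x * norm v"
      using m(2)[of v] 1 by linarith
    then have "m / 2 * norm v * norm v \<le> \<rho> x * norm v" by (simp add: power2_eq_square algebra_simps)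
    moreover have "\<rho> x \<ge> 0" by (simp add: \<rho>_def sum_nonneg)
    ultimately have "m / 2 * norm v \<le> \<rho> x"
      by (cases "v = 0") (auto simp: mult_le_cancel_right)
    then show "norm (z x - z0) \<le> 2 / m * \<rho> x" using m(1) by (simp add: v_def field_simps)
  qed
  moreover have "((\<lambda>x. 2 / m * \<rho> x) \<longlongrightarrow> 0) F" using tendsto_mult_right_zero[OF \<rho>0] by blast
  ultimately have "((\<lambda>x. z x - z0) \<longlongrightarrow> 0) F" by (rule Lim_null_comparison)
  then show ?thesis by (simp add: LIM_zero_iff)
qed

lemma has_vector_derivative_iff_quotient:
  fixes f :: "real \<Rightarrow> 'b::real_normed_vector"
  shows "(f has_vector_derivative D) (at x within S) \<longleftrightarrow>
    ((\<lambda>y. inverse (y - x) *\<^sub>R (f y - f x)) \<longlongrightarrow> D) (at x within S)"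
proof -
  have "(f has_vector_derivative D) (at x within S) \<longleftrightarrow>
     ((\<lambda>y. norm ((1 / norm (y - x)) *\<^sub>R (f y - (f x + (y - x) *\<^sub>R D)))) \<longlongrightarrow> 0) (at x within S)"
    unfolding has_vector_derivative_def has_derivative_within
    by (simp only: tendsto_norm_zero_iff) (simp add: bounded_linear_scaleR_left)
  also have "\<dots> \<longleftrightarrow> ((\<lambda>y. norm (inverse (y - x) *\<^sub>R (f y - f x) - D)) \<longlongrightarrow> 0) (at x within S)"
  proof (rule filterlim_cong[OF refl refl])
    have "norm ((1 / norm (y - x)) *\<^sub>R (f y - (f x + (y - x) *\<^sub>R D)))
        = norm (inverse (y - x) *\<^sub>R (f y - f x) - D)" if "y \<noteq> x" for y
    proof -
      have "inverse (y - x) *\<^sub>R ((y - x) *\<^sub>R D) = D" using that by simp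
      then have "inverse (y - x) *\<^sub>R (f y - f x) - D = inverse (y - x) *\<^sub>R (f y - (f x + (y - x) *\<^sub>R D))"
        by (simp add: scaleR_right_diff_distrib scaleR_right_distrib)
      then show ?thesis by (simp add: divide_inverse)
    qed
    then show "\<forall>\<^sub>F y in at x within S. norm ((1 / norm (y - x)) *\<^sub>R (f y - (f x + (y - x) *\<^sub>R D)))
        = norm (inverse (y - x) *\<^sub>R (f y - f x) - D)"
      by (auto simp: eventually_at_filter)
  qed
  also have "\<dots> \<longleftrightarrow> ((\<lambda>y. inverse (y - x) *\<^sub>R (f y - f x)) \<longlongrightarrow> D) (at x within S)"
    by (simp add: tendsto_norm_zero_iff LIM_zero_iff)
  finally show ?thesis .
qed

text \<open>The difference quotients of a solution solve a system with the same matrix, whose right hand side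
  converges; so they converge.  The derivative solves the system differentiated once, in which the
  solution itself enters the right hand side, hence the induction over all right hand sides.\<close>

lemma hd_on_pos_def_solution:
  fixes a :: "real \<Rightarrow> 'e::euclidean_space \<Rightarrow> 'e \<Rightarrow> real"
  assumes T: "derivative_unique_on T"
    and pos: "\<And>t v. t \<in> T \<Longrightarrow> v \<noteq> 0 \<Longrightarrow> bilin (a t) v v > 0"
  shows "(\<And>b c. b \<in> Basis \<Longrightarrow> c \<in> Basis \<Longrightarrow> hd_on T (\<lambda>t. a t b c) n) \<Longrightarrow> hd_on T r n \<Longrightarrow>
    (\<And>t b. t \<in> T \<Longrightarrow> b \<in> Basis \<Longrightarrow> bilin (a t) b (z t) = r t \<bullet> b) \<Longrightarrow> hd_on T z n"
proof (induction n arbitrary: r z)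
  case 0
  show ?case
    unfolding higher_differentiable_on.simps continuous_on_def
  proof
    fix t assume t: "t \<in> T"
    show "(z \<longlongrightarrow> z t) (at t within T)"
    proof (rule pos_def_solution_tendsto[where a = a and ?a0.0 = "a t" and r = r and ?r0.0 = "r t"])
      show "((\<lambda>x. a x b c) \<longlongrightarrow> a t b c) (at t within T)" if "b \<in> Basis" "c \<in> Basis" for b c
        using 0(1)[OF that] t by (simp add: continuous_on_def)
      show "(r \<longlongrightarrow> r t) (at t within T)" using 0(2) t by (simp add: continuous_on_def)
      show "\<forall>\<^sub>F x in at t within T. \<forall>b\<in>Basis. bilin (a x) b (z x) = r x \<bullet> b"
        using 0(3) by (auto simp: eventually_at_filter)
    qed (use t 0(3) pos in auto)
  qed
next
  case (Suc n)
  let ?D = "\<lambda>f t. frechet_derivative f (at t within T) 1"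
  define a' where "a' t b c = ?D (\<lambda>t. a t b c) t" for t b c
  have a': "((\<lambda>t. a t b c) has_vector_derivative a' t b c) (at t within T)" "hd_on T (\<lambda>t. a' t b c) n"
    if "b \<in> Basis" "c \<in> Basis" "t \<in> T" for t b c
    using Suc.prems(1)[OF that(1,2)] that has_vector_derivative_frechet[of "\<lambda>t. a t b c" t T]
    by (simp_all add: a'_def)
  define r' where "r' = ?D r"
  have r': "(r has_vector_derivative r' t) (at t within T)" "hd_on T r' n" if "t \<in> T" for t
    using Suc.prems(2) that has_vector_derivative_frechet[of r t T] by (simp_all add: r'_def)
  define \<rho> where "\<rho> t = r' t - (\<Sum>b\<in>Basis. bilin (a' t) b (z t) *\<^sub>R b)" for t
  have \<rho>b: "\<rho> t \<bullet> b = r' t \<bullet> b - bilin (a' t) b (z t)" if "b \<in> Basis" for t b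
    using that by (simp add: \<rho>_def inner_diff_left inner_sum_left inner_Basis if_distrib cong: if_cong)
  have "\<exists>w. \<forall>b\<in>Basis. bilin (a t) b w = \<rho> t \<bullet> b" if "t \<in> T" for t
    using pos_def_solvable[of "a t" "\<rho> t"] pos[OF that] by blast
  then obtain z' where z': "\<And>t b. t \<in> T \<Longrightarrow> b \<in> Basis \<Longrightarrow> bilin (a t) b (z' t) = \<rho> t \<bullet> b" by metis
  have dz: "(z has_vector_derivative z' t) (at t within T)" if t: "t \<in> T" for t
  proof -
    let ?q = "\<lambda>y. inverse (y - t)"
    define R where "R y = ?q y *\<^sub>R (r y - r t)
       - (\<Sum>b\<in>Basis. (\<Sum>c\<in>Basis. (?q y * (a y b c - a t b c)) * (z t \<bullet> c)) *\<^sub>R b)" for y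
    show ?thesis
      unfolding has_vector_derivative_iff_quotient
    proof (rule pos_def_solution_tendsto[where a = a and ?a0.0 = "a t" and r = R and ?r0.0 = "\<rho> t"])
    show "((\<lambda>x. a x b c) \<longlongrightarrow> a t b c) (at t within T)" if "b \<in> Basis" "c \<in> Basis" for b c
      using has_vector_derivative_continuous[OF a'(1)[OF that t]] by (simp add: continuous_within)
    have qa: "((\<lambda>y. ?q y * (a y b c - a t b c)) \<longlongrightarrow> a' t b c) (at t within T)" if "b \<in> Basis" "c \<in> Basis" for b c
      using a'(1)[OF that t] by (simp add: has_vector_derivative_iff_quotient)
    have "(R \<longlongrightarrow> r' t - (\<Sum>b\<in>Basis. (\<Sum>c\<in>Basis. a' t b c * (z t \<bullet> c)) *\<^sub>R b)) (at t within T)"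
      unfolding R_def
      using r'(1)[OF t, unfolded has_vector_derivative_iff_quotient]
      by (intro tendsto_intros qa)
    then show "(R \<longlongrightarrow> \<rho> t) (at t within T)"
      by (simp add: \<rho>_def bilin_basis)
    show "\<forall>\<^sub>F x in at t within T. \<forall>b\<in>Basis. bilin (a x) b (?q x *\<^sub>R (z x - z t)) = R x \<bullet> b"
      unfolding eventually_at_filter
    proof (rule always_eventually, intro allI impI ballI)
      fix y and b :: 'e assume y: "y \<noteq> t" "y \<in> T" and b: "b \<in> Basis"
      have "bilin (a y) b (z y - z t) = bilin (a y) b (z y) - bilin (a y) b (z t)"
        using bilin_linear(2)[of "a y" b "z y" "- z t"] by (simp add: bilin_linear)
      also have "\<dots> = (r y - r t) \<bullet> b - (bilin (a y) b (z t) - bilin (a t) b (z t))"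
        using Suc.prems(3)[OF y(2) b] Suc.prems(3)[OF t b] by (simp add: inner_diff_left)
      also have "bilin (a y) b (z t) - bilin (a t) b (z t) = (\<Sum>c\<in>Basis. (a y b c - a t b c) * (z t \<bullet> c))"
        using b by (simp add: bilin_basis sum_subtractf left_diff_distrib)
      finally have "bilin (a y) b (?q y *\<^sub>R (z y - z t))
          = ?q y * ((r y - r t) \<bullet> b) - (\<Sum>c\<in>Basis. (?q y * (a y b c - a t b c)) * (z t \<bullet> c))"
        by (simp only: bilin_linear right_diff_distrib[of "?q y" "(r y - r t) \<bullet> b"] sum_distrib_left mult.assoc)
      also have "\<dots> = R y \<bullet> b"
        using b by (simp add: R_def inner_diff_left inner_sum_left inner_Basis if_distrib cong: if_cong)
      finally show "bilin (a y) b (?q y *\<^sub>R (z y - z t)) = R y \<bullet> b" .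
    qed
    qed (use z' t pos in auto)
  qed
  have zn: "hd_on T z n"
    by (rule Suc.IH[OF _ _ Suc.prems(3)]) (use Suc.prems hd_on_Suc_imp in blast)+
  show ?case
  proof (cases "T = {}")
    case True
    then show ?thesis using hd_on_cong[of T z "\<lambda>_. 0" "Suc n"] hd_on_const[OF T] by blast
  next
    case False
    then obtain t0 where t0: "t0 \<in> T" by blast
    show ?thesis
    proof (rule hd_on_real_SucI[OF T dz])
      have "hd_on T (\<lambda>t. r' t - (\<Sum>b\<in>Basis. (\<Sum>c\<in>Basis. a' t b c * (z t \<bullet> c)) *\<^sub>R b)) n"
        using a'(2) t0 r'(2) zn
        by (intro hd_on_diff hd_on_sum hd_on_scaleR hd_on_mult hd_on_inner_left hd_on_const T) auto
      then have \<rho>n: "hd_on T \<rho> n"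
        using hd_on_cong[of T \<rho> "\<lambda>t. r' t - (\<Sum>b\<in>Basis. (\<Sum>c\<in>Basis. a' t b c * (z t \<bullet> c)) *\<^sub>R b)"]
        by (simp add: \<rho>_def bilin_basis)
      show "hd_on T z' n"
        by (rule Suc.IH[OF _ \<rho>n z']) (use Suc.prems hd_on_Suc_imp in blast)+
    qed
  qed
qed

text \<open>The substitution \<open>\<integral> \<mu>\<close> need not be invertible.  But \<open>y\<close> rests wherever \<open>\<mu>\<close> vanishes, so it factors
  through the substitution; the factor is Lipschitz, and its difference quotients are averages of \<open>\<Xi>(y)\<close>
  with weight \<open>\<mu>\<close>.\<close>

lemma reparametrize_by_speed:
  fixes y :: "real \<Rightarrow> 'y::euclidean_space"
  assumes ab: "a \<le> b"
    and \<mu>: "continuous_on {a..b} \<mu>" "\<And>s. s \<in> {a..b} \<Longrightarrow> \<mu> s \<ge> 0"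
    and dy: "\<And>s. s \<in> {a..b} \<Longrightarrow> (y has_vector_derivative \<mu> s *\<^sub>R \<Xi> (y s)) (at s within {a..b})"
    and \<Xi>: "continuous_on {a..b} (\<lambda>s. \<Xi> (y s))"
  obtains z where "z 0 = y a" "z (integral {a..b} \<mu>) = y b"
    "z ` {0..integral {a..b} \<mu>} \<subseteq> y ` {a..b}"
    "\<And>t. t \<in> {0..integral {a..b} \<mu>} \<Longrightarrow>
       (z has_vector_derivative \<Xi> (z t)) (at t within {0..integral {a..b} \<mu>})"
proof -
  define \<sigma> where "\<sigma> s = integral {a..s} \<mu>" for s
  define L where "L = integral {a..b} \<mu>"
  have int: "\<mu> integrable_on {u..v}" if "a \<le> u" "v \<le> b" for u v
    using \<mu>(1) that by (intro integrable_continuous_real continuous_on_subset[OF \<mu>(1)]) auto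
  have \<sigma>diff: "\<sigma> v - \<sigma> u = integral {u..v} \<mu>" if "a \<le> u" "u \<le> v" "v \<le> b" for u v
    using hk_integral_combine[OF that(1,2) int] that by (simp add: \<sigma>_def)
  have \<sigma>mono: "\<sigma> u \<le> \<sigma> v" if "a \<le> u" "u \<le> v" "v \<le> b" for u v
    using \<sigma>diff[OF that] integral_nonneg[OF int[of u v]] that \<mu>(2) by fastforce
  have \<sigma>a: "\<sigma> a = 0" and \<sigma>b: "\<sigma> b = L" by (simp_all add: \<sigma>_def L_def)
  have \<sigma>cont: "continuous_on {a..b} \<sigma>"
    unfolding \<sigma>_def by (rule indefinite_integral_continuous_1[OF int]) auto
  have ydiff: "((\<lambda>s. \<mu> s *\<^sub>R \<Xi> (y s)) has_integral (y v - y u)) {u..v}" if "a \<le> u" "u \<le> v" "v \<le> b" for u v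
    by (rule fundamental_theorem_of_calculus[OF that(2)])
      (use that in \<open>auto intro: has_vector_derivative_within_subset[OF dy]\<close>)
  have est: "norm (y v - y u - (\<sigma> v - \<sigma> u) *\<^sub>R k) \<le> e * (\<sigma> v - \<sigma> u)"
    if uv: "a \<le> u" "u \<le> v" "v \<le> b" and e: "\<And>s. s \<in> {u..v} \<Longrightarrow> norm (\<Xi> (y s) - k) \<le> e" for u v k e
  proof -
    have 1: "(\<mu> has_integral (\<sigma> v - \<sigma> u)) {u..v}"
      using int[of u v] uv by (simp add: \<sigma>diff has_integral_integral)
    have 2: "((\<lambda>s. \<mu> s *\<^sub>R \<Xi> (y s) - \<mu> s *\<^sub>R k) has_integral (y v - y u - (\<sigma> v - \<sigma> u) *\<^sub>R k)) {u..v}"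
      by (intro has_integral_diff ydiff uv has_integral_scaleR_left 1)
    have 3: "((\<lambda>s. e * \<mu> s) has_integral (e * (\<sigma> v - \<sigma> u))) {u..v}"
      using has_integral_mult_right[OF 1] .
    have "norm (integral {u..v} (\<lambda>s. \<mu> s *\<^sub>R \<Xi> (y s) - \<mu> s *\<^sub>R k)) \<le> integral {u..v} (\<lambda>s. e * \<mu> s)"
    proof (rule integral_norm_bound_integral)
      fix s assume s: "s \<in> {u..v}"
      have "norm (\<mu> s *\<^sub>R \<Xi> (y s) - \<mu> s *\<^sub>R k) = \<mu> s * norm (\<Xi> (y s) - k)"
        using s uv \<mu>(2)[of s] by (simp flip: scaleR_right_diff_distrib)
      also have "\<dots> \<le> \<mu> s * e" using s uv \<mu>(2)[of s] e[OF s] by (intro mult_left_mono) auto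
      finally show "norm (\<mu> s *\<^sub>R \<Xi> (y s) - \<mu> s *\<^sub>R k) \<le> e * \<mu> s" by (simp add: mult.commute)
    qed (use 2 3 in auto)
    then show ?thesis by (simp only: integral_unique[OF 2] integral_unique[OF 3])
  qed
  have "compact ((\<lambda>s. \<Xi> (y s)) ` {a..b})" using \<Xi> by (intro compact_continuous_image) auto
  then obtain C where C: "\<And>s. s \<in> {a..b} \<Longrightarrow> norm (\<Xi> (y s)) \<le> C"
    using compact_imp_bounded bounded_iff by (metis imageI)
  have lip: "norm (y v - y u) \<le> C * (\<sigma> v - \<sigma> u)" if "a \<le> u" "u \<le> v" "v \<le> b" for u v
    using est[OF that, of 0 C] C that by simp
  have lip': "norm (y v - y u) \<le> C * \<bar>\<sigma> v - \<sigma> u\<bar>" if "u \<in> {a..b}" "v \<in> {a..b}" for u v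
  proof (cases "u \<le> v")
    case True
    then show ?thesis using lip[of u v] \<sigma>mono[of u v] that by simp
  next
    case False
    then show ?thesis using lip[of v u] \<sigma>mono[of v u] that by (simp add: norm_minus_commute)
  qed
  have "\<exists>s\<in>{a..b}. \<sigma> s = t" if "t \<in> {0..L}" for t
    using IVT'[of \<sigma> a t b] that \<sigma>cont ab by (auto simp: \<sigma>a \<sigma>b)
  then obtain g where g: "\<And>t. t \<in> {0..L} \<Longrightarrow> g t \<in> {a..b} \<and> \<sigma> (g t) = t" by metis
  define z where "z t = y (g t)" for t
  have z\<sigma>: "z (\<sigma> s) = y s" if "s \<in> {a..b}" for s
  proof -
    have "\<sigma> s \<in> {0..L}" using \<sigma>mono[of a s] \<sigma>mono[of s b] that by (simp add: \<sigma>a \<sigma>b)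
    then show ?thesis using lip'[of s "g (\<sigma> s)"] g that by (simp add: z_def)
  qed
  have key: "\<exists>d>0. \<forall>t'\<in>{0..L}. \<bar>t' - t\<bar> < d \<longrightarrow> norm (z t' - z t - (t' - t) *\<^sub>R \<Xi> (z t)) \<le> e * \<bar>t' - t\<bar>"
    if t: "t \<in> {0..L}" and e: "e > 0" for t e
  proof -
    \<comment> \<open>The fibre of \<open>\<sigma>\<close> over \<open>t\<close> may be an interval, but \<open>y\<close> is constant on it; compactness does the rest.\<close>
    obtain d where d: "d > 0" "\<And>s. s \<in> {a..b} \<Longrightarrow> \<bar>\<sigma> s - t\<bar> < d \<Longrightarrow> norm (\<Xi> (y s) - \<Xi> (z t)) \<le> e"
    proof -
      have "\<exists>d>0. \<forall>s\<in>{a..b}. \<bar>\<sigma> s - t\<bar> < d \<longrightarrow> norm (\<Xi> (y s) - \<Xi> (z t)) \<le> e"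
      proof (rule ccontr)
        assume "\<not> ?thesis"
        then have "\<forall>n. \<exists>s\<in>{a..b}. \<bar>\<sigma> s - t\<bar> < 1 / real (Suc n) \<and> norm (\<Xi> (y s) - \<Xi> (z t)) > e"
          by (metis not_le of_nat_0_less_iff zero_less_Suc zero_less_divide_1_iff)
        then obtain f where f: "\<And>n. f n \<in> {a..b}" "\<And>n. \<bar>\<sigma> (f n) - t\<bar> < 1 / real (Suc n)"
            "\<And>n. norm (\<Xi> (y (f n)) - \<Xi> (z t)) > e" by metis
        obtain l r where lr: "l \<in> {a..b}" "strict_mono r" "(f \<circ> r) \<longlonglongrightarrow> l"
          using f(1) compact_Icc[of a b] unfolding compact_def by metis
        have "(\<lambda>n. \<sigma> ((f \<circ> r) n)) \<longlonglongrightarrow> \<sigma> l"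
          using continuous_on_tendsto_compose[OF \<sigma>cont lr(3,1)] f(1) by auto
        moreover have "(\<lambda>n. \<sigma> (f n)) \<longlonglongrightarrow> t"
        proof (rule Lim_transform_bound[where g = "\<lambda>n. 1 / real (Suc n)", THEN LIM_zero_cancel])
          show "(\<lambda>n. 1 / real (Suc n)) \<longlonglongrightarrow> 0" by (rule LIMSEQ_Suc[OF lim_1_over_n])
          show "\<forall>\<^sub>F n in sequentially. norm (\<sigma> (f n) - t) \<le> norm (1 / real (Suc n))"
            using f(2) by (intro always_eventually) (auto simp: less_imp_le)
        qed
        then have "(\<lambda>n. \<sigma> ((f \<circ> r) n)) \<longlonglongrightarrow> t" using LIMSEQ_subseq_LIMSEQ[OF _ lr(2)] by (simp add: o_def)
        ultimately have "\<sigma> l = t" using LIMSEQ_unique by blast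
        then have yl: "y l = z t" using z\<sigma>[OF lr(1)] by simp
        have "(\<lambda>n. \<Xi> (y ((f \<circ> r) n))) \<longlonglongrightarrow> \<Xi> (y l)"
          using continuous_on_tendsto_compose[OF \<Xi> lr(3,1)] f(1) by auto
        then have "\<forall>\<^sub>F n in sequentially. norm (\<Xi> (y ((f \<circ> r) n)) - \<Xi> (y l)) < e"
          using e by (simp add: tendsto_iff dist_norm)
        then obtain n where "norm (\<Xi> (y ((f \<circ> r) n)) - \<Xi> (y l)) < e"
          using eventually_happens' sequentially_bot by blast
        then show False using f(3)[of "r n"] yl by simp
      qed
      then show ?thesis using that by blast
    qed
    show ?thesis
    proof (intro exI[of _ d] conjI d(1) ballI impI)
      fix t' assume t': "t' \<in> {0..L}" "\<bar>t' - t\<bar> < d"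
      define u v where "u = g t" and "v = g t'"
      have uv: "u \<in> {a..b}" "v \<in> {a..b}" "\<sigma> u = t" "\<sigma> v = t'" "y u = z t" "y v = z t'"
        using g t t' by (auto simp: u_def v_def z_def)
      show "norm (z t' - z t - (t' - t) *\<^sub>R \<Xi> (z t)) \<le> e * \<bar>t' - t\<bar>"
      proof (cases "u \<le> v")
        case True
        have "norm (\<Xi> (y s) - \<Xi> (z t)) \<le> e" if "s \<in> {u..v}" for s
          using d(2)[of s] \<sigma>mono[of u s] \<sigma>mono[of s v] uv that t'(2) by auto
        then show ?thesis using est[of u v "\<Xi> (z t)" e] True uv \<sigma>mono[of u v] by auto
      next
        case False
        have "norm (\<Xi> (y s) - \<Xi> (z t)) \<le> e" if "s \<in> {v..u}" for s
          using d(2)[of s] \<sigma>mono[of v s] \<sigma>mono[of s u] uv that t'(2) by auto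
        then have "norm (z t - z t' - (t - t') *\<^sub>R \<Xi> (z t)) \<le> e * (t - t')"
          using est[of v u "\<Xi> (z t)" e] False uv by auto
        moreover have "norm (z t' - z t - (t' - t) *\<^sub>R \<Xi> (z t)) = norm (z t - z t' - (t - t') *\<^sub>R \<Xi> (z t))"
          by (subst norm_minus_cancel[symmetric]) (simp add: algebra_simps)
        moreover have "\<bar>t' - t\<bar> = t - t'" using \<sigma>mono[of v u] False uv by simp
        ultimately show ?thesis by simp
      qed
    qed
  qed
  have "(z has_vector_derivative \<Xi> (z t)) (at t within {0..L})" if t: "t \<in> {0..L}" for t
    unfolding has_vector_derivative_def has_derivative_within_alt
  proof (intro conjI allI impI)
    show "bounded_linear (\<lambda>x. x *\<^sub>R \<Xi> (z t))" by (rule bounded_linear_scaleR_left)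
    fix e :: real assume "e > 0"
    from key[OF t this] show "\<exists>d>0. \<forall>t'\<in>{0..L}. norm (t' - t) < d \<longrightarrow>
        norm (z t' - z t - (t' - t) *\<^sub>R \<Xi> (z t)) \<le> e * norm (t' - t)" by simp
  qed
  moreover have "z 0 = y a" using z\<sigma>[of a] ab by (simp add: \<sigma>a)
  moreover have "z L = y b" using z\<sigma>[of b] ab by (simp add: \<sigma>b)
  moreover have "z ` {0..L} \<subseteq> y ` {a..b}" using g by (auto simp: z_def)
  ultimately show ?thesis using that unfolding L_def by blast
qed

section \<open>Charts, tangent vectors and curves\<close>

abbreviation transition :: "('a, 'e) chart \<Rightarrow> ('a, 'e) chart \<Rightarrow> 'e \<Rightarrow> 'e" where
  "transition c d \<equiv> chart_map d \<circ> chart_inv c"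

abbreviation transition_deriv :: "('a, 'e::euclidean_space) chart \<Rightarrow> ('a, 'e) chart \<Rightarrow> 'a \<Rightarrow> 'e \<Rightarrow> 'e" where
  "transition_deriv c d p \<equiv> frechet_derivative (transition c d) (at (chart_map c p))"

locale manifold =
  fixes A :: "('a::{t2_space, second_countable_topology}, 'e::euclidean_space) chart set"
  assumes atlas: "smooth_atlas A"
begin

lemma chart_at: obtains d where "d \<in> A" "p \<in> chart_dom d"
proof -
  have "p \<in> (\<Union>c\<in>A. chart_dom c)" using atlas by (simp add: smooth_atlas_def)
  then show ?thesis using that by blast
qed

lemma
  assumes "d \<in> A"
  shows open_chart_dom: "open (chart_dom d)"
    and open_chart_image: "open (chart_image d)"
    and continuous_on_chart_map: "continuous_on (chart_dom d) (chart_map d)"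
    and continuous_on_chart_inv: "continuous_on (chart_image d) (chart_inv d)"
    and inj_on_chart_map: "inj_on (chart_map d) (chart_dom d)"
  using atlas assms unfolding smooth_atlas_def homeomorphism_def
  by (blast, blast, blast, blast, metis inj_on_inverseI)

lemma chart_inv_map [simp]: "d \<in> A \<Longrightarrow> p \<in> chart_dom d \<Longrightarrow> chart_inv d (chart_map d p) = p"
  by (simp add: inj_on_chart_map)

lemma chart_inv_dom: "y \<in> chart_image d \<Longrightarrow> chart_inv d y \<in> chart_dom d"
  by (simp add: inv_into_into)

lemma open_overlap:
  assumes "c \<in> A" "d \<in> A"
  shows "open (chart_map c ` (chart_dom c \<inter> chart_dom d))"
proof -
  have "chart_map c ` (chart_dom c \<inter> chart_dom d) = chart_image c \<inter> chart_inv c -` chart_dom d"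
    using assms by (auto simp: inj_on_chart_map intro!: image_eqI)
  then show ?thesis
    using continuous_open_preimage[OF continuous_on_chart_inv[OF assms(1)] open_chart_image[OF assms(1)]
        open_chart_dom[OF assms(2)]] by simp
qed

lemma hd_on_transition:
  assumes "c \<in> A" "d \<in> A"
  shows "hd_on (chart_map c ` (chart_dom c \<inter> chart_dom d)) (transition c d) n"
  using atlas assms unfolding smooth_atlas_def smooth_on_def by blast

lemma has_derivative_transition:
  assumes "c \<in> A" "d \<in> A" "p \<in> chart_dom c" "p \<in> chart_dom d"
  shows "(transition c d has_derivative transition_deriv c d p) (at (chart_map c p))"
proof -
  have p: "chart_map c p \<in> chart_map c ` (chart_dom c \<inter> chart_dom d)" using assms by blast
  show ?thesis
    using hd_on_SucD[OF hd_on_transition[OF assms(1,2), of "Suc 0"] p]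
    by (simp only: at_within_open[OF p open_overlap[OF assms(1,2)]])
qed

lemma transition_deriv_same:
  assumes "c \<in> A" "p \<in> chart_dom c"
  shows "transition_deriv c c p = (\<lambda>e. e)"
proof -
  have "((\<lambda>e. e) has_derivative (\<lambda>e. e)) (at (chart_map c p))" by (rule has_derivative_ident)
  then have "(transition c c has_derivative (\<lambda>e. e)) (at (chart_map c p))"
    by (rule has_derivative_transform_within_open[OF _ open_chart_image[OF assms(1)]])
      (use assms in auto)
  then show ?thesis using frechet_derivative_at by metis
qed

lemma transition_deriv_compose:
  assumes "c \<in> A" "d \<in> A" "k \<in> A" "p \<in> chart_dom c" "p \<in> chart_dom d" "p \<in> chart_dom k"
  shows "transition_deriv d k p (transition_deriv c d p e) = transition_deriv c k p e"
proof -
  have p: "chart_map c p \<in> chart_map c ` (chart_dom c \<inter> chart_dom d)" using assms by blast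
  have "(transition d k has_derivative transition_deriv d k p) (at (transition c d (chart_map c p)))"
    using has_derivative_transition[of d k p] assms by simp
  with has_derivative_transition[of c d p] assms
  have "((transition d k \<circ> transition c d) has_derivative (transition_deriv d k p \<circ> transition_deriv c d p))
      (at (chart_map c p))" by (intro diff_chain_at) auto
  then have "(transition c k has_derivative (transition_deriv d k p \<circ> transition_deriv c d p)) (at (chart_map c p))"
    by (rule has_derivative_transform_within_open[OF _ open_overlap[OF assms(1,2)] p])
      (use assms in auto)
  then have "transition_deriv d k p \<circ> transition_deriv c d p = transition_deriv c k p"
    using frechet_derivative_at by metis
  then show ?thesis by (metis comp_apply)
qed

lemma linear_transition_deriv:
  assumes "c \<in> A" "d \<in> A" "p \<in> chart_dom c" "p \<in> chart_dom d"
  shows "linear (transition_deriv c d p)"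
  using has_derivative_linear[OF has_derivative_transition[OF assms]] .

lemma coord_vector_in_tangent_space:
  assumes "c \<in> A" "p \<in> chart_dom c"
  shows "coord_vector A c p e \<in> tangent_space A p"
  using assms by (auto simp: tangent_space_def coord_vector_def transition_deriv_compose)

lemma tangent_eq_coord_vector:
  assumes "c \<in> A" "p \<in> chart_dom c" "v \<in> tangent_space A p"
  shows "v = coord_vector A c p (v c)"
proof
  fix d show "v d = coord_vector A c p (v c) d"
  proof (cases "d \<in> A \<and> p \<in> chart_dom d")
    case True
    then have "v d = transition_deriv c d p (v c)" using assms unfolding tangent_space_def by blast
    then show ?thesis using True by (simp add: coord_vector_def)
  next
    case False
    then have "v d = 0" using assms(3) unfolding tangent_space_def by blast
    then show ?thesis using False by (auto simp: coord_vector_def)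
  qed
qed

lemma coord_vector_same: "c \<in> A \<Longrightarrow> p \<in> chart_dom c \<Longrightarrow> coord_vector A c p e c = e"
  by (simp add: coord_vector_def transition_deriv_same)

lemma coord_vector_combine:
  assumes "c \<in> A" "p \<in> chart_dom c"
  shows "coord_vector A c p (a *\<^sub>R e + b *\<^sub>R e') = (\<lambda>d. a *\<^sub>R coord_vector A c p e d + b *\<^sub>R coord_vector A c p e' d)"
proof
  fix d
  show "coord_vector A c p (a *\<^sub>R e + b *\<^sub>R e') d = a *\<^sub>R coord_vector A c p e d + b *\<^sub>R coord_vector A c p e' d"
    using linear_transition_deriv[OF assms(1) _ assms(2), of d]
    by (auto simp: coord_vector_def linear_add linear_scale)
qed

lemma zero_in_tangent_space: "(\<lambda>_. 0) \<in> tangent_space A p"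
  by (auto simp: tangent_space_def linear_0[OF linear_transition_deriv])

text \<open>Every tangent vector is a coordinate vector, and these depend linearly on the coordinates.\<close>

lemma linear_on_tangent_space_coords:
  assumes L: "linear_on_tangent_space A p L" and c: "c \<in> A" "p \<in> chart_dom c" and v: "v \<in> tangent_space A p"
  shows "L v = (\<Sum>b\<in>Basis. L (coord_vector A c p b) * (v c \<bullet> b))"
proof -
  define M where "M e = L (coord_vector A c p e)" for e
  have M: "M (a *\<^sub>R e + b *\<^sub>R e') = a * M e + b * M e'" for a b e e'
    using L coord_vector_in_tangent_space[OF c] coord_vector_combine[OF c]
    unfolding M_def linear_on_tangent_space_def by simp
  have lin: "linear M"
  proof (rule linearI)
    show "M (x + y) = M x + M y" for x y using M[of 1 x 1 y] by simp
    show "M (r *\<^sub>R x) = r *\<^sub>R M x" for r x using M[of r x 0 x] by simp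
  qed
  have "L v = M (v c)" unfolding M_def using tangent_eq_coord_vector[OF c v] by (rule arg_cong)
  also have "\<dots> = M (\<Sum>b\<in>Basis. (v c \<bullet> b) *\<^sub>R b)" by (simp add: euclidean_representation)
  also have "\<dots> = (\<Sum>b\<in>Basis. M b * (v c \<bullet> b))"
    by (simp add: linear_sum[OF lin] linear_scale[OF lin] mult.commute)
  finally show ?thesis by (simp add: M_def)
qed

lemma curve_chart_domain:
  fixes c :: "real \<Rightarrow> 'a"
  assumes "continuous_on I c" "d \<in> A"
  shows "openin (top_of_set I) {s \<in> I. c s \<in> chart_dom d}"
  using continuous_openin_preimage_gen[OF assms(1) open_chart_dom[OF assms(2)]]
  by (simp add: vimage_def Int_def)

lemma at_within_openin:
  fixes s :: "'x::topological_space"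
  assumes "openin (top_of_set I) J" "s \<in> J"
  shows "at s within J = at s within I"
proof -
  obtain U where U: "open U" "J = I \<inter> U" using assms(1) by (auto simp: openin_open)
  then show ?thesis using assms(2) by (intro at_within_nhd[of s U]) auto
qed

lemma smooth_curve_on_chart:
  assumes "smooth_curve_on A I c" "d \<in> A"
  shows "hd_on {s \<in> I. c s \<in> chart_dom d} (chart_map d \<circ> c) n"
  using assms by (auto simp: smooth_curve_on_def smooth_on_def)

lemma has_vector_derivative_velocity:
  assumes c: "smooth_curve_on A I c" and I: "derivative_unique_on I"
    and s: "s \<in> I" and d: "d \<in> A" "c s \<in> chart_dom d"
  shows "(chart_map d \<circ> c has_vector_derivative velocity A I c s d) (at s within I)"
proof -
  have s': "s \<in> {s \<in> I. c s \<in> chart_dom d}" using s d by simp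
  have o: "openin (top_of_set I) {s \<in> I. c s \<in> chart_dom d}"
    using c d curve_chart_domain unfolding smooth_curve_on_def by blast
  have "(chart_map d \<circ> c) differentiable at s within {s \<in> I. c s \<in> chart_dom d}"
    using smooth_curve_on_chart[OF c d(1), of "Suc 0"] s' by simp
  then have "(chart_map d \<circ> c) differentiable at s within I"
    unfolding at_within_openin[OF o s'] .
  then show ?thesis using d by (simp add: velocity_def vector_derivative_works)
qed

lemma velocity_eqI:
  assumes I: "derivative_unique_on I" and s: "s \<in> I" and d: "d \<in> A" "c s \<in> chart_dom d"
    and "(chart_map d \<circ> c has_vector_derivative w) (at s within I)"
  shows "velocity A I c s d = w"
  using assms vector_derivative_within[of s I] unfolding derivative_unique_on_real_iff
  by (simp add: velocity_def)

lemma velocity_in_tangent_space: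
  assumes c: "smooth_curve_on A I c" and I: "derivative_unique_on I" and s: "s \<in> I"
  shows "velocity A I c s \<in> tangent_space A (c s)"
  unfolding tangent_space_def
proof (intro CollectI conjI ballI allI impI)
  fix d k assume d: "d \<in> A" "c s \<in> chart_dom d" and k: "k \<in> A" "c s \<in> chart_dom k"
  have "(chart_map d \<circ> c has_derivative (\<lambda>h. h *\<^sub>R velocity A I c s d)) (at s within I)"
    using has_vector_derivative_velocity[OF c I s d] by (simp add: has_vector_derivative_def)
  moreover have "(transition d k has_derivative transition_deriv d k (c s))
      (at ((chart_map d \<circ> c) s) within (chart_map d \<circ> c) ` I)"
    using has_derivative_transition[OF d(1) k(1) d(2) k(2)] by (simp add: has_derivative_at_withinI)
  ultimately have "(transition d k \<circ> (chart_map d \<circ> c) has_derivative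
      transition_deriv d k (c s) \<circ> (\<lambda>h. h *\<^sub>R velocity A I c s d)) (at s within I)"
    by (rule diff_chain_within)
  moreover have "transition_deriv d k (c s) \<circ> (\<lambda>h. h *\<^sub>R velocity A I c s d)
      = (\<lambda>h. h *\<^sub>R transition_deriv d k (c s) (velocity A I c s d))"
    using linear_transition_deriv[OF d(1) k(1) d(2) k(2)] by (auto simp: linear_scale)
  ultimately have "(transition d k \<circ> (chart_map d \<circ> c) has_vector_derivative
      transition_deriv d k (c s) (velocity A I c s d)) (at s within I)"
    by (simp add: has_vector_derivative_def)
  moreover have o: "openin (top_of_set I) {s \<in> I. c s \<in> chart_dom d}"
    using c d curve_chart_domain unfolding smooth_curve_on_def by blast
  ultimately have "(transition d k \<circ> (chart_map d \<circ> c) has_vector_derivative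
      transition_deriv d k (c s) (velocity A I c s d)) (at s within {s \<in> I. c s \<in> chart_dom d})"
    using at_within_openin[OF o, of s] s d by simp
  then have "(chart_map k \<circ> c has_vector_derivative
      transition_deriv d k (c s) (velocity A I c s d)) (at s within {s \<in> I. c s \<in> chart_dom d})"
    by (rule has_vector_derivative_transform[rotated 2]) (use s d in auto)
  then have "(chart_map k \<circ> c has_vector_derivative
      transition_deriv d k (c s) (velocity A I c s d)) (at s within I)"
    using at_within_openin[OF o, of s] s d by simp
  then show "velocity A I c s k = transition_deriv d k (c s) (velocity A I c s d)"
    by (rule velocity_eqI[where c = c, OF I s k])
qed (auto simp: velocity_def)

lemma smooth_curve_on_subset:
  assumes c: "smooth_curve_on A I c" and J: "J \<subseteq> I" "derivative_unique_on J"
  shows "smooth_curve_on A J c"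
  unfolding smooth_curve_on_def smooth_on_def
proof (intro conjI ballI allI)
  show cont: "continuous_on J c" using c J continuous_on_subset unfolding smooth_curve_on_def by blast
  fix d n assume d: "d \<in> A"
  have "derivative_unique_on {s \<in> J. c s \<in> chart_dom d}"
    using derivative_unique_on_relopen[OF J(2) curve_chart_domain[OF cont d]] .
  then show "hd_on {s \<in> J. c s \<in> chart_dom d} (chart_map d \<circ> c) n"
    by (rule hd_on_subset[OF _ _ smooth_curve_on_chart[OF c d]]) (use J in auto)
qed

lemma velocity_subset:
  assumes c: "smooth_curve_on A I c" and I: "derivative_unique_on I"
    and J: "J \<subseteq> I" "derivative_unique_on J" and s: "s \<in> J"
  shows "velocity A J c s = velocity A I c s"
proof
  fix d
  show "velocity A J c s d = velocity A I c s d"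
  proof (cases "d \<in> A \<and> c s \<in> chart_dom d")
    case True
    have "s \<in> I" using s J(1) by blast
    then show ?thesis
      using has_vector_derivative_within_subset[OF has_vector_derivative_velocity[OF c I] J(1), of s d] True
      by (intro velocity_eqI[where c = c, OF J(2) s]) auto
  qed (auto simp: velocity_def)
qed

text \<open>Transition maps are smooth, so a single chart decides about a curve that stays in it.\<close>

lemma smooth_curve_onI:
  fixes c :: "real \<Rightarrow> 'a"
  assumes I: "derivative_unique_on I" and d: "d \<in> A" and cd: "c ` I \<subseteq> chart_dom d"
    and x: "\<And>n. hd_on I (chart_map d \<circ> c) n"
  shows "smooth_curve_on A I c"
  unfolding smooth_curve_on_def smooth_on_def
proof (intro conjI ballI allI)
  have "continuous_on I (chart_inv d \<circ> (chart_map d \<circ> c))"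
    by (rule continuous_on_compose[OF hd_on_continuous[OF x] continuous_on_subset[OF continuous_on_chart_inv[OF d]]])
      (use cd in auto)
  then show cont: "continuous_on I c"
    by (rule continuous_on_eq) (use cd d in auto)
  fix k n assume k: "k \<in> A"
  let ?J = "{s \<in> I. c s \<in> chart_dom k}"
  have J: "derivative_unique_on ?J"
    using derivative_unique_on_relopen[OF I curve_chart_domain[OF cont k]] .
  have "hd_on ?J (\<lambda>s. transition d k ((chart_map d \<circ> c) s)) n"
  proof (rule hd_on_compose[OF J derivative_unique_on_open[OF open_overlap[OF d k]] _ hd_on_transition[OF d k]])
    show "(chart_map d \<circ> c) ` ?J \<subseteq> chart_map d ` (chart_dom d \<inter> chart_dom k)" using cd by auto
    show "hd_on ?J (chart_map d \<circ> c) n" by (rule hd_on_subset[OF J _ x]) auto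
  qed
  then show "hd_on ?J (chart_map k \<circ> c) n"
    by (subst hd_on_cong[where g = "\<lambda>s. transition d k ((chart_map d \<circ> c) s)"]) (use cd d in auto)
qed

lemma smooth_curve_on_cong:
  assumes "\<And>s. s \<in> I \<Longrightarrow> c s = c' s"
  shows "smooth_curve_on A I c \<longleftrightarrow> smooth_curve_on A I c'"
proof -
  have "smooth_on {s \<in> I. c s \<in> chart_dom d} (chart_map d \<circ> c) \<longleftrightarrow>
        smooth_on {s \<in> I. c' s \<in> chart_dom d} (chart_map d \<circ> c')" for d :: "('a, 'e) chart"
  proof -
    have "{s \<in> I. c s \<in> chart_dom d} = {s \<in> I. c' s \<in> chart_dom d}" using assms by auto
    moreover have "smooth_on {s \<in> I. c' s \<in> chart_dom d} (chart_map d \<circ> c) \<longleftrightarrow>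
        smooth_on {s \<in> I. c' s \<in> chart_dom d} (chart_map d \<circ> c')"
      by (rule smooth_on_cong) (use assms in auto)
    ultimately show ?thesis by simp
  qed
  moreover have "continuous_on I c \<longleftrightarrow> continuous_on I c'"
    by (rule continuous_on_cong[OF refl]) (use assms in auto)
  ultimately show ?thesis by (simp add: smooth_curve_on_def)
qed

lemma velocity_cong:
  assumes "\<And>s. s \<in> I \<Longrightarrow> c s = c' s" "s \<in> I"
  shows "velocity A I c s = velocity A I c' s"
proof -
  have "(chart_map d \<circ> c has_vector_derivative w) (at s within I) \<longleftrightarrow>
        (chart_map d \<circ> c' has_vector_derivative w) (at s within I)" for d :: "('a, 'e) chart" and w
    using has_vector_derivative_transform[of s I "chart_map d \<circ> c" "chart_map d \<circ> c'" w]
      has_vector_derivative_transform[of s I "chart_map d \<circ> c'" "chart_map d \<circ> c" w] assms by fastforce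
  then have "vector_derivative (chart_map d \<circ> c) (at s within I) = vector_derivative (chart_map d \<circ> c') (at s within I)"
    for d :: "('a, 'e) chart" by (simp add: vector_derivative_def)
  then show ?thesis using assms by (intro ext) (auto simp: velocity_def)
qed

text \<open>Used with \<open>k = 1\<close> to concatenate curves and with \<open>k = - 1\<close> to reverse time.\<close>

lemma smooth_curve_on_affine:
  assumes c: "smooth_curve_on A {a..b} c" and J: "a < b" "k \<noteq> 0" "J = {s. r + k * s \<in> {a..b}}"
  shows "smooth_curve_on A J (\<lambda>s. c (r + k * s))"
    and "s \<in> J \<Longrightarrow> velocity A J (\<lambda>s. c (r + k * s)) s = (\<lambda>d. k *\<^sub>R velocity A {a..b} c (r + k * s) d)"
    and "derivative_unique_on J"
proof -
  show Ju: "derivative_unique_on J"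
  proof (cases "k > 0")
    case True
    then have "J = {(a - r) / k .. (b - r) / k}" using J by (auto simp: field_simps)
    then show ?thesis using True J by (simp add: derivative_unique_on_Icc divide_strict_right_mono)
  next
    case False
    then have k: "k < 0" using J by simp
    then have "J = {(b - r) / k .. (a - r) / k}" using J by (auto simp: field_simps)
    then show ?thesis using k J by (simp add: derivative_unique_on_Icc divide_strict_right_mono_neg)
  qed
  have cont: "continuous_on J (\<lambda>s. c (r + k * s))"
    using c J(3) unfolding smooth_curve_on_def
    by (auto intro!: continuous_on_compose2[of "{a..b}" c] continuous_intros)
  have I: "derivative_unique_on {a..b}" using J(1) by (rule derivative_unique_on_Icc)
  show "smooth_curve_on A J (\<lambda>s. c (r + k * s))"
    unfolding smooth_curve_on_def smooth_on_def
  proof (intro conjI ballI allI cont)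
    fix d n assume d: "d \<in> A"
    have eq: "{s \<in> J. c (r + k * s) \<in> chart_dom d} = {s. r + k * s \<in> {s \<in> {a..b}. c s \<in> chart_dom d}}"
      using J(3) by auto
    have "derivative_unique_on {s. r + k * s \<in> {s \<in> {a..b}. c s \<in> chart_dom d}}"
      using derivative_unique_on_relopen[OF Ju curve_chart_domain[OF cont d]] eq by simp
    from hd_on_affine[OF this smooth_curve_on_chart[OF c d, of n]]
    show "hd_on {s \<in> J. c (r + k * s) \<in> chart_dom d} (chart_map d \<circ> (\<lambda>s. c (r + k * s))) n"
      unfolding eq by (simp add: o_def)
  qed
  assume s: "s \<in> J"
  show "velocity A J (\<lambda>s. c (r + k * s)) s = (\<lambda>d. k *\<^sub>R velocity A {a..b} c (r + k * s) d)"
  proof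
    fix d
    show "velocity A J (\<lambda>s. c (r + k * s)) s d = k *\<^sub>R velocity A {a..b} c (r + k * s) d"
    proof (cases "d \<in> A \<and> c (r + k * s) \<in> chart_dom d")
      case True
      have 1: "((\<lambda>s. r + k * s) has_vector_derivative k) (at s within J)"
        by (auto intro!: derivative_eq_intros)
      have 2: "(chart_map d \<circ> c has_vector_derivative velocity A {a..b} c (r + k * s) d)
          (at (r + k * s) within (\<lambda>s. r + k * s) ` J)"
        by (rule has_vector_derivative_within_subset[OF has_vector_derivative_velocity[OF c I]])
          (use True s J(3) in auto)
      show ?thesis
      proof (rule velocity_eqI[where c = "\<lambda>s. c (r + k * s)", OF Ju s])
        show "(chart_map d \<circ> (\<lambda>s. c (r + k * s)) has_vector_derivative k *\<^sub>R velocity A {a..b} c (r + k * s) d)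
            (at s within J)"
          using vector_diff_chain_within[OF 1 2] by (simp add: o_def)
      qed (use True in auto)
    qed (auto simp: velocity_def)
  qed
qed

end

section \<open>The product manifold\<close>

lemma hd_on_ident: "derivative_unique_on S \<Longrightarrow> hd_on S (\<lambda>x. x) n"
proof (cases n)
  case (Suc m)
  assume "derivative_unique_on S"
  then show ?thesis unfolding Suc
    by (intro hd_on_SucI[OF _ has_derivative_ident] hd_on_const)
qed simp

definition lift_chart :: "('a, 'e) chart \<Rightarrow> (real \<times> 'a, real \<times> 'e) chart" where
  "lift_chart c = (UNIV \<times> chart_dom c, \<lambda>(t, x). (t, chart_map c x))"

lemma som_atlas_eq: "som_atlas A = lift_chart ` A"
  by (simp add: som_atlas_def lift_chart_def)

lemma lift_chart_simps [simp]:
  "chart_dom (lift_chart c) = UNIV \<times> chart_dom c"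
  "chart_map (lift_chart c) (t, x) = (t, chart_map c x)"
  by (simp_all add: lift_chart_def)

lemma chart_map_lift: "chart_map (lift_chart c) p = (fst p, chart_map c (snd p))"
  by (simp add: lift_chart_def split_beta)

lemma chart_map_lift_image: "chart_map (lift_chart c) ` (UNIV \<times> B) = UNIV \<times> (chart_map c ` B)"
  by (auto simp: chart_map_lift image_iff)

context manifold
begin

lemma chart_inv_lift:
  assumes "c \<in> A" "snd q \<in> chart_image c"
  shows "chart_inv (lift_chart c) q = (fst q, chart_inv c (snd q))"
proof (rule inv_into_f_eq)
  show "inj_on (chart_map (lift_chart c)) (chart_dom (lift_chart c))"
    using inj_on_chart_map[OF assms(1)] by (auto simp: inj_on_def)
  show "(fst q, chart_inv c (snd q)) \<in> chart_dom (lift_chart c)"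
    using chart_inv_dom[OF assms(2)] by simp
  show "chart_map (lift_chart c) (fst q, chart_inv c (snd q)) = q"
    using assms by (simp add: f_inv_into_f)
qed

lemma transition_lift:
  assumes "c \<in> A" "snd q \<in> chart_image c"
  shows "transition (lift_chart c) (lift_chart d) q = (fst q, transition c d (snd q))"
  unfolding comp_apply chart_inv_lift[OF assms] by (rule lift_chart_simps)

lemma overlap_lift:
  "chart_map (lift_chart c) ` (chart_dom (lift_chart c) \<inter> chart_dom (lift_chart d))
    = UNIV \<times> chart_map c ` (chart_dom c \<inter> chart_dom d)"
proof -
  have "chart_dom (lift_chart c) \<inter> chart_dom (lift_chart d) = UNIV \<times> (chart_dom c \<inter> chart_dom d)" by auto
  then show ?thesis by (simp only: chart_map_lift_image)
qed

text \<open>Thereby all facts about curves and tangent vectors of a manifold are available for the spacetime.\<close>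

lemma smooth_atlas_som_atlas: "smooth_atlas (som_atlas A)"
  unfolding smooth_atlas_def som_atlas_eq
proof (intro conjI ballI)
  show "(\<Union>c\<in>lift_chart ` A. chart_dom c) = UNIV"
  proof -
    have "\<exists>d\<in>A. p \<in> chart_dom d" for p by (rule chart_at[of p]) blast
    then show ?thesis by auto
  qed
next
  fix C assume "C \<in> lift_chart ` A"
  then obtain c where c: "c \<in> A" "C = lift_chart c" by blast
  show "open (chart_dom C)" using c open_chart_dom by (simp add: open_Times)
  show "open (chart_image C)" using c open_chart_image by (simp add: chart_map_lift_image open_Times)
  have 1: "continuous_on (UNIV \<times> chart_dom c) (\<lambda>p. (fst p, chart_map c (snd p)))"
    by (intro continuous_intros continuous_on_compose2[OF continuous_on_chart_map[OF c(1)]]) auto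
  have "continuous_on (UNIV \<times> chart_image c) (\<lambda>q. (fst q, chart_inv c (snd q)))"
    by (intro continuous_intros continuous_on_compose2[OF continuous_on_chart_inv[OF c(1)]]) auto
  then have 2: "continuous_on (UNIV \<times> chart_image c) (chart_inv (lift_chart c))"
  proof (rule continuous_on_eq)
    fix q :: "real \<times> 'e" assume "q \<in> UNIV \<times> chart_image c"
    then have "snd q \<in> chart_image c" by auto
    from chart_inv_lift[OF c(1) this] show "(fst q, chart_inv c (snd q)) = chart_inv (lift_chart c) q" by (rule sym)
  qed
  show "homeomorphism (chart_dom C) (chart_image C) (chart_map C) (chart_inv C)"
  proof (rule homeomorphismI)
    show "continuous_on (chart_dom C) (chart_map C)"
      using 1 c by (simp add: chart_map_lift[abs_def])
    show "continuous_on (chart_image C) (chart_inv C)"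
      using 2 c by (simp add: chart_map_lift_image)
    have eq: "chart_inv (lift_chart c) (chart_map (lift_chart c) p) = p" if "p \<in> UNIV \<times> chart_dom c" for p
    proof -
      have "snd p \<in> chart_dom c" using that by auto
      then have "chart_inv (lift_chart c) (chart_map (lift_chart c) p) = (fst p, chart_inv c (chart_map c (snd p)))"
        using chart_inv_lift[OF c(1), of "chart_map (lift_chart c) p"] by (simp add: chart_map_lift del: lift_chart_simps)
      then show ?thesis using \<open>snd p \<in> chart_dom c\<close> c by simp
    qed
    show "chart_inv C ` chart_image C \<subseteq> chart_dom C" using eq c by auto
    show "chart_inv C (chart_map C p) = p" if "p \<in> chart_dom C" for p using eq that c by simp
    show "chart_map C (chart_inv C q) = q" if "q \<in> chart_image C" for q
      using that by (simp add: f_inv_into_f)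
  qed simp
next
  fix C D assume "C \<in> lift_chart ` A" "D \<in> lift_chart ` A"
  then obtain c d where c: "c \<in> A" "C = lift_chart c" and d: "d \<in> A" "D = lift_chart d" by blast
  let ?T = "chart_map c ` (chart_dom c \<inter> chart_dom d)"
  have oT: "open ?T" by (rule open_overlap[OF c(1) d(1)])
  have T: "derivative_unique_on ((UNIV :: real set) \<times> ?T)"
    by (intro derivative_unique_on_open open_Times open_UNIV oT)
  have "hd_on ((UNIV :: real set) \<times> ?T) (\<lambda>q. (fst q, transition c d (snd q))) n" for n
  proof (rule hd_on_Pair[OF T])
    show "hd_on (UNIV \<times> ?T) (fst :: real \<times> 'e \<Rightarrow> real) n"
      using hd_on_bounded_linear[OF T bounded_linear_fst hd_on_ident[OF T]] .
    show "hd_on ((UNIV :: real set) \<times> ?T) (\<lambda>q. transition c d (snd q)) n"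
      by (rule hd_on_compose[OF T derivative_unique_on_open[OF oT] _ hd_on_transition[OF c(1) d(1)]
            hd_on_bounded_linear[OF T bounded_linear_snd hd_on_ident[OF T]]]) auto
  qed
  then have "smooth_on ((UNIV :: real set) \<times> ?T) (\<lambda>q. (fst q, transition c d (snd q)))"
    by (simp add: smooth_on_def)
  moreover have "smooth_on ((UNIV :: real set) \<times> ?T) (\<lambda>q. (fst q, transition c d (snd q)))
      \<longleftrightarrow> smooth_on (UNIV \<times> ?T) (transition C D)"
  proof (rule smooth_on_cong)
    fix q :: "real \<times> 'e" assume "q \<in> UNIV \<times> ?T"
    then have "snd q \<in> chart_image c" by auto
    from transition_lift[OF c(1) this, of d] show "(fst q, transition c d (snd q)) = transition C D q"
      by (simp only: c d)
  qed
  ultimately show "smooth_on (chart_map C ` (chart_dom C \<inter> chart_dom D)) (transition C D)"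
    by (simp only: c d overlap_lift)
qed

lemma transition_deriv_lift:
  assumes "c \<in> A" "d \<in> A" "snd p \<in> chart_dom c" "snd p \<in> chart_dom d"
  shows "transition_deriv (lift_chart c) (lift_chart d) p
    = (\<lambda>h. (fst h, transition_deriv c d (snd p) (snd h)))"
proof -
  let ?q = "chart_map (lift_chart c) p"
  have snd_q: "snd ?q = chart_map c (snd p)" by (simp add: chart_map_lift)
  have "(transition c d has_derivative transition_deriv c d (snd p)) (at (snd ?q))"
    using has_derivative_transition[OF assms] snd_q by simp
  with bounded_linear.has_derivative[OF bounded_linear_snd has_derivative_ident, of "at ?q"]
  have "((\<lambda>q. transition c d (snd q)) has_derivative (\<lambda>h. transition_deriv c d (snd p) (snd h))) (at ?q)"
    by (rule has_derivative_compose)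
  then have 1: "((\<lambda>q. (fst q, transition c d (snd q))) has_derivative
     (\<lambda>h. (fst h, transition_deriv c d (snd p) (snd h)))) (at ?q)"
    by (rule has_derivative_Pair[OF bounded_linear.has_derivative[OF bounded_linear_fst has_derivative_ident]])
  have 2: "open ((UNIV :: real set) \<times> chart_image c)"
    using open_chart_image[OF assms(1)] by (simp add: open_Times)
  have 3: "?q \<in> UNIV \<times> chart_image c" using assms by (simp add: chart_map_lift)
  have 4: "(fst q, transition c d (snd q)) = transition (lift_chart c) (lift_chart d) q"
    if "q \<in> UNIV \<times> chart_image c" for q
  proof -
    have "snd q \<in> chart_image c" using that by auto
    then show ?thesis by (rule transition_lift[OF assms(1), symmetric])
  qed
  have "(transition (lift_chart c) (lift_chart d) has_derivative
     (\<lambda>h. (fst h, transition_deriv c d (snd p) (snd h)))) (at ?q)"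
    using has_derivative_transform_within_open[OF 1 2 3 4] .
  then show ?thesis by (rule frechet_derivative_at[symmetric])
qed

text \<open>The definition of \<^const>\<open>tangent_map\<close> computes in some unspecified chart.  The following lemmas
  carry the result to any chart by the transformation law of tangent vectors.\<close>

lemma chart_of_som:
  obtains c where "c \<in> A" "snd p \<in> chart_dom c"
    "(SOME C. C \<in> som_atlas A \<and> p \<in> chart_dom C) = lift_chart c"
proof -
  let ?C = "SOME C. C \<in> som_atlas A \<and> p \<in> chart_dom C"
  obtain d where "d \<in> A" "snd p \<in> chart_dom d" by (rule chart_at)
  then have "\<exists>C. C \<in> som_atlas A \<and> p \<in> chart_dom C"
    by (intro exI[of _ "lift_chart d"]) (auto simp: som_atlas_eq mem_Times_iff)
  then have "?C \<in> som_atlas A \<and> p \<in> chart_dom ?C" by (rule someI_ex)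
  then show ?thesis using that by (auto simp: som_atlas_eq mem_Times_iff)
qed

lemma tangent_lift:
  assumes "v \<in> tangent_space (som_atlas A) p" "c \<in> A" "d \<in> A" "snd p \<in> chart_dom c" "snd p \<in> chart_dom d"
  shows "v (lift_chart d) = (fst (v (lift_chart c)), transition_deriv c d (snd p) (snd (v (lift_chart c))))"
proof -
  have "v (lift_chart d) = transition_deriv (lift_chart c) (lift_chart d) p (v (lift_chart c))"
  proof -
    have "lift_chart c \<in> som_atlas A" "p \<in> chart_dom (lift_chart c)"
      "lift_chart d \<in> som_atlas A" "p \<in> chart_dom (lift_chart d)"
      using assms by (simp_all add: som_atlas_eq mem_Times_iff)
    then show ?thesis using assms(1) unfolding tangent_space_def by blast
  qed
  also have "\<dots> = (fst (v (lift_chart c)), transition_deriv c d (snd p) (snd (v (lift_chart c))))"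
    by (simp only: transition_deriv_lift[OF assms(2-5)])
  finally show ?thesis .
qed

lemma dt_eq:
  assumes v: "v \<in> tangent_space (som_atlas A) p" and d: "d \<in> A" "snd p \<in> chart_dom d"
  shows "dt A p v = fst (v (lift_chart d))"
proof -
  obtain c where c: "c \<in> A" "snd p \<in> chart_dom c"
    "(SOME C. C \<in> som_atlas A \<and> p \<in> chart_dom C) = lift_chart c" by (rule chart_of_som)
  have "((\<lambda>t. t) \<circ> fst \<circ> chart_inv (lift_chart c) has_derivative fst) (at (chart_map (lift_chart c) p))"
  proof (rule has_derivative_transform_within_open)
    show "(fst has_derivative fst) (at (chart_map (lift_chart c) p))"
      by (rule bounded_linear.has_derivative[OF bounded_linear_fst has_derivative_ident])
    show "open ((UNIV :: real set) \<times> chart_image c)" by (intro open_Times open_UNIV open_chart_image c)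
    show "chart_map (lift_chart c) p \<in> UNIV \<times> chart_image c" using c by (simp add: chart_map_lift)
    show "fst q = ((\<lambda>t. t) \<circ> fst \<circ> chart_inv (lift_chart c)) q" if "q \<in> UNIV \<times> chart_image c" for q
    proof -
      have "snd q \<in> chart_image c" using that by auto
      then show ?thesis unfolding comp_apply by (simp only: chart_inv_lift[OF c(1)] fst_conv)
    qed
  qed
  then have "frechet_derivative ((\<lambda>t. t) \<circ> fst \<circ> chart_inv (lift_chart c)) (at (chart_map (lift_chart c) p)) = fst"
    by (rule frechet_derivative_at[symmetric])
  then have "dt A p v = fst (v (lift_chart c))"
    by (simp add: dt_def tangent_map_def real_atlas_def c(3) Let_def)
  then show ?thesis by (simp only: tangent_lift[OF v c(1) d(1) c(2) d(2)] fst_conv)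
qed

lemma dproj_eq:
  assumes v: "v \<in> tangent_space (som_atlas A) p"
  shows "dproj A p v = (\<lambda>d. if d \<in> A \<and> snd p \<in> chart_dom d then snd (v (lift_chart d)) else 0)"
proof
  fix d
  obtain c where c: "c \<in> A" "snd p \<in> chart_dom c"
    "(SOME C. C \<in> som_atlas A \<and> p \<in> chart_dom C) = lift_chart c" by (rule chart_of_som)
  show "dproj A p v d = (if d \<in> A \<and> snd p \<in> chart_dom d then snd (v (lift_chart d)) else 0)"
  proof (cases "d \<in> A \<and> snd p \<in> chart_dom d")
    case True
    have "(chart_map d \<circ> snd \<circ> chart_inv (lift_chart c) has_derivative
       (\<lambda>h. transition_deriv c d (snd p) (snd h))) (at (chart_map (lift_chart c) p))"
    proof (rule has_derivative_transform_within_open)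
      have "(transition c d has_derivative transition_deriv c d (snd p)) (at (snd (chart_map (lift_chart c) p)))"
        using has_derivative_transition[of c d "snd p"] c True by (simp add: chart_map_lift)
      with bounded_linear.has_derivative[OF bounded_linear_snd has_derivative_ident, of "at (chart_map (lift_chart c) p)"]
      show "((\<lambda>q. transition c d (snd q)) has_derivative (\<lambda>h. transition_deriv c d (snd p) (snd h)))
          (at (chart_map (lift_chart c) p))"
        by (rule has_derivative_compose)
      show "open ((UNIV :: real set) \<times> chart_image c)" by (intro open_Times open_UNIV open_chart_image c)
      show "chart_map (lift_chart c) p \<in> UNIV \<times> chart_image c" using c by (simp add: chart_map_lift)
      show "transition c d (snd q) = (chart_map d \<circ> snd \<circ> chart_inv (lift_chart c)) q"
        if "q \<in> UNIV \<times> chart_image c" for q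
      proof -
        have "snd q \<in> chart_image c" using that by auto
        then show ?thesis unfolding comp_apply by (simp only: chart_inv_lift[OF c(1)] snd_conv)
      qed
    qed
    then have "frechet_derivative (chart_map d \<circ> snd \<circ> chart_inv (lift_chart c)) (at (chart_map (lift_chart c) p))
        = (\<lambda>h. transition_deriv c d (snd p) (snd h))"
      by (rule frechet_derivative_at[symmetric])
    then have "dproj A p v d = transition_deriv c d (snd p) (snd (v (lift_chart c)))"
      using True by (simp add: dproj_def tangent_map_def c(3) Let_def)
    then show ?thesis using tangent_lift[OF v c(1) _ c(2), of d] True by (simp del: lift_chart_simps)
  qed (auto simp: dproj_def tangent_map_def Let_def)
qed

lemma dproj_in_tangent_space:
  assumes v: "v \<in> tangent_space (som_atlas A) p"
  shows "dproj A p v \<in> tangent_space A (snd p)"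
  unfolding tangent_space_def
proof (intro CollectI conjI ballI allI impI)
  fix c d assume cd: "c \<in> A" "d \<in> A" "snd p \<in> chart_dom c" "snd p \<in> chart_dom d"
  show "dproj A p v d = transition_deriv c d (snd p) (dproj A p v c)"
    using tangent_lift[OF v cd] cd unfolding dproj_eq[OF v] by (simp only: if_True simp_thms snd_conv)
next
  fix c assume "\<not> (c \<in> A \<and> snd p \<in> chart_dom c)"
  then show "dproj A p v c = 0" by (auto simp: dproj_eq[OF v])
qed

lemma smooth_curve_on_som_atlasI:
  assumes I: "derivative_unique_on I" and c: "smooth_curve_on A I c" and t: "\<And>n. hd_on I t n"
  shows "smooth_curve_on (som_atlas A) I (\<lambda>s. (t s, c s))"
  unfolding smooth_curve_on_def smooth_on_def
proof (intro conjI ballI allI)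
  have cc: "continuous_on I c" using c by (simp add: smooth_curve_on_def)
  then show "continuous_on I (\<lambda>s. (t s, c s))"
    using hd_on_continuous[OF t] by (intro continuous_intros)
  fix D n assume "D \<in> som_atlas A"
  then obtain d where d: "d \<in> A" "D = lift_chart d" by (auto simp: som_atlas_eq)
  let ?J = "{s \<in> I. c s \<in> chart_dom d}"
  have J: "derivative_unique_on ?J" using derivative_unique_on_relopen[OF I curve_chart_domain[OF cc d(1)]] .
  have "hd_on ?J t n" by (rule hd_on_subset[OF J _ t]) auto
  then have "hd_on ?J (\<lambda>s. (t s, (chart_map d \<circ> c) s)) n"
    by (intro hd_on_Pair[OF J] smooth_curve_on_chart[OF c d(1)])
  then show "hd_on {s \<in> I. (t s, c s) \<in> chart_dom D} (chart_map D \<circ> (\<lambda>s. (t s, c s))) n"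
    using d by (simp add: o_def)
qed

lemma smooth_curve_on_som_atlasD:
  assumes I: "derivative_unique_on I" and \<gamma>: "smooth_curve_on (som_atlas A) I \<gamma>"
  shows "smooth_curve_on A I (snd \<circ> \<gamma>)"
    and "s \<in> I \<Longrightarrow> dproj A (\<gamma> s) (velocity (som_atlas A) I \<gamma> s) = velocity A I (snd \<circ> \<gamma>) s"
    and "s \<in> I \<Longrightarrow> (fst \<circ> \<gamma> has_vector_derivative dt A (\<gamma> s) (velocity (som_atlas A) I \<gamma> s)) (at s within I)"
proof -
  interpret M: manifold "som_atlas A" by unfold_locales (rule smooth_atlas_som_atlas)
  have cg: "continuous_on I \<gamma>" using \<gamma> by (simp add: smooth_curve_on_def)
  have c: "continuous_on I (snd \<circ> \<gamma>)" using cg by (auto intro: continuous_intros simp: o_def)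
  have eq: "{s \<in> I. \<gamma> s \<in> chart_dom (lift_chart d)} = {s \<in> I. (snd \<circ> \<gamma>) s \<in> chart_dom d}" for d :: "('a, 'e) chart"
    by (auto simp: mem_Times_iff)
  show sc: "smooth_curve_on A I (snd \<circ> \<gamma>)"
    unfolding smooth_curve_on_def smooth_on_def
  proof (intro conjI ballI allI c)
    fix d n assume d: "d \<in> A"
    then have ld: "lift_chart d \<in> som_atlas A" by (simp add: som_atlas_eq)
    have J: "derivative_unique_on {s \<in> I. (snd \<circ> \<gamma>) s \<in> chart_dom d}"
      using derivative_unique_on_relopen[OF I curve_chart_domain[OF c d]] .
    have "hd_on {s \<in> I. (snd \<circ> \<gamma>) s \<in> chart_dom d} (chart_map (lift_chart d) \<circ> \<gamma>) n"
      using M.smooth_curve_on_chart[OF \<gamma> ld] unfolding eq .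
    from hd_on_bounded_linear[OF J bounded_linear_snd this]
    show "hd_on {s \<in> I. (snd \<circ> \<gamma>) s \<in> chart_dom d} (chart_map d \<circ> (snd \<circ> \<gamma>)) n"
      by (simp add: chart_map_lift o_def)
  qed
  assume s: "s \<in> I"
  have v: "velocity (som_atlas A) I \<gamma> s \<in> tangent_space (som_atlas A) (\<gamma> s)"
    by (rule M.velocity_in_tangent_space[OF \<gamma> I s])
  have dv: "(chart_map (lift_chart d) \<circ> \<gamma> has_vector_derivative velocity (som_atlas A) I \<gamma> s (lift_chart d)) (at s within I)"
    if "d \<in> A" "snd (\<gamma> s) \<in> chart_dom d" for d
    using that by (intro M.has_vector_derivative_velocity[OF \<gamma> I s]) (auto simp: som_atlas_eq mem_Times_iff)
  show "dproj A (\<gamma> s) (velocity (som_atlas A) I \<gamma> s) = velocity A I (snd \<circ> \<gamma>) s"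
  proof
    fix d
    show "dproj A (\<gamma> s) (velocity (som_atlas A) I \<gamma> s) d = velocity A I (snd \<circ> \<gamma>) s d"
    proof (cases "d \<in> A \<and> snd (\<gamma> s) \<in> chart_dom d")
      case True
      have "(chart_map d \<circ> (snd \<circ> \<gamma>) has_vector_derivative snd (velocity (som_atlas A) I \<gamma> s (lift_chart d))) (at s within I)"
        using bounded_linear.has_vector_derivative[OF bounded_linear_snd dv[of d]] True
        by (simp add: chart_map_lift o_def)
      then have "velocity A I (snd \<circ> \<gamma>) s d = snd (velocity (som_atlas A) I \<gamma> s (lift_chart d))"
        using True by (intro velocity_eqI[where c = "snd \<circ> \<gamma>", OF I s]) auto
      then show ?thesis using True by (simp add: dproj_eq[OF v])
    next
      case False
      then show ?thesis unfolding dproj_eq[OF v] by (auto simp: velocity_def)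
    qed
  qed
  obtain d where d: "d \<in> A" "snd (\<gamma> s) \<in> chart_dom d" by (rule chart_at)
  from bounded_linear.has_vector_derivative[OF bounded_linear_fst dv[OF d]]
  show "(fst \<circ> \<gamma> has_vector_derivative dt A (\<gamma> s) (velocity (som_atlas A) I \<gamma> s)) (at s within I)"
    using dt_eq[OF v d] by (simp add: chart_map_lift o_def)
qed

lemma d_dt:
  shows "d_dt A p \<in> tangent_space (som_atlas A) p" and "dt A p (d_dt A p) = 1"
    and "dproj A p (d_dt A p) = (\<lambda>_. 0)"
proof -
  interpret M: manifold "som_atlas A" by unfold_locales (rule smooth_atlas_som_atlas)
  let ?\<gamma> = "\<lambda>r. (r, snd p)"
  have U: "derivative_unique_on (UNIV :: real set)" by (simp add: derivative_unique_on_open)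
  obtain d where d: "d \<in> A" "snd p \<in> chart_dom d" by (rule chart_at)
  have const: "smooth_curve_on A UNIV (\<lambda>_::real. snd p)"
    by (rule smooth_curve_onI[OF U d(1)]) (use d hd_on_const[OF U] in \<open>auto simp: o_def\<close>)
  have \<gamma>: "smooth_curve_on (som_atlas A) UNIV ?\<gamma>"
    by (rule smooth_curve_on_som_atlasI[OF U const hd_on_ident[OF U]])
  have sn: "snd \<circ> ?\<gamma> = (\<lambda>_. snd p)" and fs: "fst \<circ> ?\<gamma> = (\<lambda>r. r)" by auto
  show "d_dt A p \<in> tangent_space (som_atlas A) p"
    using M.velocity_in_tangent_space[OF \<gamma> U, of "fst p"] by (simp add: d_dt_def)
  have "(fst \<circ> ?\<gamma> has_vector_derivative dt A p (d_dt A p)) (at (fst p))"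
    using smooth_curve_on_som_atlasD(3)[OF U \<gamma>, of "fst p"] by (simp add: d_dt_def)
  then show "dt A p (d_dt A p) = 1"
    unfolding fs using vector_derivative_at has_vector_derivative_id_at by metis
  have "dproj A p (d_dt A p) = velocity A UNIV (\<lambda>_. snd p) (fst p)"
    using smooth_curve_on_som_atlasD(2)[OF U \<gamma>, of "fst p"] by (simp add: d_dt_def sn)
  also have "\<dots> = (\<lambda>_. 0)" by (auto simp: velocity_def o_def)
  finally show "dproj A p (d_dt A p) = (\<lambda>_. 0)" .
qed

end

section \<open>Causal vectors and travel times\<close>

lemma piecewise_single: "a < b \<Longrightarrow> Q {a..b} \<Longrightarrow> piecewise Q a b"
  unfolding piecewise_def by (rule exI[of _ 1], rule exI[of _ "\<lambda>i. if i = 0 then a else b"]) simp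

lemma piecewise_append:
  assumes "piecewise Q a b" "piecewise Q b c" shows "piecewise Q a c"
proof -
  obtain n s where s: "0 < n" "s 0 = a" "s n = b" "\<And>i. i < n \<Longrightarrow> s i < s (Suc i) \<and> Q {s i..s (Suc i)}"
    using assms(1) unfolding piecewise_def by blast
  obtain m r where r: "0 < m" "r 0 = b" "r m = c" "\<And>i. i < m \<Longrightarrow> r i < r (Suc i) \<and> Q {r i..r (Suc i)}"
    using assms(2) unfolding piecewise_def by blast
  define p where "p i = (if i \<le> n then s i else r (i - n))" for i
  have "p i < p (Suc i) \<and> Q {p i..p (Suc i)}" if "i < n + m" for i
  proof -
    consider "i < n" | "i = n" | "n < i" by linarith
    then show ?thesis
    proof cases
      case 1 then show ?thesis using s(4)[of i] by (simp add: p_def)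
    next
      case 2 then show ?thesis using r(4)[of 0] r(1,2) s(3) by (simp add: p_def)
    next
      case 3
      then have "Suc i - n = Suc (i - n)" by simp
      then show ?thesis using r(4)[of "i - n"] 3 that by (simp add: p_def)
    qed
  qed
  moreover have "p 0 = a" "p (n + m) = c" using s r by (auto simp: p_def)
  ultimately show ?thesis unfolding piecewise_def using s(1) by (intro exI[of _ "n + m"] exI[of _ p]) auto
qed

text \<open>The bounds on \<open>u\<close>, \<open>v\<close>, \<open>w\<close> allow \<open>P\<close> to refer to a function that is only given on \<open>[a, b]\<close>, such as
  the velocity within \<open>[a, b]\<close>.\<close>

lemma piecewise_induct [consumes 1, case_names piece append]:
  assumes Q: "piecewise Q a b"
    and piece: "\<And>u v. a \<le> u \<Longrightarrow> u < v \<Longrightarrow> v \<le> b \<Longrightarrow> Q {u..v} \<Longrightarrow> P u v"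
    and append: "\<And>u v w. a \<le> u \<Longrightarrow> u < v \<Longrightarrow> v < w \<Longrightarrow> w \<le> b \<Longrightarrow> P u v \<Longrightarrow> P v w \<Longrightarrow> P u w"
  shows "P a b"
proof -
  obtain n s where s: "0 < n" "s 0 = a" "s n = b" "\<And>i. i < n \<Longrightarrow> s i < s (Suc i) \<and> Q {s i..s (Suc i)}"
    using Q unfolding piecewise_def by blast
  have mono: "s i \<le> s j" if "i \<le> j" "j \<le> n" for i j
    using that
  proof (induction j)
    case (Suc j)
    then show ?case using s(4)[of j] by (cases "i = Suc j") fastforce+
  qed simp
  have "a < s (Suc k) \<and> P a (s (Suc k))" if "Suc k \<le> n" for k
    using that
  proof (induction k)
    case 0
    then show ?case using s(2) s(4)[of 0] mono[of 1 n] s(3) piece[of a "s 1"] by simp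
  next
    case (Suc k)
    then have k: "a < s (Suc k)" "P a (s (Suc k))" by simp_all
    have l: "s (Suc k) < s (Suc (Suc k))" "Q {s (Suc k)..s (Suc (Suc k))}" "s (Suc (Suc k)) \<le> b"
      using s(4)[of "Suc k"] mono[of "Suc (Suc k)" n] s(3) Suc.prems by auto
    have "P (s (Suc k)) (s (Suc (Suc k)))" using piece[of "s (Suc k)"] k l by simp
    then show ?case using append[of a "s (Suc k)" "s (Suc (Suc k))"] k l by auto
  qed
  from this[of "n - 1"] show ?thesis using s(1,3) by simp
qed

lemma piecewise_imp_less: "piecewise Q a b \<Longrightarrow> a < b"
  by (induction rule: piecewise_induct) auto

lemma piecewise_shift:
  assumes "piecewise Q a b" "\<And>u v. a \<le> u \<Longrightarrow> u < v \<Longrightarrow> v \<le> b \<Longrightarrow> Q {u..v} \<Longrightarrow> Q' {u + r..v + r}"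
  shows "piecewise Q' (a + r) (b + r)"
  using assms(1)
  by (induction rule: piecewise_induct) (auto intro: piecewise_single assms(2) piecewise_append)

lemma piecewise_reverse:
  assumes "piecewise Q a b" "\<And>u v. a \<le> u \<Longrightarrow> u < v \<Longrightarrow> v \<le> b \<Longrightarrow> Q {u..v} \<Longrightarrow> Q' {- v..- u}"
  shows "piecewise Q' (- b) (- a)"
  using assms(1)
  by (induction rule: piecewise_induct) (auto intro: piecewise_single assms(2) piecewise_append)

lemma piecewise_mono:
  assumes "piecewise Q a b" "\<And>u v. a \<le> u \<Longrightarrow> u < v \<Longrightarrow> v \<le> b \<Longrightarrow> Q {u..v} \<Longrightarrow> Q' {u..v}"
  shows "piecewise Q' a b"
  using piecewise_shift[of Q a b Q' 0] assms by simp

locale som =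
  fixes A :: "('a::{t2_space, second_countable_topology}, 'e::euclidean_space) chart set"
    and \<beta> :: "'a \<Rightarrow> real"
    and \<omega> :: "'a \<Rightarrow> ('a, 'e) tangent \<Rightarrow> real"
    and g0 :: "'a \<Rightarrow> ('a, 'e) tangent \<Rightarrow> ('a, 'e) tangent \<Rightarrow> real"
  assumes som: "som_spacetime A \<beta> \<omega> g0"

sublocale som \<subseteq> manifold A
  using som by unfold_locales (simp add: som_spacetime_def)

sublocale som \<subseteq> M: manifold "som_atlas A"
  by unfold_locales (rule smooth_atlas_som_atlas)

context som
begin

abbreviation F where "F \<equiv> fermat_metric \<beta> \<omega> g0"
abbreviation g where "g \<equiv> som_metric A \<beta> \<omega> g0"
abbreviation future_vector where "future_vector \<equiv> future_causal_vector (som_atlas A) g (d_dt A)"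
abbreviation past_vector where "past_vector \<equiv> past_causal_vector (som_atlas A) g (d_dt A)"

lemma \<beta>_pos: "\<beta> x > 0"
  using som by (simp add: som_spacetime_def)

lemma \<omega>_linear: "linear_on_tangent_space A p (\<omega> p)"
  using som by (simp add: som_spacetime_def one_form_def)

lemma g0_linear: "v \<in> tangent_space A p \<Longrightarrow> linear_on_tangent_space A p (g0 p v)"
  using som by (simp add: som_spacetime_def symmetric_02_tensor_def)

lemma g0_sym: "v \<in> tangent_space A p \<Longrightarrow> w \<in> tangent_space A p \<Longrightarrow> g0 p v w = g0 p w v"
  using som by (simp add: som_spacetime_def symmetric_02_tensor_def)

lemma linear_on_tangent_space_0: "linear_on_tangent_space A p L \<Longrightarrow> L (\<lambda>_. 0) = 0"
proof -
  assume "linear_on_tangent_space A p L"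
  then have "L (\<lambda>d. a *\<^sub>R v d + b *\<^sub>R w d) = a * L v + b * L w"
    if "v \<in> tangent_space A p" "w \<in> tangent_space A p" for v w a b
    using that unfolding linear_on_tangent_space_def by blast
  from this[OF zero_in_tangent_space zero_in_tangent_space, of 0 0] show ?thesis by simp
qed

lemma \<omega>_0: "\<omega> p (\<lambda>_. 0) = 0"
  by (rule linear_on_tangent_space_0[OF \<omega>_linear])

lemma g0_0: "v \<in> tangent_space A p \<Longrightarrow> g0 p v (\<lambda>_. 0) = 0"
  by (rule linear_on_tangent_space_0[OF g0_linear])

text \<open>The Riemannian metric of the Randers splitting \<open>F = \<omega> / \<beta> + \<surd> h\<close>.\<close>

definition h where "h p v = 1 / (\<beta> p)\<^sup>2 * (\<omega> p v)\<^sup>2 + 1 / \<beta> p * g0 p v v"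

lemma fermat_eq: "F p v = \<omega> p v / \<beta> p + sqrt (h p v)"
  by (simp add: fermat_metric_def h_def)

lemma h_pos:
  assumes "v \<in> tangent_space A p" "v \<noteq> (\<lambda>_. 0)"
  shows "h p v > 0"
proof -
  have "g0 p v v + 1 / \<beta> p * (\<omega> p v)\<^sup>2 > 0" using som assms by (simp add: som_spacetime_def)
  then have "1 / \<beta> p * (g0 p v v + 1 / \<beta> p * (\<omega> p v)\<^sup>2) > 0" using \<beta>_pos by simp
  then show ?thesis by (simp add: h_def distrib_left power2_eq_square mult.assoc add.commute)
qed

lemma h_0: "h p (\<lambda>_. 0) = 0"
  by (simp add: h_def \<omega>_0 g0_0[OF zero_in_tangent_space])

lemma h_nonneg: "v \<in> tangent_space A p \<Longrightarrow> h p v \<ge> 0"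
  using h_pos[of v p] h_0[of p] by (cases "v = (\<lambda>_. 0)") auto

lemma fermat_0: "F p (\<lambda>_. 0) = 0"
  by (simp add: fermat_eq h_0 \<omega>_0)

lemma som_metric_self:
  "g p v v = \<beta> (snd p) * (h (snd p) (dproj A p v) - (dt A p v - \<omega> (snd p) (dproj A p v) / \<beta> (snd p))\<^sup>2)"
  using \<beta>_pos[of "snd p"] by (simp add: som_metric_def h_def field_simps power2_eq_square)

lemma som_metric_d_dt:
  assumes "v \<in> tangent_space (som_atlas A) p"
  shows "g p v (d_dt A p) = - \<beta> (snd p) * (dt A p v - \<omega> (snd p) (dproj A p v) / \<beta> (snd p))"
  using \<beta>_pos[of "snd p"] g0_0[OF dproj_in_tangent_space[OF assms]]
  by (simp add: som_metric_def d_dt \<omega>_0 field_simps)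

text \<open>With \<open>r = dt(v) - \<omega>(w) / \<beta>\<close>, where \<open>w\<close> is the projection of \<open>v\<close> to \<open>S\<close>, completing the square gives
  \<open>g(v, v) = \<beta> (h(w) - r\<^sup>2)\<close> and \<open>g(v, \<partial>\<^sub>t) = - \<beta> r\<close>.  So \<open>v\<close> is future causal iff \<open>r > 0\<close> and \<open>dt(v) \<ge> F(w)\<close>.\<close>

lemma causal_vector_iff:
  assumes v: "v \<in> tangent_space (som_atlas A) p"
    and r: "r = dt A p v - \<omega> (snd p) (dproj A p v) / \<beta> (snd p)"
  shows "future_vector p v \<longleftrightarrow> r > 0 \<and> r \<ge> sqrt (h (snd p) (dproj A p v))"
    and "past_vector p v \<longleftrightarrow> - r > 0 \<and> - r \<ge> sqrt (h (snd p) (dproj A p v))"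
proof -
  let ?H = "h (snd p) (dproj A p v)"
  have b: "\<beta> (snd p) > 0" by (rule \<beta>_pos)
  have H: "?H \<ge> 0" by (rule h_nonneg[OF dproj_in_tangent_space[OF v]])
  have nz: "v \<noteq> (\<lambda>_. 0)" if "r \<noteq> 0"
  proof
    assume v0: "v = (\<lambda>_. 0)"
    obtain d where d: "d \<in> A" "snd p \<in> chart_dom d" by (rule chart_at)
    have "dproj A p v = (\<lambda>_. 0)" unfolding dproj_eq[OF v] by (auto simp: v0)
    moreover have "dt A p v = 0" unfolding dt_eq[OF v d] by (simp add: v0)
    ultimately show False using that by (simp add: r \<omega>_0)
  qed
  have gle: "g p v v \<le> 0 \<longleftrightarrow> sqrt ?H \<le> \<bar>r\<bar>"
  proof -
    have "g p v v \<le> 0 \<longleftrightarrow> ?H \<le> r\<^sup>2"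
      unfolding som_metric_self r[symmetric] using b by (simp add: mult_le_0_iff)
    also have "\<dots> \<longleftrightarrow> sqrt ?H \<le> \<bar>r\<bar>" by (metis real_sqrt_abs real_sqrt_le_iff)
    finally show ?thesis .
  qed
  have gT: "g p v (d_dt A p) = - \<beta> (snd p) * r" by (simp only: som_metric_d_dt[OF v] r)
  show "future_vector p v \<longleftrightarrow> r > 0 \<and> r \<ge> sqrt ?H"
    unfolding future_causal_vector_def causal_vector_def gle gT using b v nz by (auto simp: zero_less_mult_iff)
  show "past_vector p v \<longleftrightarrow> - r > 0 \<and> - r \<ge> sqrt ?H"
    unfolding past_causal_vector_def causal_vector_def gle gT using b v nz by (auto simp: mult_less_0_iff)
qed

definition future_piece :: "(real \<Rightarrow> real \<times> 'a) \<Rightarrow> real set \<Rightarrow> bool" where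
  "future_piece \<gamma> I \<longleftrightarrow> smooth_curve_on (som_atlas A) I \<gamma> \<and>
     (\<forall>s\<in>I. future_vector (\<gamma> s) (velocity (som_atlas A) I \<gamma> s))"

lemma future_piece_iff:
  assumes I: "derivative_unique_on I" and \<gamma>: "smooth_curve_on (som_atlas A) I \<gamma>"
    and t': "\<And>s. s \<in> I \<Longrightarrow> (fst \<circ> \<gamma> has_vector_derivative t' s) (at s within I)"
    and c: "c = snd \<circ> \<gamma>"
  shows "future_piece \<gamma> I \<longleftrightarrow> (\<forall>s\<in>I. t' s > \<omega> (c s) (velocity A I c s) / \<beta> (c s) \<and>
      t' s \<ge> F (c s) (velocity A I c s))"
proof -
  have "future_vector (\<gamma> s) (velocity (som_atlas A) I \<gamma> s) \<longleftrightarrow>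
      t' s > \<omega> (c s) (velocity A I c s) / \<beta> (c s) \<and> t' s \<ge> F (c s) (velocity A I c s)" if s: "s \<in> I" for s
  proof -
    have v: "velocity (som_atlas A) I \<gamma> s \<in> tangent_space (som_atlas A) (\<gamma> s)"
      by (rule M.velocity_in_tangent_space[OF \<gamma> I s])
    have p: "dproj A (\<gamma> s) (velocity (som_atlas A) I \<gamma> s) = velocity A I c s"
      unfolding c by (rule smooth_curve_on_som_atlasD(2)[OF I \<gamma> s])
    have "at s within I \<noteq> bot" using I s by (simp add: derivative_unique_on_real_iff)
    from vector_derivative_unique_within[OF this smooth_curve_on_som_atlasD(3)[OF I \<gamma> s] t'[OF s]]
    have t: "dt A (\<gamma> s) (velocity (som_atlas A) I \<gamma> s) = t' s" .
    have cs: "snd (\<gamma> s) = c s" by (simp add: c)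
    show ?thesis unfolding causal_vector_iff(1)[OF v refl] p t cs fermat_eq by (auto simp: algebra_simps)
  qed
  then show ?thesis using \<gamma> by (simp add: future_piece_def)
qed

lemma future_piece_graph:
  assumes I: "derivative_unique_on I" and c: "smooth_curve_on A I c"
    and t: "\<And>n. hd_on I t n" "\<And>s. s \<in> I \<Longrightarrow> (t has_vector_derivative t' s) (at s within I)"
    and t': "\<And>s. s \<in> I \<Longrightarrow> t' s > \<omega> (c s) (velocity A I c s) / \<beta> (c s)"
      "\<And>s. s \<in> I \<Longrightarrow> t' s \<ge> F (c s) (velocity A I c s)"
  shows "future_piece (\<lambda>s. (t s, c s)) I"
proof -
  have \<gamma>: "smooth_curve_on (som_atlas A) I (\<lambda>s. (t s, c s))"
    by (rule smooth_curve_on_som_atlasI[OF I c t(1)])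
  show ?thesis
    by (subst future_piece_iff[OF I \<gamma>, where c = c and t' = t']) (use t t' in \<open>auto simp: o_def\<close>)
qed

lemma future_piece_cong:
  assumes "\<And>s. s \<in> I \<Longrightarrow> \<gamma> s = \<gamma>' s"
  shows "future_piece \<gamma> I \<longleftrightarrow> future_piece \<gamma>' I"
proof -
  have "velocity (som_atlas A) I \<gamma> s = velocity (som_atlas A) I \<gamma>' s" if "s \<in> I" for s
    by (rule M.velocity_cong[OF assms that])
  then show ?thesis
    using M.smooth_curve_on_cong[OF assms] assms by (simp add: future_piece_def)
qed

lemma future_piece_shift:
  assumes "future_piece \<gamma> {u..v}" "u < v"
  shows "future_piece (\<lambda>s. \<gamma> (s - r)) {u + r..v + r}"
proof -
  have J: "{u + r..v + r} = {s. - r + 1 * s \<in> {u..v}}" by auto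
  have \<gamma>: "smooth_curve_on (som_atlas A) {u..v} \<gamma>" using assms by (simp add: future_piece_def)
  note aff = M.smooth_curve_on_affine[OF \<gamma> assms(2) _ J]
  have eq: "(\<lambda>s. \<gamma> (- r + 1 * s)) = (\<lambda>s. \<gamma> (s - r))" by (simp add: algebra_simps)
  have "velocity (som_atlas A) {u + r..v + r} (\<lambda>s. \<gamma> (s - r)) s = velocity (som_atlas A) {u..v} \<gamma> (s - r)"
    if "s \<in> {u + r..v + r}" for s
    using aff(2)[OF _ that] unfolding eq by simp
  then show ?thesis
    using aff(1) assms(1) unfolding eq future_piece_def by auto
qed

text \<open>Translations in time are isometries, so whether a future causal curve leads from \<open>(t, x)\<close> to
  \<open>(t + \<tau>, y)\<close> does not depend on \<open>t\<close>.  The relation is therefore a statement about travel times in \<open>S\<close>, and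
  quantifying over \<open>t\<close> lets travels be joined.  A travel from a point to itself in time \<open>0\<close> is a closed causal
  curve.\<close>

definition reaches :: "'a \<Rightarrow> real \<Rightarrow> 'a \<Rightarrow> bool" where
  "reaches x \<tau> y \<longleftrightarrow> (\<forall>t. \<exists>a b \<gamma>. piecewise (future_piece \<gamma>) a b \<and> \<gamma> a = (t, x) \<and> \<gamma> b = (t + \<tau>, y))"

lemma reaches_trans:
  assumes "reaches x \<tau> y" "reaches y \<tau>' z"
  shows "reaches x (\<tau> + \<tau>') z"
  unfolding reaches_def
proof
  fix t
  obtain a b \<gamma> where 1: "piecewise (future_piece \<gamma>) a b" "\<gamma> a = (t, x)" "\<gamma> b = (t + \<tau>, y)"
    using assms(1) unfolding reaches_def by metis
  obtain a' b' \<gamma>' where 2: "piecewise (future_piece \<gamma>') a' b'" "\<gamma>' a' = (t + \<tau>, y)" "\<gamma>' b' = (t + \<tau> + \<tau>', z)"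
    using assms(2) unfolding reaches_def by metis
  define r where "r = b - a'"
  define \<delta> where "\<delta> s = (if s \<le> b then \<gamma> s else \<gamma>' (s - r))" for s
  have \<delta>1: "\<delta> s = \<gamma> s" if "s \<le> b" for s using that by (simp add: \<delta>_def)
  have \<delta>2: "\<delta> s = \<gamma>' (s - r)" if "s \<ge> b" for s
    using that 1(3) 2(2) by (cases "s = b") (auto simp: \<delta>_def r_def)
  have ab: "a < b" "a' < b'" using 1 2 piecewise_imp_less by blast+
  have "piecewise (future_piece \<delta>) a b"
  proof (rule piecewise_mono[OF 1(1)])
    fix u v assume "a \<le> u" "u < v" "v \<le> b" "future_piece \<gamma> {u..v}"
    then show "future_piece \<delta> {u..v}" using future_piece_cong[of "{u..v}" \<delta> \<gamma>] \<delta>1 by simp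
  qed
  moreover have "piecewise (future_piece \<delta>) (a' + r) (b' + r)"
  proof (rule piecewise_shift[OF 2(1)])
    fix u v assume "a' \<le> u" "u < v" "v \<le> b'" "future_piece \<gamma>' {u..v}"
    then show "future_piece \<delta> {u + r..v + r}"
      using future_piece_cong[of "{u + r..v + r}" \<delta> "\<lambda>s. \<gamma>' (s - r)"] \<delta>2 future_piece_shift[of \<gamma>' u v r]
      by (simp add: r_def)
  qed
  moreover have "a' + r = b" by (simp add: r_def)
  ultimately have "piecewise (future_piece \<delta>) a (b' + r)" using piecewise_append by metis
  moreover have "\<delta> a = (t, x)" using 1 ab by (simp add: \<delta>1)
  moreover have "\<delta> (b' + r) = (t + (\<tau> + \<tau>'), z)" using 2 ab by (simp add: \<delta>2 r_def add.assoc)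
  ultimately show "\<exists>a b \<gamma>. piecewise (future_piece \<gamma>) a b \<and> \<gamma> a = (t, x) \<and> \<gamma> b = (t + (\<tau> + \<tau>'), z)"
    by blast
qed

lemma reaches_lift:
  assumes ab: "a < b" and c: "smooth_curve_on A {a..b} c"
    and t: "\<And>n. hd_on {a..b} t n" "\<And>s. s \<in> {a..b} \<Longrightarrow> (t has_vector_derivative t' s) (at s within {a..b})"
    and t': "\<And>s. s \<in> {a..b} \<Longrightarrow> t' s > \<omega> (c s) (velocity A {a..b} c s) / \<beta> (c s)"
      "\<And>s. s \<in> {a..b} \<Longrightarrow> t' s \<ge> F (c s) (velocity A {a..b} c s)"
  shows "reaches (c a) (t b - t a) (c b)"
  unfolding reaches_def
proof
  fix t0
  have I: "derivative_unique_on {a..b}" using ab by (rule derivative_unique_on_Icc)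
  let ?t = "\<lambda>s. t s + (t0 - t a)"
  have "future_piece (\<lambda>s. (?t s, c s)) {a..b}"
  proof (rule future_piece_graph[OF I c _ _ t'])
    show "hd_on {a..b} ?t n" for n by (intro hd_on_add hd_on_const I t(1))
    show "(?t has_vector_derivative t' s) (at s within {a..b})" if "s \<in> {a..b}" for s
      using has_vector_derivative_add[OF t(2)[OF that] has_vector_derivative_const[of "t0 - t a"]] by simp
  qed
  then have "piecewise (future_piece (\<lambda>s. (?t s, c s))) a b" using ab by (intro piecewise_single)
  then show "\<exists>a' b' \<gamma>. piecewise (future_piece \<gamma>) a' b' \<and> \<gamma> a' = (t0, c a) \<and> \<gamma> b' = (t0 + (t b - t a), c b)"
    by (intro exI[of _ a] exI[of _ b] exI[of _ "\<lambda>s. (?t s, c s)"]) simp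
qed

end

section \<open>Curves that are given more time than their length\<close>

definition lform :: "('e::euclidean_space \<Rightarrow> real) \<Rightarrow> 'e \<Rightarrow> real" where
  "lform t v = (\<Sum>b\<in>Basis. t b * (v \<bullet> b))"

lemma hd_on_real_polynomial:
  fixes S :: "real set"
  assumes S: "derivative_unique_on S" and g: "real_polynomial_function g"
  shows "hd_on S g n"
  using g
proof induction
  case (linear f)
  show ?case using hd_on_bounded_linear[OF S linear hd_on_ident[OF S]] .
next
  case (const k)
  show ?case by (rule hd_on_const[OF S])
next
  case (add f g)
  show ?case by (rule hd_on_add[OF S add.IH])
next
  case (mult f g)
  show ?case by (rule hd_on_mult[OF S mult.IH])
qed

context som
begin

text \<open>The components of the one-form \<open>\<omega> / \<beta>\<close> in the chart \<open>d\<close>, and after it the Gram matrix of \<open>h\<close>.\<close>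

definition \<theta> :: "('a, 'e) chart \<Rightarrow> 'e \<Rightarrow> 'e \<Rightarrow> real" where
  "\<theta> d y b = \<omega> (chart_inv d y) (coord_vector A d (chart_inv d y) b) * inverse (\<beta> (chart_inv d y))"

definition hmat :: "('a, 'e) chart \<Rightarrow> 'e \<Rightarrow> 'e \<Rightarrow> 'e \<Rightarrow> real" where
  "hmat d y b c = \<theta> d y b * \<theta> d y c
     + g0 (chart_inv d y) (coord_vector A d (chart_inv d y) b) (coord_vector A d (chart_inv d y) c)
       * inverse (\<beta> (chart_inv d y))"

lemma
  assumes d: "d \<in> A"
  shows hd_on_\<theta>: "hd_on (chart_image d) (\<lambda>y. \<theta> d y b) n"
    and hd_on_hmat: "hd_on (chart_image d) (\<lambda>y. hmat d y b c) n"
proof -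
  have U: "derivative_unique_on (chart_image d)" by (rule derivative_unique_on_open[OF open_chart_image[OF d]])
  have "smooth_function A \<beta>" "one_form A \<omega>" "symmetric_02_tensor A g0"
    using som by (simp_all add: som_spacetime_def)
  then have b: "hd_on (chart_image d) (\<lambda>y. \<beta> (chart_inv d y)) n"
    and w: "hd_on (chart_image d) (\<lambda>y. \<omega> (chart_inv d y) (coord_vector A d (chart_inv d y) b)) n"
    and h: "hd_on (chart_image d) (\<lambda>y. g0 (chart_inv d y) (coord_vector A d (chart_inv d y) b)
       (coord_vector A d (chart_inv d y) c)) n" for b c
    using d by (simp_all add: smooth_function_def one_form_def symmetric_02_tensor_def smooth_on_def o_def)
  have ib: "hd_on (chart_image d) (\<lambda>y. inverse (\<beta> (chart_inv d y))) n"
    by (rule hd_on_inverse[OF U _ b]) (use \<beta>_pos in \<open>metis less_irrefl\<close>)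
  show t: "hd_on (chart_image d) (\<lambda>y. \<theta> d y b) n" for b
    unfolding \<theta>_def by (rule hd_on_mult[OF U w ib])
  show "hd_on (chart_image d) (\<lambda>y. hmat d y b c) n"
    unfolding hmat_def by (intro hd_on_add hd_on_mult U t h ib)
qed

lemma \<theta>_chart:
  assumes d: "d \<in> A" "p \<in> chart_dom d" and v: "v \<in> tangent_space A p"
  shows "\<omega> p v / \<beta> p = lform (\<theta> d (chart_map d p)) (v d)"
  using linear_on_tangent_space_coords[OF \<omega>_linear d v] d
  by (simp add: lform_def \<theta>_def divide_inverse sum_distrib_left sum_distrib_right ac_simps)

lemma h_chart:
  assumes d: "d \<in> A" "p \<in> chart_dom d" and v: "v \<in> tangent_space A p"
  shows "h p v = bilin (hmat d (chart_map d p)) (v d) (v d)"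
proof -
  let ?e = "\<lambda>b. coord_vector A d p b"
  have e: "?e b \<in> tangent_space A p" for b by (rule coord_vector_in_tangent_space[OF d])
  have "g0 p v v = (\<Sum>b\<in>Basis. g0 p v (?e b) * (v d \<bullet> b))"
    by (rule linear_on_tangent_space_coords[OF g0_linear[OF v] d v])
  also have "\<dots> = (\<Sum>b\<in>Basis. (\<Sum>c\<in>Basis. g0 p (?e b) (?e c) * (v d \<bullet> c)) * (v d \<bullet> b))"
    using linear_on_tangent_space_coords[OF g0_linear[OF e] d v] g0_sym[OF v e] by simp
  finally have g: "g0 p v v = (\<Sum>b\<in>Basis. \<Sum>c\<in>Basis. g0 p (?e b) (?e c) * (v d \<bullet> b) * (v d \<bullet> c))"
    by (simp add: sum_distrib_left sum_distrib_right ac_simps)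
  have "h p v = (\<omega> p v / \<beta> p)\<^sup>2 + g0 p v v * inverse (\<beta> p)"
    by (simp add: h_def power_divide divide_inverse power_inverse power_mult_distrib)
  also have "(\<omega> p v / \<beta> p)\<^sup>2 = (\<Sum>b\<in>Basis. \<Sum>c\<in>Basis.
      (\<theta> d (chart_map d p) b * (v d \<bullet> b)) * (\<theta> d (chart_map d p) c * (v d \<bullet> c)))"
    unfolding \<theta>_chart[OF d v] lform_def power2_eq_square sum_product ..
  finally show ?thesis
    unfolding g bilin_def hmat_def using d
    by (simp add: sum.distrib sum_distrib_left sum_distrib_right distrib_left distrib_right ac_simps)
qed

lemma hmat_pos:
  assumes d: "d \<in> A" and y: "y \<in> chart_image d" and e: "e \<noteq> 0"
  shows "bilin (hmat d y) e e > 0"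
proof -
  let ?p = "chart_inv d y" and ?v = "coord_vector A d (chart_inv d y) e"
  have p: "?p \<in> chart_dom d" using chart_inv_dom[OF y] .
  have v: "?v \<in> tangent_space A ?p" by (rule coord_vector_in_tangent_space[OF d p])
  have vd: "?v d = e" by (rule coord_vector_same[OF d p])
  then have "?v \<noteq> (\<lambda>_. 0)" using e by metis
  from h_pos[OF v this] show ?thesis
    unfolding h_chart[OF d p v] vd using y by (simp add: f_inv_into_f)
qed

lemma fermat_chart:
  assumes d: "d \<in> A" "p \<in> chart_dom d" and v: "v \<in> tangent_space A p"
  shows "F p v = lform (\<theta> d (chart_map d p)) (v d) + sqrt (bilin (hmat d (chart_map d p)) (v d) (v d))"
  by (simp only: fermat_eq \<theta>_chart[OF d v] h_chart[OF d v])

lemma fermat_ge_\<omega>: "v \<in> tangent_space A p \<Longrightarrow> \<omega> p v / \<beta> p \<le> F p v"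
  by (simp add: fermat_eq h_nonneg)

lemma continuous_on_velocity_chart:
  assumes c: "smooth_curve_on A I c" and I: "derivative_unique_on I" and d: "d \<in> A"
  shows "continuous_on {s \<in> I. c s \<in> chart_dom d} (\<lambda>s. velocity A I c s d)"
proof -
  let ?J = "{s \<in> I. c s \<in> chart_dom d}"
  have o: "openin (top_of_set I) ?J"
    using c d curve_chart_domain unfolding smooth_curve_on_def by blast
  have J: "derivative_unique_on ?J" by (rule derivative_unique_on_relopen[OF I o])
  obtain w where w: "\<And>s. s \<in> ?J \<Longrightarrow> (chart_map d \<circ> c has_vector_derivative w s) (at s within ?J)"
    "hd_on ?J w 0"
    by (rule hd_on_real_SucE[OF smooth_curve_on_chart[OF c d, of "Suc 0"]]) blast
  have "w s = velocity A I c s d" if "s \<in> ?J" for s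
  proof -
    have "(chart_map d \<circ> c has_vector_derivative w s) (at s within I)"
      using w(1)[OF that] by (simp only: at_within_openin[OF o that])
    then show ?thesis using that by (intro velocity_eqI[where c = c, OF I _ d, symmetric]) auto
  qed
  then show ?thesis using w(2) by (auto intro: continuous_on_eq)
qed

text \<open>The square root is continuous although not smooth at \<open>0\<close>, so velocities that vanish do no harm.\<close>

lemma continuous_on_fermat_velocity:
  assumes c: "smooth_curve_on A I c" and I: "derivative_unique_on I"
  shows "continuous_on I (\<lambda>s. F (c s) (velocity A I c s))"
  unfolding continuous_on_eq_continuous_within
proof
  fix s assume s: "s \<in> I"
  obtain d where d: "d \<in> A" "c s \<in> chart_dom d" by (rule chart_at)
  let ?J = "{s \<in> I. c s \<in> chart_dom d}" and ?x = "chart_map d \<circ> c"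
  have o: "openin (top_of_set I) ?J"
    using c d curve_chart_domain unfolding smooth_curve_on_def by blast
  have x: "continuous_on ?J ?x" by (rule hd_on_continuous[OF smooth_curve_on_chart[OF c d(1), of 0]])
  have im: "?x ` ?J \<subseteq> chart_image d" by auto
  have "continuous_on ?J (\<lambda>s. lform (\<theta> d (?x s)) (velocity A I c s d)
      + sqrt (bilin (hmat d (?x s)) (velocity A I c s d) (velocity A I c s d)))"
    unfolding lform_def bilin_def
    by (intro continuous_intros continuous_on_velocity_chart[OF c I d(1)]
        continuous_on_compose2[OF hd_on_continuous[OF hd_on_\<theta>[OF d(1), of _ 0]] x im]
        continuous_on_compose2[OF hd_on_continuous[OF hd_on_hmat[OF d(1), of _ _ 0]] x im])
  then have "continuous_on ?J (\<lambda>s. F (c s) (velocity A I c s))"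
    by (rule continuous_on_eq) (use fermat_chart[OF d(1)] velocity_in_tangent_space[OF c I] in simp)
  then have "continuous (at s within ?J) (\<lambda>s. F (c s) (velocity A I c s))"
    using s d by (simp add: continuous_on_eq_continuous_within)
  then show "continuous (at s within I) (\<lambda>s. F (c s) (velocity A I c s))"
  proof -
    have "s \<in> ?J" using s d by simp
    from this \<open>continuous (at s within ?J) _\<close> show ?thesis by (simp only: at_within_openin[OF o])
  qed
qed

lemma smooth_curve_on_const: "derivative_unique_on I \<Longrightarrow> smooth_curve_on A I (\<lambda>_::real. x)"
proof -
  assume I: "derivative_unique_on I"
  obtain d where "d \<in> A" "x \<in> chart_dom d" by (rule chart_at)
  then show ?thesis by (intro smooth_curve_onI[OF I]) (auto simp: o_def intro: hd_on_const[OF I])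
qed

lemma velocity_const:
  assumes I: "derivative_unique_on I" and s: "s \<in> I"
  shows "velocity A I (\<lambda>_. x) s = (\<lambda>_. 0)"
proof
  fix d
  show "velocity A I (\<lambda>_. x) s d = 0"
  proof (cases "d \<in> A \<and> x \<in> chart_dom d")
    case True
    then show ?thesis by (intro velocity_eqI[where c = "\<lambda>_. x", OF I s]) (auto simp: o_def)
  next
    case False
    then show ?thesis by (auto simp: velocity_def)
  qed
qed

lemma reaches_stay:
  assumes "\<tau> > 0" shows "reaches x \<tau> x"
proof -
  have I: "derivative_unique_on {0..1::real}" by (simp add: derivative_unique_on_Icc)
  have "reaches x (\<tau> * 1 - \<tau> * 0) x"
  proof (rule reaches_lift[where c = "\<lambda>_. x" and t' = "\<lambda>_. \<tau>" and a = 0 and b = 1])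
    show "smooth_curve_on A {0..1} (\<lambda>_::real. x)" by (rule smooth_curve_on_const[OF I])
    show "hd_on {0..1} ((*) \<tau>) n" for n by (rule hd_on_mult[OF I hd_on_const[OF I] hd_on_ident[OF I]])
    show "((*) \<tau> has_vector_derivative \<tau>) (at s within {0..1})" for s
      by (auto intro!: derivative_eq_intros)
  qed (use assms in \<open>simp_all add: velocity_const[OF I] \<omega>_0 fermat_0\<close>)
  then show ?thesis by simp
qed

text \<open>The extra time leaves room for a polynomial \<open>t' > F(c')\<close> with integral \<open>\<tau>\<close>.  Its integral is a smooth
  time function, which makes \<open>(t, c)\<close> future timelike even where \<open>c\<close> is at rest.\<close>

lemma reaches_if_longer:
  assumes c: "smooth_curve_on A {a..b} c" and ab: "a < b"
    and \<tau>: "\<tau> > integral {a..b} (\<lambda>s. F (c s) (velocity A {a..b} c s))"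
  shows "reaches (c a) \<tau> (c b)"
proof -
  let ?f = "\<lambda>s. F (c s) (velocity A {a..b} c s)"
  have I: "derivative_unique_on {a..b}" using ab by (rule derivative_unique_on_Icc)
  have f: "continuous_on {a..b} ?f" by (rule continuous_on_fermat_velocity[OF c I])
  \<comment> \<open>\<open>q\<close> is within \<open>\<epsilon>\<close> of \<open>F(c')\<close>; the constant \<open>\<kappa>\<close> that corrects the integral of \<open>q\<close> to \<open>\<tau>\<close> exceeds \<open>\<epsilon>\<close>.\<close>
  define \<epsilon> where "\<epsilon> = (\<tau> - integral {a..b} ?f) / (3 * (b - a))"
  have \<epsilon>: "\<epsilon> > 0" using \<tau> ab by (simp add: \<epsilon>_def)
  obtain q where q: "real_polynomial_function q" "\<And>s. s \<in> {a..b} \<Longrightarrow> \<bar>?f s - q s\<bar> < \<epsilon>"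
    using Stone_Weierstrass_real_polynomial_function[OF compact_Icc f \<epsilon>] by blast
  have qn: "hd_on {a..b} q n" for n by (rule hd_on_real_polynomial[OF I q(1)])
  have qc: "continuous_on {a..b} q" by (rule hd_on_continuous[OF qn])
  define \<kappa> where "\<kappa> = (\<tau> - integral {a..b} q) / (b - a)"
  have "integral {a..b} q \<le> integral {a..b} (\<lambda>s. ?f s + \<epsilon>)"
  proof (rule integral_le)
    show "q integrable_on {a..b}" "(\<lambda>s. ?f s + \<epsilon>) integrable_on {a..b}"
      by (intro integrable_continuous_real continuous_intros f qc)+
    show "q s \<le> ?f s + \<epsilon>" if "s \<in> {a..b}" for s using q(2)[OF that] by linarith
  qed
  also have "\<dots> = integral {a..b} ?f + \<epsilon> * (b - a)"
    using ab by (subst hk_integral_add) (auto intro!: integrable_continuous_real f)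
  finally have "integral {a..b} q \<le> integral {a..b} ?f + \<epsilon> * (b - a)" .
  moreover have "\<epsilon> * (3 * (b - a)) = \<tau> - integral {a..b} ?f"
    using ab by (intro iffD1[OF nonzero_eq_divide_eq]) (simp_all add: \<epsilon>_def)
  moreover have "\<epsilon> * (3 * (b - a)) = 3 * (\<epsilon> * (b - a))" by simp
  moreover have "\<epsilon> * (b - a) > 0" using ab \<epsilon> by simp
  ultimately have "\<epsilon> * (b - a) < \<tau> - integral {a..b} q" by linarith
  then have \<kappa>: "\<kappa> > \<epsilon>" using ab by (simp add: \<kappa>_def pos_less_divide_eq)
  let ?t = "\<lambda>s. integral {a..s} (\<lambda>u. q u + \<kappa>)"
  have dt: "(?t has_vector_derivative q s + \<kappa>) (at s within {a..b})" if "s \<in> {a..b}" for s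
    by (rule integral_has_vector_derivative[OF _ that]) (intro continuous_intros qc)
  have "reaches (c a) (?t b - ?t a) (c b)"
  proof (rule reaches_lift[OF ab c _ dt])
    show "hd_on {a..b} ?t n" for n
      by (rule hd_on_Suc_imp[OF hd_on_real_SucI[OF I dt]]) (auto intro!: hd_on_add hd_on_const I qn)
    show 1: "?f s \<le> q s + \<kappa>" if "s \<in> {a..b}" for s
      using q(2)[OF that] \<kappa> by linarith
    show "\<omega> (c s) (velocity A {a..b} c s) / \<beta> (c s) < q s + \<kappa>" if "s \<in> {a..b}" for s
      using q(2)[OF that] \<kappa> fermat_ge_\<omega>[OF velocity_in_tangent_space[OF c I that]] by linarith
  qed
  moreover have "?t b - ?t a = \<tau>"
    using ab by (subst hk_integral_add) (auto intro!: integrable_continuous_real qc simp: \<kappa>_def)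
  ultimately show ?thesis by simp
qed

lemma reaches_if_longer_within:
  assumes c: "smooth_curve_on A {a..b} c" and uv: "a \<le> u" "u \<le> v" "v \<le> b" "a < b"
    and \<tau>: "\<tau> > integral {u..v} (\<lambda>s. F (c s) (velocity A {a..b} c s))"
  shows "reaches (c u) \<tau> (c v)"
proof (cases "u < v")
  case True
  have I: "derivative_unique_on {a..b}" "derivative_unique_on {u..v}"
    using True uv by (simp_all add: derivative_unique_on_Icc)
  have sub: "{u..v} \<subseteq> {a..b}" using uv by auto
  have "integral {u..v} (\<lambda>s. F (c s) (velocity A {u..v} c s)) = integral {u..v} (\<lambda>s. F (c s) (velocity A {a..b} c s))"
    using velocity_subset[OF c I(1) sub I(2)] by (intro hk_integral_cong) simp
  then show ?thesis using reaches_if_longer[OF smooth_curve_on_subset[OF c sub I(2)] True] \<tau> by simp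
next
  case False
  then show ?thesis using uv \<tau> reaches_stay by simp
qed

text \<open>The velocities within \<open>[a, b]\<close> and within \<open>[u, v]\<close> agree except possibly at \<open>u\<close> and \<open>v\<close>.\<close>

lemma has_integral_piece:
  assumes c: "smooth_curve_on A {u..v} c" and uv: "a \<le> u" "u < v" "v \<le> b"
  shows "((\<lambda>s. F (c s) (velocity A {a..b} c s)) has_integral
     integral {u..v} (\<lambda>s. F (c s) (velocity A {u..v} c s))) {u..v}"
proof (rule has_integral_spike_finite[of "{u, v}"])
  show "F (c s) (velocity A {a..b} c s) = F (c s) (velocity A {u..v} c s)" if "s \<in> {u..v} - {u, v}" for s
  proof -
    have "at s within {a..b} = at s" "at s within {u..v} = at s"
      using that uv by (auto intro!: at_within_Icc_at)
    then have "velocity A {a..b} c s = velocity A {u..v} c s" by (intro ext) (auto simp: velocity_def)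
    then show ?thesis by simp
  qed
  have "continuous_on {u..v} (\<lambda>s. F (c s) (velocity A {u..v} c s))"
    using uv by (intro continuous_on_fermat_velocity[OF c] derivative_unique_on_Icc)
  then show "((\<lambda>s. F (c s) (velocity A {u..v} c s)) has_integral
     integral {u..v} (\<lambda>s. F (c s) (velocity A {u..v} c s))) {u..v}"
    by (intro integrable_integral integrable_continuous_real)
qed simp

end

section \<open>The Lagrangian of a curve in a chart\<close>

text \<open>Every summand of the varied Lagrangian has the form \<open>\<Phi>(x + \<epsilon> \<eta>)\<close> times a polynomial in \<open>\<epsilon>\<close> of degree two:
  linear terms come from \<open>\<omega>\<close> and quadratic ones from \<open>h\<close>.\<close>

lemma variation_term:
  fixes \<Phi> :: "'e::euclidean_space \<Rightarrow> real" and x \<eta> :: "real \<Rightarrow> 'e"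
  assumes U: "open U" and \<Phi>: "hd_on U \<Phi> (Suc 0)"
    and x: "continuous_on {u..v} x" and \<eta>: "continuous_on {u..v} \<eta>"
    and inU: "\<And>\<epsilon> s. \<epsilon> \<in> {0..r} \<Longrightarrow> s \<in> {u..v} \<Longrightarrow> x s + \<epsilon> *\<^sub>R \<eta> s \<in> U"
    and c: "continuous_on {u..v} \<alpha>" "continuous_on {u..v} \<alpha>'" "continuous_on {u..v} \<alpha>''"
    and r: "r \<ge> 0"
  shows "((\<lambda>\<epsilon>. integral {u..v} (\<lambda>s. \<Phi> (x s + \<epsilon> *\<^sub>R \<eta> s) * (\<alpha> s + \<epsilon> * \<alpha>' s + \<epsilon>\<^sup>2 * \<alpha>'' s)))
    has_real_derivative
      integral {u..v} (\<lambda>s. frechet_derivative \<Phi> (at (x s) within U) (\<eta> s) * \<alpha> s + \<Phi> (x s) * \<alpha>' s)) (at 0 within {0..r})"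
proof -
  let ?D = "\<lambda>y. frechet_derivative \<Phi> (at y within U)"
  have D: "(\<Phi> has_derivative ?D y) (at y)" if "y \<in> U" for y
    using hd_on_SucD[OF \<Phi> that] by (simp only: at_within_open[OF that U])
  have Dsum: "?D y e = (\<Sum>i\<in>Basis. (e \<bullet> i) * ?D y i)" if "y \<in> U" for y e
  proof -
    have L: "linear (?D y)" using has_derivative_linear[OF D[OF that]] .
    have "?D y e = ?D y (\<Sum>i\<in>Basis. (e \<bullet> i) *\<^sub>R i)" by (simp add: euclidean_representation)
    then show ?thesis by (simp add: linear_sum[OF L] linear_scale[OF L])
  qed
  have Dc: "continuous_on U (\<lambda>y. ?D y i)" for i using \<Phi> by simp
  have \<Phi>c: "continuous_on U \<Phi>" using hd_on_continuous[OF \<Phi>] .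
  let ?S = "{0..r} \<times> cbox u v"
  have line: "continuous_on ?S (\<lambda>p. x (snd p) + fst p *\<^sub>R \<eta> (snd p))"
    by (intro continuous_intros continuous_on_compose2[OF x] continuous_on_compose2[OF \<eta>]) auto
  have lineU: "(\<lambda>p. x (snd p) + fst p *\<^sub>R \<eta> (snd p)) ` ?S \<subseteq> U" using inU by auto
  note cs = continuous_on_compose2[OF c(1)] continuous_on_compose2[OF c(2)] continuous_on_compose2[OF c(3)]
  define j where "j \<epsilon> s = \<Phi> (x s + \<epsilon> *\<^sub>R \<eta> s) * (\<alpha> s + \<epsilon> * \<alpha>' s + \<epsilon>\<^sup>2 * \<alpha>'' s)" for \<epsilon> s
  define j' where "j' \<epsilon> s = (\<Sum>i\<in>Basis. (\<eta> s \<bullet> i) * ?D (x s + \<epsilon> *\<^sub>R \<eta> s) i) * (\<alpha> s + \<epsilon> * \<alpha>' s + \<epsilon>\<^sup>2 * \<alpha>'' s)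
      + \<Phi> (x s + \<epsilon> *\<^sub>R \<eta> s) * (\<alpha>' s + 2 * \<epsilon> * \<alpha>'' s)" for \<epsilon> s
  have "((\<lambda>\<epsilon>. integral (cbox u v) (j \<epsilon>)) has_field_derivative integral (cbox u v) (j' 0)) (at 0 within {0..r})"
  proof (rule leibniz_rule_field_derivative)
    fix \<epsilon> s assume e: "\<epsilon> \<in> {0..r}" and s: "s \<in> cbox u v"
    let ?y = "x s + \<epsilon> *\<^sub>R \<eta> s"
    have y: "?y \<in> U" using inU e s by auto
    have "((\<lambda>\<epsilon>. x s + \<epsilon> *\<^sub>R \<eta> s) has_derivative (\<lambda>k. k *\<^sub>R \<eta> s)) (at \<epsilon> within {0..r})"
      by (auto intro!: derivative_eq_intros)
    from has_derivative_compose[OF this D[OF y]]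
    have "((\<lambda>\<epsilon>. \<Phi> (x s + \<epsilon> *\<^sub>R \<eta> s)) has_derivative (\<lambda>k. ?D ?y (k *\<^sub>R \<eta> s))) (at \<epsilon> within {0..r})" .
    moreover have "(\<lambda>k. ?D ?y (k *\<^sub>R \<eta> s)) = (*) (?D ?y (\<eta> s))"
      using linear_scale[OF has_derivative_linear[OF D[OF y]]] by (auto simp: mult.commute)
    ultimately have 1: "((\<lambda>\<epsilon>. \<Phi> (x s + \<epsilon> *\<^sub>R \<eta> s)) has_field_derivative ?D ?y (\<eta> s)) (at \<epsilon> within {0..r})"
      by (simp add: has_field_derivative_def)
    have 2: "((\<lambda>\<epsilon>. \<alpha> s + \<epsilon> * \<alpha>' s + \<epsilon>\<^sup>2 * \<alpha>'' s) has_field_derivative (\<alpha>' s + 2 * \<epsilon> * \<alpha>'' s)) (at \<epsilon> within {0..r})"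
      by (auto intro!: derivative_eq_intros)
    show "((\<lambda>\<epsilon>. j \<epsilon> s) has_field_derivative j' \<epsilon> s) (at \<epsilon> within {0..r})"
      unfolding j_def j'_def Dsum[OF y, symmetric] using DERIV_mult[OF 1 2] by (simp add: algebra_simps)
  next
    fix \<epsilon> assume "\<epsilon> \<in> {0..r}"
    then have "continuous_on {u..v} (j \<epsilon>)"
      unfolding j_def using inU
      by (intro continuous_intros continuous_on_compose2[OF \<Phi>c] x \<eta> c) auto
    then show "j \<epsilon> integrable_on cbox u v" by (simp add: integrable_continuous_real)
  next
    have "continuous_on ?S (\<lambda>p. j' (fst p) (snd p))"
      unfolding j'_def
      by (intro continuous_intros continuous_on_compose2[OF Dc line lineU] continuous_on_compose2[OF \<Phi>c line lineU]
          continuous_on_compose2[OF \<eta>] cs) auto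
    then show "continuous_on ?S (\<lambda>(\<epsilon>, s). j' \<epsilon> s)" by (simp add: split_beta)
  qed (use r in auto)
  moreover have "integral {u..v} (j' 0) = integral {u..v}
      (\<lambda>s. ?D (x s) (\<eta> s) * \<alpha> s + \<Phi> (x s) * \<alpha>' s)"
  proof (rule hk_integral_cong)
    fix s assume "s \<in> {u..v}"
    then have "x s \<in> U" using inU[of 0 s] r by simp
    then show "j' 0 s = ?D (x s) (\<eta> s) * \<alpha> s + \<Phi> (x s) * \<alpha>' s" by (simp add: j'_def Dsum)
  qed
  moreover have "(\<lambda>\<epsilon>. integral {u..v} (j \<epsilon>)) =
      (\<lambda>\<epsilon>. integral {u..v} (\<lambda>s. \<Phi> (x s + \<epsilon> *\<^sub>R \<eta> s) * (\<alpha> s + \<epsilon> * \<alpha>' s + \<epsilon>\<^sup>2 * \<alpha>'' s)))"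
    by (simp add: j_def[abs_def])
  ultimately show ?thesis by simp
qed

lemma lform_linear:
  "lform t (v + v') = lform t v + lform t v'" "lform t (k *\<^sub>R v) = k * lform t v" "lform t 0 = 0" "lform t (- v) = - lform t v"
  by (simp_all add: lform_def inner_add_left algebra_simps sum.distrib sum_distrib_left sum_negf)

locale chart_curve = som A \<beta> \<omega> g0
  for A :: "('a::{t2_space, second_countable_topology}, 'e::euclidean_space) chart set" and \<beta> \<omega> g0 +
  fixes d :: "('a, 'e) chart" and a b :: real and c :: "real \<Rightarrow> 'a"
  assumes d: "d \<in> A" and ab: "a < b" and c: "smooth_curve_on A {a..b} c"
    and c_dom: "c ` {a..b} \<subseteq> chart_dom d"
begin

abbreviation U where "U \<equiv> chart_image d"
definition x where "x s = chart_map d (c s)"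
definition w where "w s = velocity A {a..b} c s d"
definition speed where "speed s = sqrt (bilin (hmat d (x s)) (w s) (w s))"

abbreviation flength :: "real \<Rightarrow> real \<Rightarrow> real" where
  "flength u v \<equiv> integral {u..v} (\<lambda>s. F (c s) (velocity A {a..b} c s))"

lemma I: "derivative_unique_on {a..b}"
  using ab by (rule derivative_unique_on_Icc)

lemma open_U: "open U"
  by (rule open_chart_image[OF d])

lemma c_in_dom: "s \<in> {a..b} \<Longrightarrow> c s \<in> chart_dom d"
  using c_dom by blast

lemma x_in_U: "s \<in> {a..b} \<Longrightarrow> x s \<in> U"
  unfolding x_def by (rule imageI[OF c_in_dom])

lemma hd_on_x: "hd_on {a..b} x n"
proof -
  have "{s \<in> {a..b}. c s \<in> chart_dom d} = {a..b}" using c_dom by auto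
  then show ?thesis using smooth_curve_on_chart[OF c d, of n] by (simp add: x_def[abs_def] o_def)
qed

lemma continuous_on_x: "continuous_on {a..b} x"
  by (rule hd_on_continuous[OF hd_on_x])

lemma has_vector_derivative_x: "s \<in> {a..b} \<Longrightarrow> (x has_vector_derivative w s) (at s within {a..b})"
  using has_vector_derivative_velocity[OF c I _ d c_in_dom, of s] by (simp add: x_def[abs_def] w_def o_def)

lemma continuous_on_w: "continuous_on {a..b} w"
proof -
  have "{s \<in> {a..b}. c s \<in> chart_dom d} = {a..b}" using c_dom by auto
  then show ?thesis using continuous_on_velocity_chart[OF c I d] by (simp add: w_def[abs_def])
qed

lemma continuous_on_\<theta>: "continuous_on U (\<lambda>y. \<theta> d y i)"
  by (rule hd_on_continuous[OF hd_on_\<theta>[OF d, of _ 0]])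

lemma continuous_on_hmat: "continuous_on U (\<lambda>y. hmat d y i k)"
  by (rule hd_on_continuous[OF hd_on_hmat[OF d, of _ _ 0]])

lemma continuous_on_\<theta>_x: "continuous_on {a..b} (\<lambda>s. \<theta> d (x s) i)"
  by (rule continuous_on_compose2[OF continuous_on_\<theta> continuous_on_x]) (use x_in_U in auto)

lemma continuous_on_hmat_x: "continuous_on {a..b} (\<lambda>s. hmat d (x s) i k)"
  by (rule continuous_on_compose2[OF continuous_on_hmat continuous_on_x]) (use x_in_U in auto)

lemma fermat_x: "s \<in> {a..b} \<Longrightarrow> F (c s) (velocity A {a..b} c s) = lform (\<theta> d (x s)) (w s) + speed s"
  using fermat_chart[OF d c_in_dom velocity_in_tangent_space[OF c I], of s]
  by (simp add: x_def w_def speed_def)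

lemma speed_nonneg: "s \<in> {a..b} \<Longrightarrow> speed s \<ge> 0"
  using hmat_pos[OF d x_in_U, of s "w s"] by (cases "w s = 0") (auto simp: speed_def bilin_linear)

lemma speed_square: "s \<in> {a..b} \<Longrightarrow> (speed s)\<^sup>2 = bilin (hmat d (x s)) (w s) (w s)"
  using hmat_pos[OF d x_in_U, of s "w s"] by (cases "w s = 0") (auto simp: speed_def bilin_linear)

lemma speed_0_iff: "s \<in> {a..b} \<Longrightarrow> speed s = 0 \<longleftrightarrow> w s = 0"
  using hmat_pos[OF d x_in_U, of s "w s"] by (cases "w s = 0") (auto simp: speed_def bilin_linear)

lemma continuous_on_speed: "continuous_on {a..b} speed"
  unfolding speed_def bilin_def
  by (intro continuous_intros continuous_on_hmat_x continuous_on_w)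

text \<open>At rest the quotient is \<open>0 / 0 = 0\<close>, which is its continuous value there: by coercivity of \<open>h\<close> the
  numerator is at most a multiple of the square of the speed.\<close>

definition quad where "quad i k s = (w s \<bullet> i) * (w s \<bullet> k) / speed s"

lemma continuous_on_quad:
  assumes "i \<in> Basis" "k \<in> Basis" shows "continuous_on {a..b} (quad i k)"
proof -
  obtain m where m: "m > 0" "\<And>s v. s \<in> {a..b} \<Longrightarrow> m * (norm v)\<^sup>2 \<le> bilin (hmat d (x s)) v v"
    by (rule pos_def_coercive[of "{a..b}" "\<lambda>s. hmat d (x s)"])
      (use continuous_on_hmat_x hmat_pos[OF d x_in_U] in auto)
  have bound: "\<bar>quad i k s\<bar> \<le> speed s / m" if s: "s \<in> {a..b}" for s
  proof (cases "speed s = 0")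
    case False
    then have pos: "speed s > 0" using speed_nonneg[OF s] by simp
    have "\<bar>(w s \<bullet> i) * (w s \<bullet> k)\<bar> \<le> (norm (w s))\<^sup>2"
      using Basis_le_norm[OF assms(1), of "w s"] Basis_le_norm[OF assms(2), of "w s"]
      by (simp add: abs_mult power2_eq_square mult_mono)
    also have "\<dots> \<le> (speed s)\<^sup>2 / m"
      using m(2)[OF s, of "w s"] m(1) speed_square[OF s] by (simp add: field_simps)
    finally have "\<bar>(w s \<bullet> i) * (w s \<bullet> k)\<bar> / speed s \<le> (speed s)\<^sup>2 / m / speed s"
      using pos by (intro divide_right_mono) auto
    then show ?thesis using pos by (simp add: quad_def power2_eq_square)
  qed (simp add: quad_def)
  show ?thesis
    unfolding continuous_on_def
  proof
    fix s assume s: "s \<in> {a..b}"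
    have sp: "(speed \<longlongrightarrow> speed s) (at s within {a..b})"
      using continuous_on_speed s by (simp add: continuous_on_def)
    have wl: "(w \<longlongrightarrow> w s) (at s within {a..b})"
      using continuous_on_w s by (simp add: continuous_on_def)
    show "(quad i k \<longlongrightarrow> quad i k s) (at s within {a..b})"
    proof (cases "speed s = 0")
      case False
      then show ?thesis unfolding quad_def by (intro tendsto_intros sp wl)
    next
      case True
      have "((\<lambda>s. speed s / m) \<longlongrightarrow> 0) (at s within {a..b})"
        using tendsto_divide[OF sp tendsto_const, of m] m(1) True by simp
      moreover have "\<forall>\<^sub>F s in at s within {a..b}. norm (quad i k s) \<le> speed s / m"
        using bound by (auto simp: eventually_at_filter)
      ultimately have "(quad i k \<longlongrightarrow> 0) (at s within {a..b})" by (rule Lim_null_comparison[rotated])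
      then show ?thesis using True by (simp add: quad_def)
    qed
  qed
qed

lemma hmat_sym: "y \<in> U \<Longrightarrow> hmat d y i k = hmat d y k i"
  using g0_sym[OF coord_vector_in_tangent_space[OF d chart_inv_dom] coord_vector_in_tangent_space[OF d chart_inv_dom]]
  by (simp add: hmat_def mult.commute)

lemma bilin_hmat_sym: "y \<in> U \<Longrightarrow> bilin (hmat d y) v v' = bilin (hmat d y) v' v"
  unfolding bilin_def by (subst sum.swap) (simp add: hmat_sym[of y] ac_simps)

text \<open>The force \<open>\<partial>L/\<partial>x\<close> and the momentum \<open>\<partial>L/\<partial>v\<close> of the Randers Lagrangian along the curve.  The force
  vanishes while the curve rests; the momentum has this meaning only while it moves.\<close>

definition force :: "real \<Rightarrow> 'e \<Rightarrow> real" where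
  "force s e = (\<Sum>i\<in>Basis. frechet_derivative (\<lambda>y. \<theta> d y i) (at (x s) within U) e * (w s \<bullet> i))
     + (\<Sum>i\<in>Basis. \<Sum>k\<in>Basis. frechet_derivative (\<lambda>y. hmat d y i k) (at (x s) within U) e * quad i k s) / 2"

definition momentum :: "real \<Rightarrow> 'e \<Rightarrow> real" where
  "momentum s e = lform (\<theta> d (x s)) e + bilin (hmat d (x s)) e (w s) / speed s"

lemma linear_force:
  assumes s: "s \<in> {a..b}" shows "linear (force s)"
proof -
  have D: "linear (frechet_derivative \<Phi> (at (x s) within U))" if "hd_on U \<Phi> (Suc 0)" for \<Phi> :: "'e \<Rightarrow> real"
    using has_derivative_linear[OF hd_on_SucD[OF that x_in_U[OF s]]] .
  note lin = D[OF hd_on_\<theta>[OF d]] D[OF hd_on_hmat[OF d]]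
  show ?thesis
    by (rule linearI)
      (simp_all add: force_def linear_add[OF lin(1)] linear_add[OF lin(2)] linear_scale[OF lin(1)] linear_scale[OF lin(2)]
        distrib_right sum.distrib sum_distrib_left add_divide_distrib distrib_left mult.assoc)
qed

lemma continuous_on_force: "continuous_on {a..b} (\<lambda>s. force s e)"
proof -
  have D: "continuous_on {a..b} (\<lambda>s. frechet_derivative \<Phi> (at (x s) within U) e)"
    if "hd_on U \<Phi> (Suc 0)" for \<Phi> :: "'e \<Rightarrow> real"
    by (rule continuous_on_compose2[of U "\<lambda>y. frechet_derivative \<Phi> (at y within U) e", OF _ continuous_on_x])
      (use that x_in_U in auto)
  show ?thesis unfolding force_def
    by (intro continuous_intros D[OF hd_on_\<theta>[OF d]] D[OF hd_on_hmat[OF d]] continuous_on_w continuous_on_quad) auto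
qed

end

section \<open>The first variation of length\<close>

context chart_curve
begin

text \<open>The square root in \<open>F\<close> is removed by \<open>2 |v| \<le> |v|\<^sup>2 / \<mu> + \<mu>\<close>, with \<open>\<mu>\<close> the speed of the
  unvaried curve, so that equality holds for the unvaried curve.\<close>

lemma segment_variation:
  fixes p \<kappa> :: 'e and r :: real
  assumes uv: "a \<le> u" "u < v" "v \<le> b" and r: "r \<ge> 0"
    and inU: "\<And>\<epsilon> s. \<epsilon> \<in> {0..r} \<Longrightarrow> s \<in> {u..v} \<Longrightarrow> x s + \<epsilon> *\<^sub>R (p + s *\<^sub>R \<kappa>) \<in> U"
    and reg: "(\<forall>s\<in>{u..v}. speed s > 0) \<or> \<kappa> = 0"
  obtains J where
    "(J has_real_derivative integral {u..v} (\<lambda>s. force s (p + s *\<^sub>R \<kappa>) + momentum s \<kappa>)) (at 0 within {0..r})"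
    "J 0 = flength u v"
    "\<And>\<epsilon> \<tau>. \<epsilon> \<in> {0..r} \<Longrightarrow> J \<epsilon> < \<tau> \<Longrightarrow>
       reaches (chart_inv d (x u + \<epsilon> *\<^sub>R (p + u *\<^sub>R \<kappa>))) \<tau> (chart_inv d (x v + \<epsilon> *\<^sub>R (p + v *\<^sub>R \<kappa>)))"
proof -
  define \<eta> where "\<eta> s = p + s *\<^sub>R \<kappa>" for s
  note inU' = inU[folded \<eta>_def]
  have sub: "{u..v} \<subseteq> {a..b}" using uv by auto
  have Iuv: "derivative_unique_on {u..v}" using uv by (simp add: derivative_unique_on_Icc)
  have xc: "continuous_on {u..v} x" by (rule continuous_on_subset[OF continuous_on_x sub])
  have wc: "continuous_on {u..v} w" by (rule continuous_on_subset[OF continuous_on_w sub])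
  have sc: "continuous_on {u..v} speed" by (rule continuous_on_subset[OF continuous_on_speed sub])
  have \<eta>c: "continuous_on {u..v} \<eta>" unfolding \<eta>_def by (intro continuous_intros)
  have qc: "continuous_on {u..v} (quad i k)" if "i \<in> Basis" "k \<in> Basis" for i k
    by (rule continuous_on_subset[OF continuous_on_quad[OF that] sub])
  define m where "m i k s = ((\<kappa> \<bullet> i) * (w s \<bullet> k) + (w s \<bullet> i) * (\<kappa> \<bullet> k)) / speed s" for i k s
  define n where "n i k s = (\<kappa> \<bullet> i) * (\<kappa> \<bullet> k) / speed s" for i k s
  have mc: "continuous_on {u..v} (m i k)" and nc: "continuous_on {u..v} (n i k)" for i k
  proof -
    have "continuous_on {u..v} (m i k) \<and> continuous_on {u..v} (n i k)"
    proof (cases "\<kappa> = 0")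
      case True
      then show ?thesis by (simp add: m_def[abs_def] n_def[abs_def])
    next
      case False
      then show ?thesis unfolding m_def[abs_def] n_def[abs_def] using reg
        by (intro conjI continuous_intros wc sc) fastforce+
    qed
    then show "continuous_on {u..v} (m i k)" "continuous_on {u..v} (n i k)" by blast+
  qed
  define A1 where "A1 i \<epsilon> s = \<theta> d (x s + \<epsilon> *\<^sub>R \<eta> s) i * (w s \<bullet> i + \<epsilon> * (\<kappa> \<bullet> i) + \<epsilon>\<^sup>2 * 0)" for i \<epsilon> s
  define A2 where "A2 i k \<epsilon> s = hmat d (x s + \<epsilon> *\<^sub>R \<eta> s) i k * (quad i k s / 2 + \<epsilon> * (m i k s / 2) + \<epsilon>\<^sup>2 * (n i k s / 2))" for i k \<epsilon> s
  define B1 where "B1 i s = frechet_derivative (\<lambda>y. \<theta> d y i) (at (x s) within U) (\<eta> s) * (w s \<bullet> i) + \<theta> d (x s) i * (\<kappa> \<bullet> i)" for i s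
  define B2 where "B2 i k s = frechet_derivative (\<lambda>y. hmat d y i k) (at (x s) within U) (\<eta> s) * (quad i k s / 2) + hmat d (x s) i k * (m i k s / 2)" for i k s
  have d1: "((\<lambda>\<epsilon>. integral {u..v} (A1 i \<epsilon>)) has_real_derivative integral {u..v} (B1 i)) (at 0 within {0..r})" for i
    unfolding A1_def B1_def
    by (rule variation_term[OF open_U hd_on_\<theta>[OF d] xc \<eta>c inU' _ _ _ r]) (auto intro!: continuous_intros wc)
  have d2: "((\<lambda>\<epsilon>. integral {u..v} (A2 i k \<epsilon>)) has_real_derivative integral {u..v} (B2 i k)) (at 0 within {0..r})"
    if "i \<in> Basis" "k \<in> Basis" for i k
    unfolding A2_def B2_def
    by (rule variation_term[OF open_U hd_on_hmat[OF d] xc \<eta>c inU' _ _ _ r]) (auto intro!: continuous_intros qc that mc nc)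
  define J where "J \<epsilon> = (\<Sum>i\<in>Basis. integral {u..v} (A1 i \<epsilon>)) + (\<Sum>i\<in>Basis. \<Sum>k\<in>Basis. integral {u..v} (A2 i k \<epsilon>))
     + integral {u..v} (\<lambda>s. speed s / 2)" for \<epsilon>
  have "(J has_real_derivative ((\<Sum>i\<in>Basis. integral {u..v} (B1 i)) + (\<Sum>i\<in>Basis. \<Sum>k\<in>Basis. integral {u..v} (B2 i k)) + 0))
      (at 0 within {0..r})"
    unfolding J_def[abs_def] by (intro DERIV_add DERIV_sum d1 d2 DERIV_const)
  also have "(\<Sum>i\<in>Basis. integral {u..v} (B1 i)) + (\<Sum>i\<in>Basis. \<Sum>k\<in>Basis. integral {u..v} (B2 i k)) + 0
      = integral {u..v} (\<lambda>s. force s (\<eta> s) + momentum s \<kappa>)"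
  proof -
    have D: "continuous_on {u..v} (\<lambda>s. frechet_derivative \<Phi> (at (x s) within U) (\<eta> s))"
      if \<Phi>: "hd_on U \<Phi> (Suc 0)" for \<Phi> :: "'e \<Rightarrow> real"
    proof -
      have "frechet_derivative \<Phi> (at (x s) within U) (\<eta> s) = frechet_derivative \<Phi> (at (x s) within U) p
          + s * frechet_derivative \<Phi> (at (x s) within U) \<kappa>" if "s \<in> {u..v}" for s
      proof -
        have "linear (frechet_derivative \<Phi> (at (x s) within U))"
          using has_derivative_linear[OF hd_on_SucD[OF \<Phi> x_in_U]] that sub by blast
        then show ?thesis by (simp add: \<eta>_def linear_add linear_scale)
      qed
      moreover have "continuous_on {u..v} (\<lambda>s. frechet_derivative \<Phi> (at (x s) within U) e)" for e
        by (rule continuous_on_compose2[of U "\<lambda>y. frechet_derivative \<Phi> (at y within U) e", OF _ xc])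
          (use \<Phi> x_in_U sub in auto)
      ultimately show ?thesis
        by (subst continuous_on_cong[OF refl]) (auto intro!: continuous_intros)
    qed
    have i1: "B1 i integrable_on {u..v}" for i
      unfolding B1_def
      by (intro integrable_continuous_real continuous_intros wc D[OF hd_on_\<theta>[OF d]]
          continuous_on_subset[OF continuous_on_\<theta>_x sub])
    have i2: "B2 i k integrable_on {u..v}" if "i \<in> Basis" "k \<in> Basis" for i k
      unfolding B2_def
      by (intro integrable_continuous_real continuous_intros mc qc that D[OF hd_on_hmat[OF d]]
          continuous_on_subset[OF continuous_on_hmat_x sub]) auto
    have "(\<Sum>i\<in>Basis. integral {u..v} (B1 i)) + (\<Sum>i\<in>Basis. \<Sum>k\<in>Basis. integral {u..v} (B2 i k))
        = integral {u..v} (\<lambda>s. (\<Sum>i\<in>Basis. B1 i s) + (\<Sum>i\<in>Basis. \<Sum>k\<in>Basis. B2 i k s))"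
      by (simp add: hk_integral_add hk_integral_sum integrable_sum i1 i2)
    also have "\<dots> = integral {u..v} (\<lambda>s. force s (\<eta> s) + momentum s \<kappa>)"
    proof (rule hk_integral_cong)
      fix s assume "s \<in> {u..v}"
      then have xs: "x s \<in> U" using sub x_in_U by blast
      have "(\<Sum>i\<in>Basis. \<Sum>k\<in>Basis. hmat d (x s) i k * (m i k s / 2))
          = (bilin (hmat d (x s)) \<kappa> (w s) + bilin (hmat d (x s)) (w s) \<kappa>) / 2 / speed s"
        unfolding bilin_def m_def
        by (simp add: sum.distrib[symmetric] sum_divide_distrib add_divide_distrib algebra_simps)
      also have "\<dots> = bilin (hmat d (x s)) \<kappa> (w s) / speed s"
        using bilin_hmat_sym[OF xs, of "w s" \<kappa>] by simp
      finally show "(\<Sum>i\<in>Basis. B1 i s) + (\<Sum>i\<in>Basis. \<Sum>k\<in>Basis. B2 i k s) = force s (\<eta> s) + momentum s \<kappa>"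
        by (simp add: B1_def B2_def force_def momentum_def lform_def sum.distrib sum_divide_distrib)
    qed
    finally show ?thesis by simp
  qed
  finally have J1: "(J has_real_derivative integral {u..v} (\<lambda>s. force s (\<eta> s) + momentum s \<kappa>)) (at 0 within {0..r})" .
  define jj where "jj \<epsilon> s = (\<Sum>i\<in>Basis. A1 i \<epsilon> s) + (\<Sum>i\<in>Basis. \<Sum>k\<in>Basis. A2 i k \<epsilon> s) + speed s / 2" for \<epsilon> s
  have jjc: "continuous_on {u..v} (jj \<epsilon>)" and Jjj: "J \<epsilon> = integral {u..v} (jj \<epsilon>)" if "\<epsilon> \<in> {0..r}" for \<epsilon>
  proof -
    have line: "continuous_on {u..v} (\<lambda>s. x s + \<epsilon> *\<^sub>R \<eta> s)" by (intro continuous_intros xc \<eta>c)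
    have im: "(\<lambda>s. x s + \<epsilon> *\<^sub>R \<eta> s) ` {u..v} \<subseteq> U" using inU'[OF that] by blast
    have c1: "continuous_on {u..v} (A1 i \<epsilon>)" for i
      unfolding A1_def by (intro continuous_intros continuous_on_compose2[OF continuous_on_\<theta> line im] wc)
    have c2: "continuous_on {u..v} (A2 i k \<epsilon>)" if "i \<in> Basis" "k \<in> Basis" for i k
      unfolding A2_def by (intro continuous_intros continuous_on_compose2[OF continuous_on_hmat line im] mc nc qc that) auto
    show "continuous_on {u..v} (jj \<epsilon>)" unfolding jj_def by (intro continuous_intros c1 c2 sc) auto
    show "J \<epsilon> = integral {u..v} (jj \<epsilon>)"
      unfolding J_def jj_def
      by (simp add: hk_integral_add hk_integral_sum
          integrable_sum integrable_add integrable_continuous_real c1 c2 sc continuous_on_divide)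
  qed
  have jj_eq: "jj \<epsilon> s = lform (\<theta> d (x s + \<epsilon> *\<^sub>R \<eta> s)) (w s + \<epsilon> *\<^sub>R \<kappa>)
      + (bilin (hmat d (x s + \<epsilon> *\<^sub>R \<eta> s)) (w s + \<epsilon> *\<^sub>R \<kappa>) (w s + \<epsilon> *\<^sub>R \<kappa>) / speed s + speed s) / 2" for \<epsilon> s
  proof -
    have "A2 i k \<epsilon> s = hmat d (x s + \<epsilon> *\<^sub>R \<eta> s) i k * ((w s + \<epsilon> *\<^sub>R \<kappa>) \<bullet> i) * ((w s + \<epsilon> *\<^sub>R \<kappa>) \<bullet> k) / speed s / 2" for i k
    proof -
      have "quad i k s / 2 + \<epsilon> * (m i k s / 2) + \<epsilon>\<^sup>2 * (n i k s / 2)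
          = ((w s \<bullet> i) * (w s \<bullet> k) + \<epsilon> * ((\<kappa> \<bullet> i) * (w s \<bullet> k) + (w s \<bullet> i) * (\<kappa> \<bullet> k)) + \<epsilon>\<^sup>2 * ((\<kappa> \<bullet> i) * (\<kappa> \<bullet> k))) / speed s / 2"
        by (simp add: quad_def m_def n_def add_divide_distrib distrib_left)
      also have "\<dots> = ((w s + \<epsilon> *\<^sub>R \<kappa>) \<bullet> i) * ((w s + \<epsilon> *\<^sub>R \<kappa>) \<bullet> k) / speed s / 2"
        by (simp add: inner_add_left algebra_simps power2_eq_square)
      finally show ?thesis by (simp add: A2_def)
    qed
    then show ?thesis
      by (simp add: jj_def A1_def lform_def bilin_def inner_add_left sum_divide_distrib add_divide_distrib)
  qed
  have J0: "J 0 = flength u v"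
    unfolding Jjj[OF atLeastAtMost_iff[THEN iffD2, OF conjI[OF order_refl r]]]
  proof (rule hk_integral_cong)
    fix s assume "s \<in> {u..v}"
    then have s: "s \<in> {a..b}" using sub by blast
    have "bilin (hmat d (x s)) (w s) (w s) / speed s = speed s"
      using speed_square[OF s] by (simp add: power2_eq_square nonzero_divide_eq_eq flip: speed_square[OF s])
    then show "jj 0 s = F (c s) (velocity A {a..b} c s)"
      by (simp add: jj_eq fermat_x[OF s])
  qed
  have J2: "reaches (chart_inv d (x u + \<epsilon> *\<^sub>R \<eta> u)) \<tau> (chart_inv d (x v + \<epsilon> *\<^sub>R \<eta> v))"
    if \<epsilon>: "\<epsilon> \<in> {0..r}" and \<tau>: "J \<epsilon> < \<tau>" for \<epsilon> \<tau>
  proof -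
    define y where "y s = x s + \<epsilon> *\<^sub>R \<eta> s" for s
    define c' where "c' s = chart_inv d (y s)" for s
    have yU: "y s \<in> U" if "s \<in> {u..v}" for s using inU'[OF \<epsilon> that] by (simp add: y_def)
    have yc': "chart_map d (c' s) = y s" "c' s \<in> chart_dom d" if "s \<in> {u..v}" for s
      using yU[OF that] chart_inv_dom[OF yU[OF that]] by (simp_all add: c'_def f_inv_into_f)
    have hy: "hd_on {u..v} y k" for k
      unfolding y_def \<eta>_def
      by (intro hd_on_add hd_on_scaleR hd_on_const hd_on_ident Iuv hd_on_subset[OF Iuv sub hd_on_x])
    have c': "smooth_curve_on A {u..v} c'"
    proof (rule smooth_curve_onI[OF Iuv d])
      show "c' ` {u..v} \<subseteq> chart_dom d" using yc' by auto
      show "hd_on {u..v} (chart_map d \<circ> c') k" for k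
        using hy[of k] yc' hd_on_cong[of "{u..v}" "chart_map d \<circ> c'" y k] by simp
    qed
    have vel: "velocity A {u..v} c' s d = w s + \<epsilon> *\<^sub>R \<kappa>" if s: "s \<in> {u..v}" for s
    proof (rule velocity_eqI[where c = c', OF Iuv s d yc'(2)[OF s]])
      have "(\<eta> has_vector_derivative \<kappa>) (at s within {u..v})"
        unfolding \<eta>_def by (auto intro!: derivative_eq_intros)
      then have "((\<lambda>s. \<epsilon> *\<^sub>R \<eta> s) has_vector_derivative \<epsilon> *\<^sub>R \<kappa>) (at s within {u..v})"
        by (rule bounded_linear.has_vector_derivative[OF bounded_linear_scaleR_right])
      then have "(y has_vector_derivative w s + \<epsilon> *\<^sub>R \<kappa>) (at s within {u..v})"
        unfolding y_def using s sub
        by (intro has_vector_derivative_add has_vector_derivative_within_subset[OF has_vector_derivative_x sub]) auto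
      then show "(chart_map d \<circ> c' has_vector_derivative w s + \<epsilon> *\<^sub>R \<kappa>) (at s within {u..v})"
        by (rule has_vector_derivative_transform[rotated 2]) (use s yc' in auto)
    qed
    have "integral {u..v} (\<lambda>s. F (c' s) (velocity A {u..v} c' s)) \<le> integral {u..v} (jj \<epsilon>)"
    proof (rule integral_le)
      show "(\<lambda>s. F (c' s) (velocity A {u..v} c' s)) integrable_on {u..v}"
        by (rule integrable_continuous_real[OF continuous_on_fermat_velocity[OF c' Iuv]])
      show "jj \<epsilon> integrable_on {u..v}" by (rule integrable_continuous_real[OF jjc[OF \<epsilon>]])
      fix s assume s: "s \<in> {u..v}"
      then have s': "s \<in> {a..b}" using sub by blast
      let ?B = "bilin (hmat d (y s)) (w s + \<epsilon> *\<^sub>R \<kappa>) (w s + \<epsilon> *\<^sub>R \<kappa>)"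
      have Fs: "F (c' s) (velocity A {u..v} c' s) = lform (\<theta> d (y s)) (w s + \<epsilon> *\<^sub>R \<kappa>) + sqrt ?B"
        using fermat_chart[OF d yc'(2)[OF s] velocity_in_tangent_space[OF c' Iuv s]]
        by (simp add: yc'(1)[OF s] vel[OF s])
      have "sqrt ?B \<le> (?B / speed s + speed s) / 2"
      proof (cases "speed s = 0")
        case True
        then have "w s = 0" using speed_0_iff[OF s'] by simp
        moreover have "\<kappa> = 0" using reg s True by (metis less_irrefl)
        ultimately show ?thesis using True by (simp add: bilin_linear)
      next
        case False
        then have sp: "speed s > 0" using speed_nonneg[OF s'] by simp
        have B: "?B \<ge> 0"
          using hmat_pos[OF d yU[OF s], of "w s + \<epsilon> *\<^sub>R \<kappa>"] by (cases "w s + \<epsilon> *\<^sub>R \<kappa> = 0") (auto simp: bilin_linear)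
        have "0 \<le> (sqrt ?B - speed s)\<^sup>2" by simp
        then have "2 * sqrt ?B * speed s \<le> ?B + speed s * speed s"
          using B by (simp add: power2_diff) (simp add: power2_eq_square)
        then show ?thesis using sp by (simp add: field_simps)
      qed
      then show "F (c' s) (velocity A {u..v} c' s) \<le> jj \<epsilon> s"
        unfolding Fs jj_eq y_def by simp
    qed
    then have "integral {u..v} (\<lambda>s. F (c' s) (velocity A {u..v} c' s)) < \<tau>"
      using \<tau> Jjj[OF \<epsilon>] by simp
    from reaches_if_longer[OF c' uv(2) this] show ?thesis by (simp add: c'_def y_def)
  qed
  show ?thesis using that[OF J1[unfolded \<eta>_def] J0] J2[unfolded \<eta>_def] by blast
qed

lemma momentum_linear: "momentum s (k *\<^sub>R e) = k * momentum s e" "momentum s 0 = 0" "momentum s (- e) = - momentum s e"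
  by (simp_all add: momentum_def lform_linear bilin_linear distrib_left add_divide_distrib)

lemma continuous_momentum:
  assumes "S \<subseteq> {a..b}" "\<And>s. s \<in> S \<Longrightarrow> speed s \<noteq> 0"
  shows "continuous_on S (\<lambda>s. momentum s e)"
proof -
  have 1: "continuous_on S (\<lambda>s. \<theta> d (x s) i)" "continuous_on S (\<lambda>s. hmat d (x s) i k)" "continuous_on S w" "continuous_on S speed"
    for i k
    by (rule continuous_on_subset[OF _ assms(1)], rule continuous_on_\<theta>_x continuous_on_hmat_x continuous_on_w continuous_on_speed)+
  show ?thesis unfolding momentum_def lform_def bilin_def using assms(2)
    by (intro continuous_intros 1) auto
qed

lemma force_bound:
  obtains C where "C > 0" "\<And>s. s \<in> {a..b} \<Longrightarrow> \<bar>force s e\<bar> \<le> C"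
proof -
  have "compact ((\<lambda>s. force s e) ` {a..b})"
    by (rule compact_continuous_image[OF continuous_on_force compact_Icc])
  then obtain C where "\<And>s. s \<in> {a..b} \<Longrightarrow> \<bar>force s e\<bar> \<le> C"
    using compact_imp_bounded bounded_iff by (metis (no_types, lifting) imageI real_norm_def)
  then show ?thesis using that[of "max C 1"] by fastforce
qed

text \<open>The image of the curve is compact in the open chart image, so small displacements stay inside.\<close>

lemma variation_room:
  obtains r where "r > 0" "\<And>\<epsilon> s \<eta>. \<epsilon> \<in> {0..r} \<Longrightarrow> s \<in> {a..b} \<Longrightarrow> norm \<eta> \<le> N \<Longrightarrow> x s + \<epsilon> *\<^sub>R \<eta> \<in> U"
proof -
  have "compact (x ` {a..b})" by (rule compact_continuous_image[OF continuous_on_x compact_Icc])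
  moreover have "x ` {a..b} \<subseteq> U" using x_in_U by blast
  ultimately obtain \<rho> where \<rho>: "\<rho> > 0" "(\<Union>y\<in>x ` {a..b}. ball y \<rho>) \<subseteq> U"
    using compact_subset_open_imp_ball_epsilon_subset[OF _ open_U] by metis
  define r where "r = \<rho> / (2 * (\<bar>N\<bar> + 1))"
  have r: "r > 0" using \<rho>(1) by (simp add: r_def add_nonneg_pos)
  show ?thesis
  proof (rule that[OF r])
    fix \<epsilon> s and \<eta> :: 'e assume e: "\<epsilon> \<in> {0..r}" and s: "s \<in> {a..b}" and n: "norm \<eta> \<le> N"
    have "norm (\<epsilon> *\<^sub>R \<eta>) \<le> r * (\<bar>N\<bar> + 1)" using e n r by (auto intro!: mult_mono)
    also have "\<dots> < \<rho>" using \<rho>(1) by (simp add: r_def field_simps add_pos_nonneg add_nonneg_pos)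
    finally have "x s + \<epsilon> *\<^sub>R \<eta> \<in> ball (x s) \<rho>" by (simp add: dist_norm)
    then show "x s + \<epsilon> *\<^sub>R \<eta> \<in> U" using \<rho>(2) s by blast
  qed
qed

text \<open>If no part of the curve can be outrun, pushing the part between \<open>s1\<close> and \<open>s2\<close> in the direction
  \<open>e\<close>, along short linear ramps at both ends, does not shorten it.  In the limit of short ramps this
  bounds the change of momentum by the force.\<close>

lemma momentum_le:
  assumes min: "\<And>u v \<tau>. a \<le> u \<Longrightarrow> u < v \<Longrightarrow> v \<le> b \<Longrightarrow> \<tau> < flength u v \<Longrightarrow> \<not> reaches (c u) \<tau> (c v)"
    and s: "a \<le> s1" "s1 < s2" "s2 \<le> b" and sp: "speed s1 > 0" "speed s2 > 0"
  shows "momentum s2 e - momentum s1 e \<le> integral {s1..s2} (\<lambda>s. force s e)"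
proof (rule field_le_epsilon)
  fix k0 :: real assume k0: "k0 > 0"
  define k where "k = k0 / 3"
  have k: "k > 0" using k0 by (simp add: k_def)
  obtain C where C: "C > 0" "\<And>s. s \<in> {a..b} \<Longrightarrow> \<bar>force s e\<bar> \<le> C" by (rule force_bound[of e]) blast
  have near: "\<exists>\<delta>>0. \<forall>t\<in>{a..b}. \<bar>t - s\<bar> < \<delta> \<longrightarrow> speed t > 0 \<and> \<bar>momentum t e - momentum s e\<bar> \<le> k"
    if s: "s \<in> {a..b}" "speed s > 0" for s
  proof -
    have l: "(speed \<longlongrightarrow> speed s) (at s within {a..b})"
      "(w \<longlongrightarrow> w s) (at s within {a..b})"
      "((\<lambda>s. \<theta> d (x s) i) \<longlongrightarrow> \<theta> d (x s) i) (at s within {a..b})"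
      "((\<lambda>s. hmat d (x s) i j) \<longlongrightarrow> hmat d (x s) i j) (at s within {a..b})" for i j
      using continuous_on_speed continuous_on_w continuous_on_\<theta>_x continuous_on_hmat_x s
      by (auto simp: continuous_on_def)
    have "((\<lambda>s. momentum s e) \<longlongrightarrow> momentum s e) (at s within {a..b})"
      unfolding momentum_def lform_def bilin_def using s by (intro tendsto_intros l) auto
    then have "\<forall>\<^sub>F t in at s within {a..b}. dist (momentum t e) (momentum s e) < k"
      using k by (simp add: tendsto_iff)
    with order_tendstoD(1)[OF l(1) s(2)]
    have "\<forall>\<^sub>F t in at s within {a..b}. speed t > 0 \<and> \<bar>momentum t e - momentum s e\<bar> \<le> k"
      by eventually_elim (simp add: dist_real_def)
    then obtain \<delta> where "\<delta> > 0" "\<forall>t\<in>{a..b}. t \<noteq> s \<and> dist t s < \<delta> \<longrightarrow> speed t > 0 \<and> \<bar>momentum t e - momentum s e\<bar> \<le> k"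
      unfolding eventually_at by blast
    moreover have "speed s > 0 \<and> \<bar>momentum s e - momentum s e\<bar> \<le> k" using s k by simp
    ultimately show ?thesis unfolding dist_real_def by metis
  qed
  obtain \<delta>1 where \<delta>1: "\<delta>1 > 0" "\<And>t. t \<in> {a..b} \<Longrightarrow> \<bar>t - s1\<bar> < \<delta>1 \<Longrightarrow> speed t > 0 \<and> \<bar>momentum t e - momentum s1 e\<bar> \<le> k"
    using near[of s1] s sp by auto
  obtain \<delta>2 where \<delta>2: "\<delta>2 > 0" "\<And>t. t \<in> {a..b} \<Longrightarrow> \<bar>t - s2\<bar> < \<delta>2 \<Longrightarrow> speed t > 0 \<and> \<bar>momentum t e - momentum s2 e\<bar> \<le> k"
    using near[of s2] s sp by auto
  \<comment> \<open>Ramps of length \<open>\<delta>\<close>: on them the speed is positive and the momentum varies by at most \<open>k\<close>, and the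
    integrals of the force over the ramps add up to at most \<open>k\<close>.\<close>
  define \<delta> where "\<delta> = min (min (\<delta>1 / 2) (\<delta>2 / 2)) (min ((s2 - s1) / 3) (k / (4 * C)))"
  have \<delta>: "\<delta> > 0" "\<delta> < \<delta>1" "\<delta> < \<delta>2" "2 * \<delta> < s2 - s1" "\<delta> \<le> k / (4 * C)"
    using \<delta>1(1) \<delta>2(1) s k C(1) by (auto simp: \<delta>_def min_def)
  have \<delta>C: "4 * (\<delta> * C) \<le> k" using \<delta>(5) C(1) by (simp add: field_simps)
  obtain r where r: "r > 0" "\<And>\<epsilon> s \<eta>. \<epsilon> \<in> {0..r} \<Longrightarrow> s \<in> {a..b} \<Longrightarrow> norm \<eta> \<le> norm e \<Longrightarrow> x s + \<epsilon> *\<^sub>R \<eta> \<in> U"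
    by (rule variation_room[of "norm e"]) blast
  let ?t1 = "s1 + \<delta>" and ?t2 = "s2 - \<delta>"
  define \<kappa> where "\<kappa> = (1 / \<delta>) *\<^sub>R e"
  define p1 where "p1 = (- s1 / \<delta>) *\<^sub>R e"
  define p3 where "p3 = (s2 / \<delta>) *\<^sub>R e"
  have ramp1: "p1 + s *\<^sub>R \<kappa> = ((s - s1) / \<delta>) *\<^sub>R e" for s
    by (simp add: p1_def \<kappa>_def diff_divide_distrib scaleR_left_diff_distrib)
  have ramp3: "p3 + s *\<^sub>R (- \<kappa>) = ((s2 - s) / \<delta>) *\<^sub>R e" for s
    by (simp add: p3_def \<kappa>_def diff_divide_distrib scaleR_left_diff_distrib)
  have short: "norm (q *\<^sub>R e) \<le> norm e" if "0 \<le> q" "q \<le> 1" for q :: real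
    using that by (simp add: mult_left_le_one_le)
  have frac1: "0 \<le> (s - s1) / \<delta>" "(s - s1) / \<delta> \<le> 1" if "s \<in> {s1..?t1}" for s using that \<delta> by auto
  have frac3: "0 \<le> (s2 - s) / \<delta>" "(s2 - s) / \<delta> \<le> 1" if "s \<in> {?t2..s2}" for s using that \<delta> by auto
  obtain J1 where J1:
    "(J1 has_real_derivative integral {s1..?t1} (\<lambda>s. force s (p1 + s *\<^sub>R \<kappa>) + momentum s \<kappa>)) (at 0 within {0..r})"
    "J1 0 = flength s1 ?t1"
    "\<And>\<epsilon> \<tau>. \<epsilon> \<in> {0..r} \<Longrightarrow> J1 \<epsilon> < \<tau> \<Longrightarrow>
       reaches (chart_inv d (x s1 + \<epsilon> *\<^sub>R (p1 + s1 *\<^sub>R \<kappa>))) \<tau> (chart_inv d (x ?t1 + \<epsilon> *\<^sub>R (p1 + ?t1 *\<^sub>R \<kappa>)))"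
  proof (rule segment_variation[of s1 ?t1 r p1 \<kappa>])
    show "x s + \<epsilon> *\<^sub>R (p1 + s *\<^sub>R \<kappa>) \<in> U" if "\<epsilon> \<in> {0..r}" "s \<in> {s1..?t1}" for \<epsilon> s
      unfolding ramp1 using that s \<delta> by (intro r(2) short frac1) auto
    show "(\<forall>t\<in>{s1..?t1}. speed t > 0) \<or> \<kappa> = 0" using \<delta>1(2) \<delta> s by auto
  qed (use s \<delta> r in auto)
  obtain J2 where J2:
    "(J2 has_real_derivative integral {?t1..?t2} (\<lambda>s. force s (e + s *\<^sub>R 0) + momentum s 0)) (at 0 within {0..r})"
    "J2 0 = flength ?t1 ?t2"
    "\<And>\<epsilon> \<tau>. \<epsilon> \<in> {0..r} \<Longrightarrow> J2 \<epsilon> < \<tau> \<Longrightarrow>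
       reaches (chart_inv d (x ?t1 + \<epsilon> *\<^sub>R (e + ?t1 *\<^sub>R 0))) \<tau> (chart_inv d (x ?t2 + \<epsilon> *\<^sub>R (e + ?t2 *\<^sub>R 0)))"
  proof (rule segment_variation[of ?t1 ?t2 r e 0])
    show "x s + \<epsilon> *\<^sub>R (e + s *\<^sub>R 0) \<in> U" if "\<epsilon> \<in> {0..r}" "s \<in> {?t1..?t2}" for \<epsilon> s
      using that s \<delta> by (intro r(2)) auto
  qed (use s \<delta> r in auto)
  obtain J3 where J3:
    "(J3 has_real_derivative integral {?t2..s2} (\<lambda>s. force s (p3 + s *\<^sub>R (- \<kappa>)) + momentum s (- \<kappa>))) (at 0 within {0..r})"
    "J3 0 = flength ?t2 s2"
    "\<And>\<epsilon> \<tau>. \<epsilon> \<in> {0..r} \<Longrightarrow> J3 \<epsilon> < \<tau> \<Longrightarrow>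
       reaches (chart_inv d (x ?t2 + \<epsilon> *\<^sub>R (p3 + ?t2 *\<^sub>R (- \<kappa>)))) \<tau> (chart_inv d (x s2 + \<epsilon> *\<^sub>R (p3 + s2 *\<^sub>R (- \<kappa>))))"
  proof (rule segment_variation[of ?t2 s2 r p3 "- \<kappa>"])
    show "x s + \<epsilon> *\<^sub>R (p3 + s *\<^sub>R (- \<kappa>)) \<in> U" if "\<epsilon> \<in> {0..r}" "s \<in> {?t2..s2}" for \<epsilon> s
      unfolding ramp3 using that s \<delta> by (intro r(2) short frac3) auto
    show "(\<forall>t\<in>{?t2..s2}. speed t > 0) \<or> - \<kappa> = 0" using \<delta>2(2) \<delta> s by auto
  qed (use s \<delta> r in auto)
  let ?T1 = "integral {s1..?t1} (\<lambda>s. force s (p1 + s *\<^sub>R \<kappa>) + momentum s \<kappa>)"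
  let ?T2 = "integral {?t1..?t2} (\<lambda>s. force s (e + s *\<^sub>R 0) + momentum s 0)"
  let ?T3 = "integral {?t2..s2} (\<lambda>s. force s (p3 + s *\<^sub>R (- \<kappa>)) + momentum s (- \<kappa>))"
  define J where "J \<epsilon> = J1 \<epsilon> + J2 \<epsilon> + J3 \<epsilon>" for \<epsilon>
  have fint: "(\<lambda>s. F (c s) (velocity A {a..b} c s)) integrable_on {u..v}" if "a \<le> u" "v \<le> b" for u v
    by (rule integrable_continuous_real[OF continuous_on_subset[OF continuous_on_fermat_velocity[OF c I]]]) (use that in auto)
  have J0: "J 0 = flength s1 s2"
  proof -
    have "flength s1 ?t1 + flength ?t1 ?t2 = flength s1 ?t2"
      by (rule hk_integral_combine) (use s \<delta> fint in auto)
    moreover have "flength s1 ?t2 + flength ?t2 s2 = flength s1 s2"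
      by (rule hk_integral_combine) (use s \<delta> fint in auto)
    ultimately show ?thesis by (simp add: J_def J1(2) J2(2) J3(2))
  qed
  \<comment> \<open>Otherwise a small push would give a travel that is faster than the curve itself.\<close>
  have T: "?T1 + ?T2 + ?T3 \<ge> 0"
  proof (rule ccontr)
    assume "\<not> ?thesis"
    then have neg: "?T1 + ?T2 + ?T3 < 0" by (simp only: not_le)
    have der: "(J has_real_derivative ?T1 + ?T2 + ?T3) (at 0 within {0..r})"
      unfolding J_def[abs_def] by (intro DERIV_add J1(1) J2(1) J3(1))
    obtain D where D: "D > 0" "\<And>q. q > 0 \<Longrightarrow> 0 + q \<in> {0..r} \<Longrightarrow> q < D \<Longrightarrow> J (0 + q) < J 0"
      using has_real_derivative_neg_dec_right[OF der neg] by blast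
    define \<epsilon> where "\<epsilon> = min (D / 2) r"
    have \<epsilon>: "\<epsilon> \<in> {0..r}" "\<epsilon> > 0" "\<epsilon> < D" using D(1) r(1) by (auto simp: \<epsilon>_def min_def)
    have less: "J \<epsilon> < J 0" using D(2)[of \<epsilon>] \<epsilon> by simp
    define \<gamma> where "\<gamma> = (J 0 - J \<epsilon>) / 4"
    have \<gamma>: "\<gamma> > 0" using less by (simp add: \<gamma>_def)
    have xc: "chart_inv d (x s) = c s" if "s \<in> {a..b}" for s
      using chart_inv_map[OF d c_in_dom[OF that]] by (simp add: x_def)
    have "p1 + s1 *\<^sub>R \<kappa> = 0" "p1 + ?t1 *\<^sub>R \<kappa> = e" "p3 + ?t2 *\<^sub>R (- \<kappa>) = e" "p3 + s2 *\<^sub>R (- \<kappa>) = 0"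
      unfolding ramp1 ramp3 using \<delta> by simp_all
    then have "reaches (c s1) (J1 \<epsilon> + \<gamma>) (chart_inv d (x ?t1 + \<epsilon> *\<^sub>R e))"
      "reaches (chart_inv d (x ?t1 + \<epsilon> *\<^sub>R e)) (J2 \<epsilon> + \<gamma>) (chart_inv d (x ?t2 + \<epsilon> *\<^sub>R e))"
      "reaches (chart_inv d (x ?t2 + \<epsilon> *\<^sub>R e)) (J3 \<epsilon> + \<gamma>) (c s2)"
      using J1(3)[OF \<epsilon>(1), of "J1 \<epsilon> + \<gamma>"] J2(3)[OF \<epsilon>(1), of "J2 \<epsilon> + \<gamma>"] J3(3)[OF \<epsilon>(1), of "J3 \<epsilon> + \<gamma>"]
        \<gamma> xc[of s1] xc[of s2] s by simp_all
    from reaches_trans[OF reaches_trans[OF this(1,2)] this(3)]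
    have "reaches (c s1) (J1 \<epsilon> + \<gamma> + (J2 \<epsilon> + \<gamma>) + (J3 \<epsilon> + \<gamma>)) (c s2)" .
    moreover have "J1 \<epsilon> + \<gamma> + (J2 \<epsilon> + \<gamma>) + (J3 \<epsilon> + \<gamma>) < flength s1 s2"
      using less J0 unfolding J_def \<gamma>_def by argo
    ultimately show False using min[of s1 s2] s by blast
  qed
  have lf: "force t (q *\<^sub>R e) = q * force t e" if "t \<in> {a..b}" for t q
    using linear_scale[OF linear_force[OF that]] by simp
  have le: "q * force t e \<le> C" if "t \<in> {a..b}" "0 \<le> q" "q \<le> 1" for t q
  proof -
    have "q * force t e \<le> q * C" using C(2)[OF that(1)] that by (intro mult_left_mono) auto
    also have "\<dots> \<le> 1 * C" using that C(1) by (intro mult_right_mono) auto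
    finally show ?thesis by simp
  qed
  have sub1: "{s1..?t1} \<subseteq> {a..b}" and sub3: "{?t2..s2} \<subseteq> {a..b}" using s \<delta> by auto
  have run1: "speed t \<noteq> 0" if "t \<in> {s1..?t1}" for t
  proof -
    have "\<bar>t - s1\<bar> < \<delta>1" using that \<delta> by auto
    then show ?thesis using \<delta>1(2)[of t] that sub1 by auto
  qed
  have run3: "speed t \<noteq> 0" if "t \<in> {?t2..s2}" for t
  proof -
    have "\<bar>t - s2\<bar> < \<delta>2" using that \<delta> by auto
    then show ?thesis using \<delta>2(2)[of t] that sub3 by auto
  qed
  have "?T1 \<le> integral {s1..?t1} (\<lambda>_. C + (momentum s1 e + k) / \<delta>)"
  proof (rule integral_le)
    have "continuous_on {s1..?t1} (\<lambda>s. ((s - s1) / \<delta>) * force s e + momentum s \<kappa>)"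
      by (intro continuous_intros continuous_on_subset[OF continuous_on_force sub1] continuous_momentum[OF sub1 run1])
        (use \<delta> in auto)
    then have "continuous_on {s1..?t1} (\<lambda>s. force s (p1 + s *\<^sub>R \<kappa>) + momentum s \<kappa>)"
      by (rule continuous_on_eq) (use lf s \<delta> in \<open>simp add: ramp1\<close>)
    then show "(\<lambda>s. force s (p1 + s *\<^sub>R \<kappa>) + momentum s \<kappa>) integrable_on {s1..?t1}" by (rule integrable_continuous_real)
    fix t assume t: "t \<in> {s1..?t1}"
    then have tab: "t \<in> {a..b}" using s \<delta> by auto
    have "\<bar>t - s1\<bar> < \<delta>1" using t \<delta> by auto
    then have "momentum t e \<le> momentum s1 e + k" using \<delta>1(2)[OF tab] by linarith
    then have "momentum t \<kappa> \<le> (momentum s1 e + k) / \<delta>"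
      using \<delta>(1) by (simp add: \<kappa>_def momentum_linear divide_right_mono)
    moreover have "force t (p1 + t *\<^sub>R \<kappa>) \<le> C"
      unfolding ramp1 lf[OF tab] using le[OF tab frac1[OF t]] .
    ultimately show "force t (p1 + t *\<^sub>R \<kappa>) + momentum t \<kappa> \<le> C + (momentum s1 e + k) / \<delta>" by linarith
  qed (rule integrable_const_ivl)
  also have "\<dots> = \<delta> * C + momentum s1 e + k" using \<delta>(1) by (simp add: field_simps)
  finally have T1: "?T1 \<le> \<delta> * C + momentum s1 e + k" .
  have "?T3 \<le> integral {?t2..s2} (\<lambda>_. C + (k - momentum s2 e) / \<delta>)"
  proof (rule integral_le)
    have "continuous_on {?t2..s2} (\<lambda>s. ((s2 - s) / \<delta>) * force s e + momentum s (- \<kappa>))"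
      by (intro continuous_intros continuous_on_subset[OF continuous_on_force sub3] continuous_momentum[OF sub3 run3])
        (use \<delta> in auto)
    then have "continuous_on {?t2..s2} (\<lambda>s. force s (p3 + s *\<^sub>R (- \<kappa>)) + momentum s (- \<kappa>))"
      by (rule continuous_on_eq) (use lf s \<delta> in \<open>simp add: ramp3 del: scaleR_minus_right\<close>)
    then show "(\<lambda>s. force s (p3 + s *\<^sub>R (- \<kappa>)) + momentum s (- \<kappa>)) integrable_on {?t2..s2}" by (rule integrable_continuous_real)
    fix t assume t: "t \<in> {?t2..s2}"
    then have tab: "t \<in> {a..b}" using s \<delta> by auto
    have "momentum t (- \<kappa>) = - (momentum t e) / \<delta>" by (simp add: \<kappa>_def momentum_linear)
    also have "\<dots> \<le> (k - momentum s2 e) / \<delta>"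
    proof (rule divide_right_mono)
      have "\<bar>t - s2\<bar> < \<delta>2" using t \<delta> by auto
      then show "- momentum t e \<le> k - momentum s2 e" using \<delta>2(2)[OF tab] by linarith
    qed (use \<delta> in simp)
    finally have "momentum t (- \<kappa>) \<le> (k - momentum s2 e) / \<delta>" .
    moreover have "force t (p3 + t *\<^sub>R (- \<kappa>)) \<le> C"
      unfolding ramp3 lf[OF tab] using le[OF tab frac3[OF t]] .
    ultimately show "force t (p3 + t *\<^sub>R (- \<kappa>)) + momentum t (- \<kappa>) \<le> C + (k - momentum s2 e) / \<delta>" by linarith
  qed (rule integrable_const_ivl)
  also have "\<dots> = \<delta> * C - momentum s2 e + k" using \<delta>(1) by (simp add: field_simps)
  finally have T3: "?T3 \<le> \<delta> * C - momentum s2 e + k" .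
  have gint: "(\<lambda>s. force s e) integrable_on {u..v}" if "a \<le> u" "v \<le> b" for u v
    by (rule integrable_continuous_real[OF continuous_on_subset[OF continuous_on_force]]) (use that in auto)
  have small: "integral {u..v} (\<lambda>s. force s e) \<ge> - ((v - u) * C)" if "a \<le> u" "u \<le> v" "v \<le> b" for u v
  proof -
    have "integral {u..v} (\<lambda>s. - C) \<le> integral {u..v} (\<lambda>s. force s e)"
    proof (rule integral_le)
      show "- C \<le> force t e" if "t \<in> {u..v}" for t
        using C(2)[of t] that \<open>a \<le> u\<close> \<open>v \<le> b\<close> by (auto simp: abs_le_iff)
    qed (use gint that in \<open>simp_all add: integrable_const_ivl\<close>)
    then show ?thesis using that by simp
  qed
  have "integral {s1..?t1} (\<lambda>s. force s e) + integral {?t1..?t2} (\<lambda>s. force s e) = integral {s1..?t2} (\<lambda>s. force s e)"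
    by (rule hk_integral_combine) (use s \<delta> gint in auto)
  moreover have "integral {s1..?t2} (\<lambda>s. force s e) + integral {?t2..s2} (\<lambda>s. force s e) = integral {s1..s2} (\<lambda>s. force s e)"
    by (rule hk_integral_combine) (use s \<delta> gint in auto)
  moreover have "integral {s1..?t1} (\<lambda>s. force s e) \<ge> - (\<delta> * C)" "integral {?t2..s2} (\<lambda>s. force s e) \<ge> - (\<delta> * C)"
    using small[of s1 ?t1] small[of ?t2 s2] s \<delta> by simp_all
  moreover have "?T2 = integral {?t1..?t2} (\<lambda>s. force s e)" by (simp add: momentum_linear)
  ultimately show "momentum s2 e - momentum s1 e \<le> integral {s1..s2} (\<lambda>s. force s e) + k0"
    using T T1 T3 \<delta>C unfolding k_def by linarith
qed

text \<open>The inequality for \<open>e\<close> and for \<open>- e\<close>.\<close>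

lemma euler_lagrange:
  assumes min: "\<And>u v \<tau>. a \<le> u \<Longrightarrow> u < v \<Longrightarrow> v \<le> b \<Longrightarrow> \<tau> < flength u v \<Longrightarrow> \<not> reaches (c u) \<tau> (c v)"
    and s: "a \<le> s1" "s1 < s2" "s2 \<le> b" and sp: "speed s1 > 0" "speed s2 > 0"
  shows "momentum s2 e - momentum s1 e = integral {s1..s2} (\<lambda>s. force s e)"
proof (rule antisym)
  show "momentum s2 e - momentum s1 e \<le> integral {s1..s2} (\<lambda>s. force s e)"
    by (rule momentum_le[OF min s sp])
  have "integral {s1..s2} (\<lambda>s. force s (- e)) = integral {s1..s2} (\<lambda>s. - force s e)"
    using linear_neg[OF linear_force] s by (intro hk_integral_cong) auto
  then show "integral {s1..s2} (\<lambda>s. force s e) \<le> momentum s2 e - momentum s1 e"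
    using momentum_le[OF min s sp, of "- e"] by (simp add: momentum_linear)
qed

end

section \<open>Regularity of curves that cannot be outrun\<close>

context chart_curve
begin

text \<open>The inverse Legendre transformation at unit speed: the momentum is \<open>\<theta> + h(v, _)\<close>.\<close>

definition legendre_inv :: "'e \<Rightarrow> 'e \<Rightarrow> 'e" where
  "legendre_inv y \<pi> = (SOME v. \<forall>i\<in>Basis. bilin (hmat d y) i v = \<pi> \<bullet> i - \<theta> d y i)"

text \<open>The force per unit of speed: \<open>force\<close> is the speed times \<open>unit_force\<close> for the normalized velocity.\<close>

definition unit_force :: "'e \<Rightarrow> 'e \<Rightarrow> 'e \<Rightarrow> real" where
  "unit_force y v e = (\<Sum>i\<in>Basis. frechet_derivative (\<lambda>y. \<theta> d y i) (at y within U) e * (v \<bullet> i))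
     + (\<Sum>i\<in>Basis. \<Sum>k\<in>Basis. frechet_derivative (\<lambda>y. hmat d y i k) (at y within U) e * ((v \<bullet> i) * (v \<bullet> k))) / 2"

text \<open>The geodesic equations of \<open>F\<close> in position \<open>y\<close> and momentum \<open>\<pi>\<close>, with time parameter the arc length of
  \<open>h\<close>.  The first component is the arrival time, as \<open>F(v) = \<theta>(v) + 1\<close> for \<open>v\<close> of \<open>h\<close>-length \<open>1\<close>.\<close>

definition geodesic_field :: "real \<times> 'e \<times> 'e \<Rightarrow> real \<times> 'e \<times> 'e" where
  "geodesic_field z = (case z of (t, y, \<pi>) \<Rightarrow> let v = legendre_inv y \<pi> in
     (lform (\<theta> d y) v + 1, v, \<Sum>i\<in>Basis. unit_force y v i *\<^sub>R i))"

lemma legendre_inv: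
  assumes y: "y \<in> U" and i: "i \<in> Basis"
  shows "bilin (hmat d y) i (legendre_inv y \<pi>) = \<pi> \<bullet> i - \<theta> d y i"
proof -
  have "\<exists>v. \<forall>i\<in>Basis. bilin (hmat d y) i v = (\<pi> - (\<Sum>k\<in>Basis. \<theta> d y k *\<^sub>R k)) \<bullet> i"
    by (rule pos_def_solvable[OF hmat_pos[OF d y]])
  moreover have "(\<pi> - (\<Sum>k\<in>Basis. \<theta> d y k *\<^sub>R k)) \<bullet> i = \<pi> \<bullet> i - \<theta> d y i" if "i \<in> Basis" for i
    using that by (simp add: inner_diff_left inner_sum_left inner_Basis if_distrib cong: if_cong)
  ultimately have "\<exists>v. \<forall>i\<in>Basis. bilin (hmat d y) i v = \<pi> \<bullet> i - \<theta> d y i" by simp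
  then have "\<forall>i\<in>Basis. bilin (hmat d y) i (legendre_inv y \<pi>) = \<pi> \<bullet> i - \<theta> d y i"
    unfolding legendre_inv_def by (rule someI_ex)
  then show ?thesis using i by blast
qed

lemma legendre_inv_unique:
  assumes y: "y \<in> U" and v: "\<And>i. i \<in> Basis \<Longrightarrow> bilin (hmat d y) i v = \<pi> \<bullet> i - \<theta> d y i"
  shows "legendre_inv y \<pi> = v"
proof (rule ccontr)
  let ?u = "legendre_inv y \<pi> - v"
  assume "legendre_inv y \<pi> \<noteq> v"
  then have "bilin (hmat d y) ?u ?u > 0" by (intro hmat_pos[OF d y]) simp
  moreover have "bilin (hmat d y) i ?u = 0" if "i \<in> Basis" for i
    using bilin_linear(2)[of "hmat d y" i "legendre_inv y \<pi>" "- v"] legendre_inv[OF y that] v[OF that]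
    by (simp add: bilin_linear)
  then have "bilin (hmat d y) ?u ?u = 0"
    by (simp add: bilin_eq_sum_left[of _ ?u] bilin_basis)
  ultimately show False by simp
qed

lemma hd_on_legendre_inv:
  fixes T :: "real set"
  assumes T: "derivative_unique_on T" and y: "hd_on T y n" and \<pi>: "hd_on T \<pi> n" and yU: "y ` T \<subseteq> U"
  shows "hd_on T (\<lambda>t. legendre_inv (y t) (\<pi> t)) n"
proof (rule hd_on_pos_def_solution[OF T, where a = "\<lambda>t. hmat d (y t)"
      and r = "\<lambda>t. \<pi> t - (\<Sum>k\<in>Basis. \<theta> d (y t) k *\<^sub>R k)"])
  have U: "derivative_unique_on U" by (rule derivative_unique_on_open[OF open_U])
  show "bilin (hmat d (y t)) v v > 0" if "t \<in> T" "v \<noteq> 0" for t v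
    using that yU by (intro hmat_pos[OF d]) auto
  show "hd_on T (\<lambda>t. hmat d (y t) i k) n" for i k
    by (rule hd_on_compose[OF T U yU hd_on_hmat[OF d] y])
  show "hd_on T (\<lambda>t. \<pi> t - (\<Sum>k\<in>Basis. \<theta> d (y t) k *\<^sub>R k)) n"
    by (intro hd_on_diff hd_on_sum hd_on_scaleR hd_on_const T \<pi> hd_on_compose[OF T U yU hd_on_\<theta>[OF d] y]) auto
  show "bilin (hmat d (y t)) i (legendre_inv (y t) (\<pi> t)) = (\<pi> t - (\<Sum>k\<in>Basis. \<theta> d (y t) k *\<^sub>R k)) \<bullet> i"
    if "t \<in> T" "i \<in> Basis" for t i
  proof -
    have "y t \<in> U" using that yU by blast
    from legendre_inv[OF this that(2), of "\<pi> t"] that(2) show ?thesis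
      by (simp add: inner_diff_left inner_sum_left inner_Basis if_distrib cong: if_cong)
  qed
qed

lemma hd_on_unit_force:
  fixes T :: "real set"
  assumes T: "derivative_unique_on T" and y: "hd_on T y n" and v: "hd_on T v n" and yU: "y ` T \<subseteq> U"
  shows "hd_on T (\<lambda>t. unit_force (y t) (v t) e) n"
proof -
  have U: "derivative_unique_on U" by (rule derivative_unique_on_open[OF open_U])
  have D: "hd_on T (\<lambda>t. frechet_derivative \<Phi> (at (y t) within U) e) n" if "hd_on U \<Phi> (Suc n)" for \<Phi> :: "'e \<Rightarrow> real"
    by (rule hd_on_compose[OF T U yU _ y]) (use that in simp)
  have half: "hd_on T (\<lambda>t. f t / 2) n" if "hd_on T f n" for f :: "real \<Rightarrow> real"
    using hd_on_bounded_linear[OF T bounded_linear_divide that] .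
  show ?thesis
    unfolding unit_force_def
    by (intro hd_on_add half hd_on_sum hd_on_mult D[OF hd_on_\<theta>[OF d]] D[OF hd_on_hmat[OF d]] T hd_on_inner_left v finite_Basis)
qed

text \<open>Along a curve no part of which can be outrun, momentum and velocity at positive speed are
  related by the unit speed equations with the same integration constant, also across the rests of the
  curve.  So the curve is, up to parametrization, a solution of an equation with smooth right hand side,
  and its unit speed parametrization is smooth.\<close>

lemma reaches_if_not_outrun:
  assumes min: "\<And>u v \<tau>. a \<le> u \<Longrightarrow> u < v \<Longrightarrow> v \<le> b \<Longrightarrow> \<tau> < flength u v \<Longrightarrow> \<not> reaches (c u) \<tau> (c v)"
    and s0: "s0 \<in> {a..b}" "speed s0 > 0"
  shows "reaches (c a) (flength a b) (c b)"
proof -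
  let ?P = "\<lambda>s i. integral {a..s} (\<lambda>t. force t i)"
  define \<psi> where "\<psi> s = (\<Sum>i\<in>Basis. (momentum s0 i - ?P s0 i + ?P s i) *\<^sub>R i)" for s
  have \<psi>i: "\<psi> s \<bullet> i = momentum s0 i - ?P s0 i + ?P s i" if "i \<in> Basis" for s i
    using that by (simp add: \<psi>_def inner_sum_left inner_Basis if_distrib cong: if_cong)
  have gint: "(\<lambda>s. force s i) integrable_on {u..v}" if "a \<le> u" "v \<le> b" for u v i
    by (rule integrable_continuous_real[OF continuous_on_subset[OF continuous_on_force]]) (use that in auto)
  have Pdiff: "?P v i - ?P u i = integral {u..v} (\<lambda>t. force t i)" if "a \<le> u" "u \<le> v" "v \<le> b" for u v i
    using hk_integral_combine[of a u v "\<lambda>t. force t i"] gint that by simp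
  have mom: "momentum s i = \<psi> s \<bullet> i" if s: "s \<in> {a..b}" "speed s > 0" and i: "i \<in> Basis" for s i
  proof -
    consider "s < s0" | "s = s0" | "s0 < s" by linarith
    then show ?thesis
    proof cases
      case 1
      then show ?thesis using euler_lagrange[OF min, of s s0 i] Pdiff[of s s0 i] s s0 \<psi>i[OF i, of s] by simp
    next
      case 2
      then show ?thesis using \<psi>i[OF i, of s] by simp
    next
      case 3
      then show ?thesis using euler_lagrange[OF min, of s0 s i] Pdiff[of s0 s i] s s0 \<psi>i[OF i, of s] by simp
    qed
  qed
  define V where "V s = legendre_inv (x s) (\<psi> s)" for s
  have V_run: "V s = w s /\<^sub>R speed s" if s: "s \<in> {a..b}" "speed s > 0" for s
    unfolding V_def
  proof (rule legendre_inv_unique[OF x_in_U[OF s(1)]])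
    fix i :: 'e assume i: "i \<in> Basis"
    have "lform (\<theta> d (x s)) i = \<theta> d (x s) i"
      using i by (simp add: lform_def inner_Basis if_distrib cong: if_cong)
    then show "bilin (hmat d (x s)) i (w s /\<^sub>R speed s) = \<psi> s \<bullet> i - \<theta> d (x s) i"
      using mom[OF s i] by (simp add: momentum_def bilin_linear divide_inverse mult.commute)
  qed
  have w_eq: "w s = speed s *\<^sub>R V s" if "s \<in> {a..b}" for s
  proof (cases "speed s = 0")
    case True
    then show ?thesis using speed_0_iff[OF that] by simp
  next
    case False
    then have "speed s > 0" using speed_nonneg[OF that] by simp
    then show ?thesis using V_run[OF that] by simp
  qed
  have force_eq: "force s e = speed s * unit_force (x s) (V s) e" if s: "s \<in> {a..b}" for s e
  proof -
    have "quad i k s = speed s * ((V s \<bullet> i) * (V s \<bullet> k))" for i k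
      by (simp add: quad_def w_eq[OF s])
    then show ?thesis
      by (simp add: force_def unit_force_def w_eq[OF s] distrib_left sum_distrib_left ac_simps)
  qed
  have d\<psi>: "(\<psi> has_vector_derivative (\<Sum>i\<in>Basis. force s i *\<^sub>R i)) (at s within {a..b})" if s: "s \<in> {a..b}" for s
    unfolding \<psi>_def[abs_def]
  proof (intro has_vector_derivative_sum)
    fix i :: 'e
    have "((\<lambda>s. ?P s i) has_vector_derivative force s i) (at s within {a..b})"
      by (rule integral_has_vector_derivative[OF continuous_on_force s])
    then have "((\<lambda>s. momentum s0 i - ?P s0 i + ?P s i) has_vector_derivative force s i) (at s within {a..b})"
      using has_vector_derivative_add[OF has_vector_derivative_const] by fastforce
    then show "((\<lambda>s. (momentum s0 i - ?P s0 i + ?P s i) *\<^sub>R i) has_vector_derivative force s i *\<^sub>R i) (at s within {a..b})"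
      by (rule bounded_linear.has_vector_derivative[OF bounded_linear_scaleR_left])
  qed
  have \<psi>c: "continuous_on {a..b} \<psi>"
    using has_vector_derivative_continuous[OF d\<psi>] by (simp add: continuous_on_eq_continuous_within)
  have xU: "x ` {a..b} \<subseteq> U" using x_in_U by blast
  have Vc: "continuous_on {a..b} V"
    using hd_on_legendre_inv[OF I hd_on_x[of 0] _ xU, of \<psi>] \<psi>c by (simp add: V_def[abs_def])
  define E where "E s = bilin (hmat d (x s)) (V s) (V s)" for s
  have Ec: "continuous_on {a..b} E"
    unfolding E_def bilin_def by (intro continuous_intros continuous_on_hmat_x Vc)
  have E_run: "E s = 1" if s: "s \<in> {a..b}" "speed s > 0" for s
    using s(2) by (simp add: E_def V_run[OF s] bilin_linear power2_eq_square field_simps flip: speed_square[OF s(1)])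
  \<comment> \<open>\<open>V\<close> has \<open>h\<close>-length \<open>1\<close> also while the curve rests, as position and momentum do not change then.\<close>
  have rest: "E u = E v" if uv: "a \<le> u" "u \<le> v" "v \<le> b" and 0: "\<And>s. s \<in> {u<..<v} \<Longrightarrow> speed s = 0" for u v
  proof -
    have zero: "h v = h u" if h: "\<And>s. s \<in> {a..b} \<Longrightarrow> (h has_vector_derivative speed s *\<^sub>R h' s) (at s within {a..b})"
      for h h' :: "real \<Rightarrow> 'e"
    proof -
      have "((\<lambda>s. speed s *\<^sub>R h' s) has_integral h v - h u) {u..v}"
        by (rule fundamental_theorem_of_calculus[OF uv(2)])
          (use uv in \<open>auto intro: has_vector_derivative_within_subset[OF h]\<close>)
      moreover have "((\<lambda>s. speed s *\<^sub>R h' s) has_integral 0) {u..v}"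
        by (rule has_integral_spike_finite[OF _ _ has_integral_0, of "{u, v}"]) (use 0 in auto)
      ultimately have "h v - h u = 0" by (rule has_integral_unique)
      then show ?thesis by simp
    qed
    have "x v = x u" by (rule zero[of x V]) (use has_vector_derivative_x w_eq in auto)
    moreover have "\<psi> v = \<psi> u"
      by (rule zero[of \<psi> "\<lambda>s. \<Sum>i\<in>Basis. unit_force (x s) (V s) i *\<^sub>R i"])
        (use d\<psi> force_eq in \<open>simp add: scaleR_sum_right\<close>)
    ultimately show ?thesis by (simp add: E_def V_def)
  qed
  have E1: "E s = 1" if s: "s \<in> {a..b}" for s
  proof -
    \<comment> \<open>On the way from \<open>s\<close> to the nearest parameter \<open>q\<close> with \<open>E q = 1\<close>, the curve rests.\<close>
    define K where "K = {q \<in> {a..b}. E q = 1} \<inter> closed_segment s s0"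
    have seg: "closed_segment s s0 \<subseteq> {a..b}" using s s0 by (auto simp: closed_segment_eq_real_ivl split: if_splits)
    have "closed {q \<in> {a..b}. E q = 1}"
      using continuous_closed_preimage_constant[OF Ec closed_atLeastAtMost, of 1] .
    then have "compact K" unfolding K_def by (intro closed_Int_compact compact_segment)
    moreover have "s0 \<in> K" using s0 E_run by (simp add: K_def)
    ultimately obtain q where q: "q \<in> K" "\<And>q'. q' \<in> K \<Longrightarrow> \<bar>q - s\<bar> \<le> \<bar>q' - s\<bar>"
      using continuous_attains_inf[of K "\<lambda>q. \<bar>q - s\<bar>"] by (force intro!: continuous_intros)
    have qab: "q \<in> {a..b}" "E q = 1" "q \<in> closed_segment s s0" using q(1) by (auto simp: K_def)
    have 0: "speed t = 0" if t: "t \<in> {min s q<..<max s q}" for t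
    proof (rule ccontr)
      assume "speed t \<noteq> 0"
      have "t \<in> closed_segment s s0" using t qab(3) by (auto simp: closed_segment_eq_real_ivl split: if_splits)
      moreover from this seg have tab: "t \<in> {a..b}" by blast
      moreover from this \<open>speed t \<noteq> 0\<close> have "E t = 1" using E_run speed_nonneg[of t] by simp
      ultimately have "t \<in> K" by (simp add: K_def)
      from q(2)[OF this] t show False by (auto split: if_splits)
    qed
    have "E (min s q) = E (max s q)" by (rule rest) (use s qab 0 in auto)
    then show ?thesis using qab(2) by (auto simp: min_def max_def split: if_splits)
  qed
  define y where "y s = (flength a s, x s, \<psi> s)" for s
  have field_y: "geodesic_field (y s) = (lform (\<theta> d (x s)) (V s) + 1, V s, \<Sum>i\<in>Basis. unit_force (x s) (V s) i *\<^sub>R i)" for s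
    by (simp add: geodesic_field_def y_def V_def Let_def)
  have dy: "(y has_vector_derivative speed s *\<^sub>R geodesic_field (y s)) (at s within {a..b})" if s: "s \<in> {a..b}" for s
  proof -
    have 1: "(flength a has_vector_derivative F (c s) (velocity A {a..b} c s)) (at s within {a..b})"
      by (rule integral_has_vector_derivative[OF continuous_on_fermat_velocity[OF c I] s])
    have "F (c s) (velocity A {a..b} c s) = speed s * (lform (\<theta> d (x s)) (V s) + 1)"
      by (simp add: fermat_x[OF s] w_eq[OF s] lform_linear distrib_left)
    moreover have "(\<Sum>i\<in>Basis. force s i *\<^sub>R i) = speed s *\<^sub>R (\<Sum>i\<in>Basis. unit_force (x s) (V s) i *\<^sub>R i)"
      by (simp add: force_eq[OF s] scaleR_sum_right)
    ultimately have "(F (c s) (velocity A {a..b} c s), w s, \<Sum>i\<in>Basis. force s i *\<^sub>R i) = speed s *\<^sub>R geodesic_field (y s)"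
      by (simp add: field_y w_eq[OF s])
    moreover have "(y has_vector_derivative (F (c s) (velocity A {a..b} c s), w s, \<Sum>i\<in>Basis. force s i *\<^sub>R i)) (at s within {a..b})"
      unfolding y_def[abs_def]
      by (intro has_vector_derivative_Pair 1 has_vector_derivative_x[OF s] d\<psi>[OF s])
    ultimately show ?thesis by simp
  qed
  have fc: "continuous_on {a..b} (\<lambda>s. geodesic_field (y s))"
  proof -
    have "continuous_on {a..b} (\<lambda>s. unit_force (x s) (V s) e)" for e
      using hd_on_unit_force[OF I hd_on_x[of 0] _ xU, of V e] Vc by simp
    then show ?thesis
      unfolding field_y lform_def by (intro continuous_intros continuous_on_\<theta>_x Vc)
  qed
  define L where "L = integral {a..b} speed"
  obtain z where z: "z 0 = y a" "z L = y b" "z ` {0..L} \<subseteq> y ` {a..b}"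
    "\<And>t. t \<in> {0..L} \<Longrightarrow> (z has_vector_derivative geodesic_field (z t)) (at t within {0..L})"
    unfolding L_def
    by (rule reparametrize_by_speed[OF less_imp_le[OF ab] continuous_on_speed speed_nonneg dy fc]) blast+
  have "L \<noteq> 0"
  proof
    assume "L = 0"
    then have "(speed has_integral 0) {a..b}"
      unfolding L_def using integrable_integral[OF integrable_continuous_real[OF continuous_on_speed]] by simp
    then have "speed s0 = 0"
      using has_integral_0_cbox_imp_0[of a b speed s0] continuous_on_speed speed_nonneg s0 ab by auto
    then show False using s0 by simp
  qed
  moreover have "L \<ge> 0" unfolding L_def
    by (rule integral_nonneg[OF integrable_continuous_real[OF continuous_on_speed] speed_nonneg])
  ultimately have L: "0 < L" by simp
  have T: "derivative_unique_on {0..L}" using L by (rule derivative_unique_on_Icc)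
  define t' x' \<pi>' where "t' t = fst (z t)" and "x' t = fst (snd (z t))" and "\<pi>' t = snd (snd (z t))" for t
  define v' where "v' t = legendre_inv (x' t) (\<pi>' t)" for t
  have field_z: "geodesic_field (z t) = (lform (\<theta> d (x' t)) (v' t) + 1, v' t, \<Sum>i\<in>Basis. unit_force (x' t) (v' t) i *\<^sub>R i)" for t
    by (simp add: geodesic_field_def t'_def x'_def \<pi>'_def v'_def Let_def split_beta)
  have dz: "(t' has_vector_derivative lform (\<theta> d (x' t)) (v' t) + 1) (at t within {0..L})"
    "(x' has_vector_derivative v' t) (at t within {0..L})"
    "(\<pi>' has_vector_derivative (\<Sum>i\<in>Basis. unit_force (x' t) (v' t) i *\<^sub>R i)) (at t within {0..L})"
    if "t \<in> {0..L}" for t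
    using z(4)[OF that]
      bounded_linear.has_vector_derivative[OF bounded_linear_fst z(4)[OF that]]
      bounded_linear.has_vector_derivative[OF bounded_linear_fst bounded_linear.has_vector_derivative[OF bounded_linear_snd z(4)[OF that]]]
      bounded_linear.has_vector_derivative[OF bounded_linear_snd bounded_linear.has_vector_derivative[OF bounded_linear_snd z(4)[OF that]]]
    by (simp_all add: field_z t'_def[abs_def] x'_def[abs_def] \<pi>'_def[abs_def])
  have x'U: "x' ` {0..L} \<subseteq> U" and unit': "\<And>t. t \<in> {0..L} \<Longrightarrow> bilin (hmat d (x' t)) (v' t) (v' t) = 1"
  proof -
    have *: "x' t \<in> U \<and> bilin (hmat d (x' t)) (v' t) (v' t) = 1" if t: "t \<in> {0..L}" for t
    proof -
      obtain s where s: "s \<in> {a..b}" "z t = y s" using z(3) t by blast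
      then have "x' t = x s" "v' t = V s" by (simp_all add: x'_def \<pi>'_def v'_def V_def y_def)
      then show ?thesis using E1[OF s(1)] x_in_U[OF s(1)] by (simp add: E_def)
    qed
    show "x' ` {0..L} \<subseteq> U" using * by blast
    show "bilin (hmat d (x' t)) (v' t) (v' t) = 1" if "t \<in> {0..L}" for t using * that by blast
  qed
  have smooth: "hd_on {0..L} x' n \<and> hd_on {0..L} \<pi>' n" for n
  proof (induction n)
    case 0
    show ?case using has_vector_derivative_continuous[OF dz(2)] has_vector_derivative_continuous[OF dz(3)]
      by (simp add: continuous_on_eq_continuous_within)
  next
    case (Suc n)
    then have v: "hd_on {0..L} v' n" unfolding v'_def[abs_def] by (intro hd_on_legendre_inv[OF T _ _ x'U]) auto
    have "hd_on {0..L} (\<lambda>t. \<Sum>i\<in>Basis. unit_force (x' t) (v' t) i *\<^sub>R i) n"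
      using Suc by (intro hd_on_sum hd_on_scaleR hd_on_const T hd_on_unit_force[OF T _ v x'U] finite_Basis) auto
    then show ?case using hd_on_real_SucI[OF T dz(2) v] hd_on_real_SucI[OF T dz(3)] by blast
  qed
  have v'n: "hd_on {0..L} v' n" for n
    unfolding v'_def[abs_def] using smooth[of n] by (intro hd_on_legendre_inv[OF T _ _ x'U]) auto
  have t'n: "hd_on {0..L} t' n" for n
  proof (rule hd_on_Suc_imp[OF hd_on_real_SucI[OF T dz(1)]])
    have "hd_on {0..L} (\<lambda>t. \<theta> d (x' t) i) n" for i
      using hd_on_compose[OF T derivative_unique_on_open[OF open_U] x'U hd_on_\<theta>[OF d]] smooth[of n] by blast
    then show "hd_on {0..L} (\<lambda>t. lform (\<theta> d (x' t)) (v' t) + 1) n"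
      unfolding lform_def by (intro hd_on_add hd_on_sum hd_on_mult hd_on_const hd_on_inner_left v'n T finite_Basis)
  qed
  define c' where "c' t = chart_inv d (x' t)" for t
  have xc': "chart_map d (c' t) = x' t" "c' t \<in> chart_dom d" if "t \<in> {0..L}" for t
  proof -
    have "x' t \<in> U" using that x'U by blast
    then show "chart_map d (c' t) = x' t" "c' t \<in> chart_dom d"
      using chart_inv_dom[of "x' t" d] by (simp_all add: c'_def f_inv_into_f)
  qed
  have c': "smooth_curve_on A {0..L} c'"
  proof (rule smooth_curve_onI[OF T d])
    show "c' ` {0..L} \<subseteq> chart_dom d" using xc' by auto
    show "hd_on {0..L} (chart_map d \<circ> c') k" for k
      using smooth[of k] xc' hd_on_cong[of "{0..L}" "chart_map d \<circ> c'" x' k] by simp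
  qed
  have vel: "velocity A {0..L} c' t d = v' t" if t: "t \<in> {0..L}" for t
  proof (rule velocity_eqI[where c = c', OF T t d xc'(2)[OF t]])
    show "(chart_map d \<circ> c' has_vector_derivative v' t) (at t within {0..L})"
      by (rule has_vector_derivative_transform[OF t _ dz(2)[OF t]]) (use xc' in auto)
  qed
  have F': "F (c' t) (velocity A {0..L} c' t) = lform (\<theta> d (x' t)) (v' t) + 1"
    "\<omega> (c' t) (velocity A {0..L} c' t) / \<beta> (c' t) = lform (\<theta> d (x' t)) (v' t)" if t: "t \<in> {0..L}" for t
    using fermat_chart[OF d xc'(2)[OF t] velocity_in_tangent_space[OF c' T t]]
      \<theta>_chart[OF d xc'(2)[OF t] velocity_in_tangent_space[OF c' T t]] unit'[OF t]
    by (simp_all add: xc'(1)[OF t] vel[OF t])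
  have "reaches (c' 0) (t' L - t' 0) (c' L)"
    by (rule reaches_lift[OF L c' t'n dz(1)]) (simp_all add: F')
  moreover have "c' 0 = c a" "c' L = c b" "t' L - t' 0 = flength a b"
    using ab by (simp_all add: c'_def x'_def t'_def z(1,2) y_def x_def d c_in_dom)
  ultimately show ?thesis by simp
qed

end

section \<open>Causality and closed curves\<close>

text \<open>If a part of the curve can be outrun, the time gained there pays for traversing the rest in slightly more
  than its Fermat length.  If not, the curve is a geodesic up to parametrization.\<close>

lemma (in chart_curve) constant_or_reaches:
  "((\<forall>s\<in>{a..b}. c s = c a) \<and> flength a b = 0) \<or> reaches (c a) (flength a b) (c b)"
proof (cases "\<exists>u v \<tau>. a \<le> u \<and> u < v \<and> v \<le> b \<and> \<tau> < flength u v \<and> reaches (c u) \<tau> (c v)")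
  case True
  then obtain u v \<tau> where uv: "a \<le> u" "u < v" "v \<le> b" and \<tau>: "\<tau> < flength u v" "reaches (c u) \<tau> (c v)" by blast
  define \<gamma> where "\<gamma> = (flength u v - \<tau>) / 2"
  have \<gamma>: "\<gamma> > 0" using \<tau> by (simp add: \<gamma>_def)
  have "reaches (c a) (flength a u + \<gamma>) (c u)" "reaches (c v) (flength v b + \<gamma>) (c b)"
    using uv \<gamma> by (auto intro!: reaches_if_longer_within[OF c _ _ _ ab])
  with \<tau>(2) have "reaches (c a) (flength a u + \<gamma> + \<tau> + (flength v b + \<gamma>)) (c b)"
    using reaches_trans by blast
  moreover have "flength a u + \<gamma> + \<tau> + (flength v b + \<gamma>) = flength a b"
  proof -
    have int: "(\<lambda>s. F (c s) (velocity A {a..b} c s)) integrable_on {p..q}" if "a \<le> p" "q \<le> b" for p q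
      by (rule integrable_continuous_real[OF continuous_on_subset[OF continuous_on_fermat_velocity[OF c I]]]) (use that in auto)
    have "flength a u + flength u v = flength a v"
      by (rule hk_integral_combine) (use uv int in auto)
    moreover have "flength a v + flength v b = flength a b"
      by (rule hk_integral_combine) (use uv int in auto)
    ultimately show ?thesis unfolding \<gamma>_def by argo
  qed
  ultimately show ?thesis by simp
next
  case False
  then have min: "\<not> reaches (c u) \<tau> (c v)" if "a \<le> u" "u < v" "v \<le> b" "\<tau> < flength u v" for u v \<tau>
    using that by blast
  show ?thesis
  proof (cases "\<exists>s0\<in>{a..b}. speed s0 > 0")
    case True
    then obtain s0 where "s0 \<in> {a..b}" "speed s0 > 0" by blast
    from reaches_if_not_outrun[OF min this] show ?thesis by blast
  next
    case False
    then have 0: "speed s = 0 \<and> w s = 0" if "s \<in> {a..b}" for s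
    proof -
      have "\<not> speed s > 0" using False that by blast
      then show ?thesis using speed_nonneg[OF that] speed_0_iff[OF that] by simp
    qed
    have "c s = c a" if s: "s \<in> {a..b}" for s
    proof -
      have "(w has_integral x s - x a) {a..s}"
        by (rule fundamental_theorem_of_calculus)
          (use s in \<open>auto intro: has_vector_derivative_within_subset[OF has_vector_derivative_x]\<close>)
      moreover have "(w has_integral 0) {a..s}"
        by (rule has_integral_is_0) (use 0 s in auto)
      ultimately have "x s - x a = 0" by (rule has_integral_unique)
      then have "x s = x a" by simp
      then have "chart_inv d (x s) = chart_inv d (x a)" by (rule arg_cong)
      then show ?thesis
        using chart_inv_map[OF d c_in_dom[OF s]] chart_inv_map[OF d c_in_dom[of a]] ab by (simp add: x_def)
    qed
    moreover have "flength a b = integral {a..b} (\<lambda>_. 0)"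
      by (rule hk_integral_cong) (simp add: fermat_x 0 lform_linear)
    then have "flength a b = 0" by simp
    ultimately show ?thesis by blast
  qed
qed

context som
begin

text \<open>The alternative of the previous lemma is stable under concatenation, so it passes from pieces
  in charts to smooth curves and on to piecewise smooth ones.\<close>

definition stays_or_reaches :: "(real \<Rightarrow> 'a) \<Rightarrow> real \<Rightarrow> real \<Rightarrow> real \<Rightarrow> bool" where
  "stays_or_reaches c u v l \<longleftrightarrow> ((\<forall>s\<in>{u..v}. c s = c u) \<and> l = 0) \<or> reaches (c u) l (c v)"

lemma stays_or_reaches_trans:
  assumes "stays_or_reaches c u v l" "stays_or_reaches c v w l'" "u \<le> v" "v \<le> w"
  shows "stays_or_reaches c u w (l + l')"
proof -
  have ends: "v \<in> {u..v}" "w \<in> {v..w}" using assms by simp_all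
  have split: "s \<in> {u..v} \<or> s \<in> {v..w}" if "s \<in> {u..w}" for s using that by auto
  consider "\<forall>s\<in>{u..v}. c s = c u" "l = 0" "\<forall>s\<in>{v..w}. c s = c v" "l' = 0"
    | "\<forall>s\<in>{u..v}. c s = c u" "l = 0" "reaches (c v) l' (c w)"
    | "reaches (c u) l (c v)" "\<forall>s\<in>{v..w}. c s = c v" "l' = 0"
    | "reaches (c u) l (c v)" "reaches (c v) l' (c w)"
    using assms(1,2) unfolding stays_or_reaches_def by blast
  then show ?thesis
  proof cases
    case 1
    have "c s = c u" if s: "s \<in> {u..w}" for s
      using split[OF s] 1(1,3) ends(1) by metis
    moreover have "l + l' = 0" using 1 by simp
    ultimately show ?thesis unfolding stays_or_reaches_def by blast
  next
    case 2
    have "c v = c u" using 2(1) ends(1) by blast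
    then show ?thesis using 2(2,3) by (simp add: stays_or_reaches_def)
  next
    case 3
    have "c w = c v" using 3(2) ends(2) by blast
    then show ?thesis using 3(1,3) by (simp add: stays_or_reaches_def)
  next
    case 4
    from reaches_trans[OF this] show ?thesis unfolding stays_or_reaches_def by blast
  qed
qed

lemma stays_or_reaches_smooth:
  assumes c: "smooth_curve_on A {a..b} c" and ab: "a < b"
  shows "stays_or_reaches c a b (integral {a..b} (\<lambda>s. F (c s) (velocity A {a..b} c s)))"
proof -
  have Iab: "derivative_unique_on {a..b}" using ab by (rule derivative_unique_on_Icc)
  define f where "f s = F (c s) (velocity A {a..b} c s)" for s
  define a0 b0 where "a0 = a" and "b0 = b"
  have fc: "continuous_on {a..b} f"
    unfolding f_def by (rule continuous_on_fermat_velocity[OF c Iab])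
  have int: "f integrable_on {p..q}" if "a0 \<le> p" "q \<le> b0" for p q
    by (rule integrable_continuous_real[OF continuous_on_subset[OF fc]]) (use that in \<open>auto simp: a0_def b0_def\<close>)
  have cc: "continuous_on {a..b} c" using c by (simp add: smooth_curve_on_def)
  have "a0 \<le> a \<longrightarrow> b \<le> b0 \<longrightarrow> stays_or_reaches c a b (integral {a..b} f)"
    using less_imp_le[OF ab]
  proof (induction rule: Bolzano)
    case (trans u v w)
    show ?case
    proof (intro impI)
      assume uw: "a0 \<le> u" "w \<le> b0"
      have "integral {u..v} f + integral {v..w} f = integral {u..w} f"
        by (rule hk_integral_combine) (use uw trans int in auto)
      moreover have "stays_or_reaches c u w (integral {u..v} f + integral {v..w} f)"
        using trans uw by (intro stays_or_reaches_trans) auto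
      ultimately show "stays_or_reaches c u w (integral {u..w} f)" by simp
    qed
  next
    case (local p)
    obtain d where d: "d \<in> A" "c p \<in> chart_dom d" by (rule chart_at)
    have p: "p \<in> {s \<in> {a..b}. c s \<in> chart_dom d}" using local d by simp
    obtain W where W: "open W" "{s \<in> {a..b}. c s \<in> chart_dom d} = {a..b} \<inter> W"
      using curve_chart_domain[OF cc d(1)] by (auto simp: openin_open)
    obtain \<delta> where \<delta>: "\<delta> > 0" "ball p \<delta> \<subseteq> W" using W p openE by blast
    show ?case
    proof (intro exI[of _ \<delta>] conjI \<delta>(1) allI impI)
      fix u v assume uv: "u \<le> p \<and> p \<le> v \<and> v - u < \<delta>" "a0 \<le> u" "v \<le> b0"
      show "stays_or_reaches c u v (integral {u..v} f)"
      proof (cases "u < v")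
        case True
        have sub: "{u..v} \<subseteq> {a..b}" using uv by (auto simp: a0_def b0_def)
        have J: "derivative_unique_on {u..v}" using True by (rule derivative_unique_on_Icc)
        have "{u..v} \<subseteq> ball p \<delta>" using uv by (auto simp: dist_real_def)
        then have "{u..v} \<subseteq> {s \<in> {a..b}. c s \<in> chart_dom d}" using \<delta>(2) sub unfolding W(2) by blast
        then have dom: "c ` {u..v} \<subseteq> chart_dom d" by blast
        have eq: "integral {u..v} (\<lambda>s. F (c s) (velocity A {u..v} c s)) = integral {u..v} f"
          unfolding f_def using velocity_subset[OF c Iab sub J]
          by (intro hk_integral_cong) simp
        interpret chart_curve A \<beta> \<omega> g0 d u v c
          by unfold_locales (use d(1) True smooth_curve_on_subset[OF c sub J] dom in auto)
        show ?thesis using constant_or_reaches unfolding stays_or_reaches_def eq .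
      next
        case False
        then have "u = v" using uv by simp
        then show ?thesis by (simp add: stays_or_reaches_def)
      qed
    qed
  qed
  then show ?thesis by (simp add: a0_def b0_def f_def[abs_def])
qed

lemma stays_or_reaches_piecewise:
  assumes "piecewise_smooth_curve A a b c"
  shows "stays_or_reaches c a b (curve_length A F a b c)"
proof -
  define f where "f s = F (c s) (velocity A {a..b} c s)" for s
  from assms have "f integrable_on {a..b} \<and> stays_or_reaches c a b (integral {a..b} f)"
    unfolding piecewise_smooth_curve_def
  proof (induction rule: piecewise_induct)
    case (piece u v)
    have "(f has_integral integral {u..v} (\<lambda>s. F (c s) (velocity A {u..v} c s))) {u..v}"
      unfolding f_def by (rule has_integral_piece) (use piece in auto)
    moreover from this have "integral {u..v} f = integral {u..v} (\<lambda>s. F (c s) (velocity A {u..v} c s))"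
      by (rule integral_unique)
    ultimately show ?case using stays_or_reaches_smooth[of u v c] piece by auto
  next
    case (append u v w)
    have "(f has_integral (integral {u..v} f + integral {v..w} f)) {u..w}"
      by (rule has_integral_combine[of u v w]) (use append in auto)
    moreover from this have "integral {u..w} f = integral {u..v} f + integral {v..w} f"
      by (rule integral_unique)
    moreover have "stays_or_reaches c u w (integral {u..v} f + integral {v..w} f)"
      using append by (intro stays_or_reaches_trans) auto
    ultimately show ?case by auto
  qed
  then show ?thesis by (simp add: curve_length_def f_def[abs_def])
qed

text \<open>A travel that returns before it starts can wait at \<open>x\<close> until it closes up.\<close>

lemma not_reaches_if_causal:
  assumes "causal_spacetime (som_atlas A) g (d_dt A)" "\<tau> \<le> 0"
  shows "\<not> reaches x \<tau> x"
proof
  assume "reaches x \<tau> x"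
  then have "reaches x 0 x"
    using reaches_trans[OF reaches_stay[of "- \<tau>" x], of \<tau> x] assms(2) by (cases "\<tau> = 0") auto
  then obtain a b \<gamma> where "piecewise (future_piece \<gamma>) a b" "\<gamma> a = (0, x)" "\<gamma> b = (0 + 0, x)"
    unfolding reaches_def by blast
  then have "causal_curve (som_atlas A) g (d_dt A) a b \<gamma>" "\<gamma> a = \<gamma> b"
    by (simp_all add: causal_curve_def future_piece_def[abs_def])
  then show False using assms(1) unfolding causal_spacetime_def by blast
qed

lemma piecewise_smooth_const:
  assumes "a < b" shows "piecewise_smooth_curve A a b (\<lambda>_. x)" "curve_length A F a b (\<lambda>_. x) = 0"
proof -
  have I: "derivative_unique_on {a..b}" using assms by (rule derivative_unique_on_Icc)
  show "piecewise_smooth_curve A a b (\<lambda>_. x)"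
    unfolding piecewise_smooth_curve_def
    by (intro piecewise_single assms smooth_curve_on_const I)
  have "curve_length A F a b (\<lambda>_. x) = integral {a..b} (\<lambda>_. 0)"
    unfolding curve_length_def
    by (rule hk_integral_cong) (simp add: velocity_const[OF I] fermat_0)
  then show "curve_length A F a b (\<lambda>_. x) = 0" by simp
qed

lemma pre_distance_eq_0_iff:
  "pre_distance A F x x = 0 \<longleftrightarrow>
    (\<forall>a b c. piecewise_smooth_curve A a b c \<longrightarrow> c a = x \<longrightarrow> c b = x \<longrightarrow> curve_length A F a b c \<ge> 0)"
proof
  assume 0: "pre_distance A F x x = 0"
  show "\<forall>a b c. piecewise_smooth_curve A a b c \<longrightarrow> c a = x \<longrightarrow> c b = x \<longrightarrow> curve_length A F a b c \<ge> 0"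
  proof (intro allI impI)
    fix a b c assume "piecewise_smooth_curve A a b c" "c a = x" "c b = x"
    then have "pre_distance A F x x \<le> ereal (curve_length A F a b c)"
      unfolding pre_distance_def by (intro Inf_lower) blast
    then show "curve_length A F a b c \<ge> 0" by (simp add: 0)
  qed
next
  assume R: "\<forall>a b c. piecewise_smooth_curve A a b c \<longrightarrow> c a = x \<longrightarrow> c b = x \<longrightarrow> curve_length A F a b c \<ge> 0"
  show "pre_distance A F x x = 0"
  proof (rule antisym)
    have "pre_distance A F x x \<le> ereal (curve_length A F 0 1 (\<lambda>_. x))"
      unfolding pre_distance_def using piecewise_smooth_const(1)[of 0 1 x] by (intro Inf_lower) force
    then show "pre_distance A F x x \<le> 0" by (simp add: piecewise_smooth_const(2) zero_ereal_def)
    show "0 \<le> pre_distance A F x x"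
      unfolding pre_distance_def using R by (intro Inf_greatest) auto
  qed
qed

lemma linear_on_tangent_space_uminus:
  assumes "linear_on_tangent_space A p L" "v \<in> tangent_space A p"
  shows "L (\<lambda>d. - v d) = - L v"
proof -
  have "L (\<lambda>d. a *\<^sub>R v d + b *\<^sub>R w d) = a * L v + b * L w"
    if "w \<in> tangent_space A p" for w a b
    using assms that unfolding linear_on_tangent_space_def by blast
  from this[OF assms(2), of "- 1" 0] show ?thesis by simp
qed

lemma future_causal_vector_uminus:
  assumes v: "v \<in> tangent_space (som_atlas A) p" and v': "(\<lambda>d. - v d) \<in> tangent_space (som_atlas A) p"
    and past: "past_vector p v"
  shows "future_vector p (\<lambda>d. - v d)"
proof -
  obtain d where d: "d \<in> A" "snd p \<in> chart_dom d" by (rule chart_at)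
  have t: "dt A p (\<lambda>d. - v d) = - dt A p v"
    unfolding dt_eq[OF v d] dt_eq[OF v' d] by simp
  have w: "dproj A p (\<lambda>d. - v d) = (\<lambda>d. - dproj A p v d)"
    unfolding dproj_eq[OF v] dproj_eq[OF v'] by auto
  have w': "(\<lambda>d. - dproj A p v d) \<in> tangent_space A (snd p)"
    using dproj_in_tangent_space[OF v'] by (simp only: w)
  note wT = dproj_in_tangent_space[OF v]
  have om: "\<omega> (snd p) (\<lambda>d. - dproj A p v d) = - \<omega> (snd p) (dproj A p v)"
    by (rule linear_on_tangent_space_uminus[OF \<omega>_linear wT])
  have "g0 (snd p) (\<lambda>d. - dproj A p v d) (\<lambda>d. - dproj A p v d) = g0 (snd p) (dproj A p v) (dproj A p v)"
    using linear_on_tangent_space_uminus[OF g0_linear[OF w'] wT]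
      linear_on_tangent_space_uminus[OF g0_linear[OF wT] wT] g0_sym[OF w' wT] by simp
  then have h: "h (snd p) (\<lambda>d. - dproj A p v d) = h (snd p) (dproj A p v)" by (simp add: h_def om)
  show ?thesis
    using past unfolding causal_vector_iff(1)[OF v' refl] causal_vector_iff(2)[OF v refl] t w om h
    by (simp add: algebra_simps)
qed

lemma future_piece_reverse:
  assumes \<gamma>: "smooth_curve_on (som_atlas A) {u..v} \<gamma>" and uv: "u < v"
    and past: "\<And>s. s \<in> {u..v} \<Longrightarrow> past_vector (\<gamma> s) (velocity (som_atlas A) {u..v} \<gamma> s)"
  shows "future_piece (\<lambda>s. \<gamma> (- s)) {- v..- u}"
proof -
  have J: "{- v..- u} = {s. 0 + (- 1) * s \<in> {u..v}}" by auto
  note aff = M.smooth_curve_on_affine[OF \<gamma> uv _ J]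
  have eq: "(\<lambda>s. \<gamma> (0 + (- 1) * s)) = (\<lambda>s. \<gamma> (- s))" by simp
  have I: "derivative_unique_on {u..v}" "derivative_unique_on {- v..- u}"
    using uv by (simp_all add: derivative_unique_on_Icc)
  have sm: "smooth_curve_on (som_atlas A) {- v..- u} (\<lambda>s. \<gamma> (- s))" using aff(1) unfolding eq by simp
  have "future_vector (\<gamma> (- s)) (velocity (som_atlas A) {- v..- u} (\<lambda>s. \<gamma> (- s)) s)"
    if s: "s \<in> {- v..- u}" for s
  proof -
    have s': "- s \<in> {u..v}" using s by auto
    have vel: "velocity (som_atlas A) {- v..- u} (\<lambda>s. \<gamma> (- s)) s = (\<lambda>d. - velocity (som_atlas A) {u..v} \<gamma> (- s) d)"
      using aff(2)[OF _ s] unfolding eq by simp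
    have "velocity (som_atlas A) {- v..- u} (\<lambda>s. \<gamma> (- s)) s \<in> tangent_space (som_atlas A) (\<gamma> (- s))"
      by (rule M.velocity_in_tangent_space[OF sm I(2) s])
    then show ?thesis unfolding vel
      by (intro future_causal_vector_uminus past s' M.velocity_in_tangent_space[OF \<gamma> I(1) s'])
  qed
  then show ?thesis using sm by (simp add: future_piece_def)
qed

lemma closed_future_curve_if_not_causal:
  assumes "\<not> causal_spacetime (som_atlas A) g (d_dt A)"
  obtains a b \<gamma> where "piecewise (future_piece \<gamma>) a b" "\<gamma> a = \<gamma> b"
proof -
  obtain a b \<gamma> where \<gamma>: "causal_curve (som_atlas A) g (d_dt A) a b \<gamma>" "\<gamma> a = \<gamma> b"
    using assms unfolding causal_spacetime_def by blast
  from \<gamma>(1) consider "piecewise (future_piece \<gamma>) a b"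
    | "piecewise (\<lambda>I. smooth_curve_on (som_atlas A) I \<gamma> \<and>
       (\<forall>s\<in>I. past_vector (\<gamma> s) (velocity (som_atlas A) I \<gamma> s))) a b"
    unfolding causal_curve_def future_piece_def[abs_def] by blast
  then show ?thesis
  proof cases
    case 1
    then show ?thesis using that \<gamma>(2) by blast
  next
    case 2
    then have "piecewise (future_piece (\<lambda>s. \<gamma> (- s))) (- b) (- a)"
      by (rule piecewise_reverse) (auto intro!: future_piece_reverse)
    then show ?thesis using that[of "\<lambda>s. \<gamma> (- s)" "- b" "- a"] \<gamma>(2) by simp
  qed
qed

lemma future_pieceD:
  assumes \<gamma>: "future_piece \<gamma> {u..v}" and uv: "u < v" and c: "c = snd \<circ> \<gamma>"
  obtains t' where "smooth_curve_on A {u..v} c"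
    "\<And>s. s \<in> {u..v} \<Longrightarrow> (fst \<circ> \<gamma> has_vector_derivative t' s) (at s within {u..v})"
    "\<And>s. s \<in> {u..v} \<Longrightarrow> t' s > \<omega> (c s) (velocity A {u..v} c s) / \<beta> (c s)"
    "\<And>s. s \<in> {u..v} \<Longrightarrow> t' s \<ge> F (c s) (velocity A {u..v} c s)"
proof -
  have I: "derivative_unique_on {u..v}" using uv by (rule derivative_unique_on_Icc)
  have sm: "smooth_curve_on (som_atlas A) {u..v} \<gamma>" using \<gamma> by (simp add: future_piece_def)
  let ?t' = "\<lambda>s. dt A (\<gamma> s) (velocity (som_atlas A) {u..v} \<gamma> s)"
  note D = smooth_curve_on_som_atlasD[OF I sm]
  have "\<forall>s\<in>{u..v}. ?t' s > \<omega> (c s) (velocity A {u..v} c s) / \<beta> (c s) \<and> ?t' s \<ge> F (c s) (velocity A {u..v} c s)"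
    using \<gamma> future_piece_iff[OF I sm D(3) c] by simp
  then show ?thesis using that[of ?t'] D(1) D(3) unfolding c by blast
qed

text \<open>As \<open>t' \<ge> F(c')\<close> and \<open>t\<close> returns to its initial value, the projection \<open>c\<close> has length at most \<open>0\<close>, hence
  length \<open>0\<close>, hence is constant.  But the velocity of a causal curve does not vanish, so then \<open>t' > 0\<close>.\<close>

lemma not_closed_future_curve:
  assumes \<gamma>: "piecewise (future_piece \<gamma>) a b" "\<gamma> a = \<gamma> b"
    and dist: "\<And>x. pre_distance A F x x = 0"
    and const: "\<And>a b c. piecewise_smooth_curve A a b c \<Longrightarrow> c a = c b \<Longrightarrow> curve_length A F a b c = 0 \<Longrightarrow> c constant_on {a..b}"
  shows False
proof -
  define c where "c = snd \<circ> \<gamma>"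
  define f where "f s = F (c s) (velocity A {a..b} c s)" for s
  have c: "piecewise_smooth_curve A a b c"
    unfolding piecewise_smooth_curve_def
  proof (rule piecewise_mono[OF \<gamma>(1)])
    fix u v assume "u < v" "future_piece \<gamma> {u..v}"
    then show "smooth_curve_on A {u..v} c" using future_pieceD[OF _ _ c_def] by blast
  qed
  have "f integrable_on {a..b} \<and> integral {a..b} f \<le> fst (\<gamma> b) - fst (\<gamma> a)"
    using \<gamma>(1)
  proof (induction rule: piecewise_induct)
    case (piece u v)
    obtain t' where t': "smooth_curve_on A {u..v} c"
      "\<And>s. s \<in> {u..v} \<Longrightarrow> (fst \<circ> \<gamma> has_vector_derivative t' s) (at s within {u..v})"
      "\<And>s. s \<in> {u..v} \<Longrightarrow> t' s \<ge> F (c s) (velocity A {u..v} c s)"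
      using future_pieceD[OF piece(4,2) c_def] by metis
    have 1: "(f has_integral integral {u..v} (\<lambda>s. F (c s) (velocity A {u..v} c s))) {u..v}"
      unfolding f_def by (rule has_integral_piece[OF t'(1)]) (use piece in auto)
    have 2: "(t' has_integral (fst \<circ> \<gamma>) v - (fst \<circ> \<gamma>) u) {u..v}"
      by (rule fundamental_theorem_of_calculus[OF less_imp_le[OF piece(2)] t'(2)])
    have "continuous_on {u..v} (\<lambda>s. F (c s) (velocity A {u..v} c s))"
      using piece by (intro continuous_on_fermat_velocity[OF t'(1)] derivative_unique_on_Icc)
    then have "((\<lambda>s. F (c s) (velocity A {u..v} c s)) has_integral integral {u..v} (\<lambda>s. F (c s) (velocity A {u..v} c s))) {u..v}"
      by (intro integrable_integral integrable_continuous_real)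
    from has_integral_le[OF this 2 t'(3)]
    have "integral {u..v} (\<lambda>s. F (c s) (velocity A {u..v} c s)) \<le> fst (\<gamma> v) - fst (\<gamma> u)" by simp
    then show ?case using 1 integral_unique[OF 1] by auto
  next
    case (append u v w)
    have "(f has_integral (integral {u..v} f + integral {v..w} f)) {u..w}"
      by (rule has_integral_combine[of u v w]) (use append in auto)
    moreover from this have "integral {u..w} f = integral {u..v} f + integral {v..w} f"
      by (rule integral_unique)
    ultimately show ?case using append(5,6) by auto
  qed
  then have "curve_length A F a b c \<le> 0" using \<gamma>(2) by (simp add: curve_length_def f_def[abs_def])
  moreover have ends: "c a = c b" using \<gamma>(2) by (simp add: c_def)
  moreover have "curve_length A F a b c \<ge> 0"
    using dist[of "c a", unfolded pre_distance_eq_0_iff] c ends by auto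
  ultimately have "c constant_on {a..b}" using const[OF c] by simp
  then obtain y where y: "\<And>s. s \<in> {a..b} \<Longrightarrow> c s = y" unfolding constant_on_def by blast
  have "fst (\<gamma> a) < fst (\<gamma> b)"
    using \<gamma>(1)
  proof (induction rule: piecewise_induct)
    case (piece u v)
    have I: "derivative_unique_on {u..v}" using piece by (simp add: derivative_unique_on_Icc)
    obtain t' where t': "\<And>s. s \<in> {u..v} \<Longrightarrow> (fst \<circ> \<gamma> has_vector_derivative t' s) (at s within {u..v})"
      "\<And>s. s \<in> {u..v} \<Longrightarrow> t' s > \<omega> (c s) (velocity A {u..v} c s) / \<beta> (c s)"
      using future_pieceD[OF piece(4,2) c_def] by metis
    have pos: "t' s > 0" if s: "s \<in> {u..v}" for s
    proof -
      have "velocity A {u..v} c s = velocity A {u..v} (\<lambda>_. y) s"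
        by (rule velocity_cong[OF y s]) (use piece in auto)
      then have "velocity A {u..v} c s = (\<lambda>_. 0)" using velocity_const[OF I s] by simp
      then show ?thesis using t'(2)[OF s] by (simp add: \<omega>_0)
    qed
    obtain s where s: "s \<in> {u<..<v}" "(fst \<circ> \<gamma>) v - (fst \<circ> \<gamma>) u = (v - u) *\<^sub>R t' s"
      using mvt_simple[OF piece(2), of "fst \<circ> \<gamma>" "\<lambda>s h. h *\<^sub>R t' s"] t'(1)
      unfolding has_vector_derivative_def by auto
    moreover have "(v - u) * t' s > 0" using pos[of s] s piece by simp
    ultimately show ?case by simp
  qed simp
  then show False using \<gamma>(2) by simp
qed

end

theorem proposition3p9:
  fixes A :: "('a::{t2_space, second_countable_topology}, 'e::euclidean_space) chart set"
    and \<beta> :: "'a \<Rightarrow> real"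
    and \<omega> :: "'a \<Rightarrow> ('a, 'e) tangent \<Rightarrow> real"
    and g0 :: "'a \<Rightarrow> ('a, 'e) tangent \<Rightarrow> ('a, 'e) tangent \<Rightarrow> real"
  assumes "som_spacetime A \<beta> \<omega> g0"
  shows "causal_spacetime (som_atlas A) (som_metric A \<beta> \<omega> g0) (d_dt A) \<longleftrightarrow>
    (\<forall>x. pre_distance A (fermat_metric \<beta> \<omega> g0) x x = 0) \<and>
    \<not> (\<exists>a b c. piecewise_smooth_curve A a b c \<and> c a = c b \<and> \<not> c constant_on {a..b} \<and>
           curve_length A (fermat_metric \<beta> \<omega> g0) a b c = 0)"
proof -
  interpret som A \<beta> \<omega> g0 by unfold_locales (rule assms)
  show ?thesis
  proof (intro iffI conjI allI notI)
    assume causal: "causal_spacetime (som_atlas A) g (d_dt A)"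
    have stays: "(\<forall>s\<in>{a..b}. c s = c a) \<and> curve_length A F a b c = 0"
      if "piecewise_smooth_curve A a b c" "c a = c b" "curve_length A F a b c \<le> 0" for a b c
    proof -
      have "\<not> reaches (c a) (curve_length A F a b c) (c b)"
        using not_reaches_if_causal[OF causal that(3), of "c a"] that(2) by metis
      then show ?thesis
        using stays_or_reaches_piecewise[OF that(1)] unfolding stays_or_reaches_def by blast
    qed
    show "pre_distance A F x x = 0" for x
      unfolding pre_distance_eq_0_iff
    proof (intro allI impI)
      fix a b c assume "piecewise_smooth_curve A a b c" "c a = x" "c b = x"
      then show "curve_length A F a b c \<ge> 0"
        using stays[of a b c] by (cases "curve_length A F a b c \<le> 0") auto
    qed
    assume "\<exists>a b c. piecewise_smooth_curve A a b c \<and> c a = c b \<and> \<not> c constant_on {a..b} \<and> curve_length A F a b c = 0"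
    then obtain a b c where c: "piecewise_smooth_curve A a b c" "c a = c b" "\<not> c constant_on {a..b}"
      "curve_length A F a b c = 0" by blast
    then have "\<forall>s\<in>{a..b}. c s = c a" using stays[of a b c] by linarith
    then show False using c(3) unfolding constant_on_def by blast
  next
    assume R: "(\<forall>x. pre_distance A F x x = 0) \<and> \<not> (\<exists>a b c. piecewise_smooth_curve A a b c \<and> c a = c b \<and>
        \<not> c constant_on {a..b} \<and> curve_length A F a b c = 0)"
    show "causal_spacetime (som_atlas A) g (d_dt A)"
    proof (rule ccontr)
      assume "\<not> causal_spacetime (som_atlas A) g (d_dt A)"
      then obtain a b \<gamma> where "piecewise (future_piece \<gamma>) a b" "\<gamma> a = \<gamma> b"
        by (rule closed_future_curve_if_not_causal)
      then show False by (rule not_closed_future_curve) (use R in blast)+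
    qed
  qed
qed

end
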